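(* Let $\{U(t,x)\}_{t\ge0,x\in\mathbb{R}}$ be the solution of the Tricomi equation $\partial_{tt}U=t\,\partial_{xx}U+W$ on $t>0$, $x\in\mathbb{R}$, with zero initial data $U(0,x)=\partial_tU(0,x)=0$, driven by space-time Gaussian white noise $W$. For any $x\in\mathbb{R}$ the stochastic process $\{U(t,x)\}_{t\ge0}$ admits a continuous modification whose paths are Hölder continuous of every order $\gamma<1/2$ on compact time intervals $[0,T]$, $T>0$.
   Context: Let $\mathrm{Ai}$ and $\mathrm{Bi}$ denote the Airy functions. For $s,t\ge 0$ and $\rho>0$ define $$C(t,s,\rho):=-\frac{\pi}{\rho^{2/3}}\left[\mathrm{Bi}(-\rho^{2/3}t)\,\mathrm{Ai}(-\rho^{2/3}s)-\mathrm{Ai}(-\rho^{2/3}t)\,\mathrm{Bi}(-\rho^{2/3}s)\right],$$ and $C(t,s,0):=t-s$. Fix a real, smooth orthonormal basis $\{\psi_m\}_{m\ge1}$ of $L^2([0,+\infty))$ (for instance, a Laguerre basis). Let $\{\varphi_n\}_{n\ge1}$ be the orthonormal basis of $L^2(\mathbb{R})$ made of Hermite functions, enumerated so that $\varphi_n(x)=(2^{n-1}(n-1)!\sqrt{\pi})^{-1/2}H_{n-1}(x)e^{-x^2/2}$, with $H_k$ the physicists' Hermite polynomial of degree $k$. Let $\{\mathtt{z}_{mn}\}_{m,n\ge1}$ be independent standard Gaussian random variables on a probability space $(\Omega,\mathcal{F},\mathbb{P})$. The space-time Gaussian white noise is the formal series $W(t,x)=\sum_{m,n\ge1}\psi_m(t)\varphi_n(x)\mathtt{z}_{mn}$.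 For $N\ge1$ set $W_N(t,x):=\sum_{m,n=1}^N\psi_m(t)\varphi_n(x)\mathtt{z}_{mn}$. Let $U_N$ be the solution of $$\partial_{tt}U_N=t\,\partial_{xx}U_N+W_N\ \ (t>0,\ x\in\mathbb{R}),\qquad U_N(0,x)=0,\ \ \partial_tU_N(0,x)=0,$$ understood $\omega$-wise as a deterministic non-homogeneous Tricomi equation and given by the Fourier representation $$U_N(t,x)=\frac{1}{2\pi}\int_{\mathbb{R}}e^{i\xi x}\int_0^tC(t,s,|\xi|)\,\widehat{W_N}(s,\xi)\,ds\,d\xi,\qquad \widehat{W_N}(s,\xi)=\int_{\mathbb{R}}e^{-i\xi x}W_N(s,x)\,dx.$$ The solution of the stochastic Cauchy problem is by definition the (Gaussian) random field $U(t,x):=\lim_{N\to+\infty}U_N(t,x)$, the limit being in $\mathbb{L}^2(\Omega,\mathcal{F},\mathbb{P})$ for all $t\ge0$, $x\in\mathbb{R}$ (this limit exists). *)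

theory Defs
  imports "HOL-Probability.Probability"
begin

section \<open>Airy functions\<close>

text \<open>
  The functions \<open>airy_f\<close> and \<open>airy_g\<close> are the power series solutions of \<open>w'' = x w\<close>
  with \<open>(w 0, w' 0) = (1, 0)\<close> and \<open>(0, 1)\<close>. The constants \<open>airy_c1\<close> and \<open>airy_c2\<close> are
  \<open>Ai 0\<close> and \<open>- Ai' 0\<close> (Abramowitz and Stegun, 10.4.2 to 10.4.5).
\<close>

definition airy_f :: "real \<Rightarrow> real" where
  "airy_f x = (\<Sum>k. 3 ^ k * pochhammer (1/3) k * x ^ (3 * k) / fact (3 * k))"

definition airy_g :: "real \<Rightarrow> real" where
  "airy_g x = (\<Sum>k. 3 ^ k * pochhammer (2/3) k * x ^ (3 * k + 1) / fact (3 * k + 1))"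

definition airy_c1 :: real where
  "airy_c1 = 3 powr (-2/3) / Gamma (2/3)"

definition airy_c2 :: real where
  "airy_c2 = 3 powr (-1/3) / Gamma (1/3)"

definition Ai :: "real \<Rightarrow> real" where
  "Ai x = airy_c1 * airy_f x - airy_c2 * airy_g x"

definition Bi :: "real \<Rightarrow> real" where
  "Bi x = sqrt 3 * (airy_c1 * airy_f x + airy_c2 * airy_g x)"

definition tricomi_C :: "real \<Rightarrow> real \<Rightarrow> real \<Rightarrow> real" where
  "tricomi_C t s \<rho> =
    (if \<rho> = 0 then t - s
     else - (pi / \<rho> powr (2/3)) *
       (Bi (- (\<rho> powr (2/3)) * t) * Ai (- (\<rho> powr (2/3)) * s)
        - Ai (- (\<rho> powr (2/3)) * t) * Bi (- (\<rho> powr (2/3)) * s)))"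


section \<open>Square-integrable functions, orthonormal bases and smoothness\<close>

definition square_integrable :: "'a measure \<Rightarrow> ('a \<Rightarrow> 'b::{banach, second_countable_topology}) \<Rightarrow> bool" where
  "square_integrable M f \<longleftrightarrow> f \<in> borel_measurable M \<and> integrable M (\<lambda>x. (norm (f x))\<^sup>2)"

definition L2_tendsto ::
  "'a measure \<Rightarrow> (nat \<Rightarrow> 'a \<Rightarrow> 'b::{banach, second_countable_topology}) \<Rightarrow> ('a \<Rightarrow> 'b) \<Rightarrow> bool" where
  "L2_tendsto M X Y \<longleftrightarrow>
     (\<forall>N. square_integrable M (X N)) \<and> square_integrable M Y \<and>
     (\<lambda>N. \<integral>x. (norm (X N x - Y x))\<^sup>2 \<partial>M) \<longlonglongrightarrow> 0"

text \<open>Sequences are indexed from 1; the value at index 0 is irrelevant.\<close>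

definition orthonormal_basis_L2 :: "'a measure \<Rightarrow> (nat \<Rightarrow> 'a \<Rightarrow> real) \<Rightarrow> bool" where
  "orthonormal_basis_L2 M e \<longleftrightarrow>
     (\<forall>m\<ge>1. square_integrable M (e m)) \<and>
     (\<forall>m\<ge>1. \<forall>n\<ge>1. (\<integral>x. e m x * e n x \<partial>M) = (if m = n then 1 else 0)) \<and>
     (\<forall>f. square_integrable M f \<longrightarrow>
        L2_tendsto M (\<lambda>N x. \<Sum>m=1..N. (\<integral>y. f y * e m y \<partial>M) * e m x) f)"

text \<open>
  \<open>D k\<close> is the derivative of order \<open>k\<close>; on a half-line it is one-sided at the end point.
\<close>

definition smooth_within :: "real set \<Rightarrow> (real \<Rightarrow> real) \<Rightarrow> bool" where
  "smooth_within S f \<longleftrightarrow>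
     (\<exists>D :: nat \<Rightarrow> real \<Rightarrow> real. (\<forall>t\<in>S. D 0 t = f t) \<and>
        (\<forall>k. \<forall>t\<in>S. (D k has_real_derivative D (Suc k) t) (at t within S)))"


section \<open>Hermite functions\<close>

text \<open>Physicists' Hermite polynomials, by the Rodrigues formula.\<close>

definition hermite :: "nat \<Rightarrow> real \<Rightarrow> real" where
  "hermite k x = (-1) ^ k * exp (x\<^sup>2) * (deriv ^^ k) (\<lambda>u. exp (- u\<^sup>2)) x"

text \<open>Only used for \<open>n \<ge> 1\<close>, so the subtraction does not truncate.\<close>

definition hermite_fun :: "nat \<Rightarrow> real \<Rightarrow> real" where
  "hermite_fun n x =
     (2 ^ (n - 1) * fact (n - 1) * sqrt pi) powr (-1/2) * hermite (n - 1) x * exp (- x\<^sup>2 / 2)"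


section \<open>Truncated white noise and the approximate solutions\<close>

definition W_trunc ::
  "(nat \<Rightarrow> real \<Rightarrow> real) \<Rightarrow> (nat \<Rightarrow> nat \<Rightarrow> 'a \<Rightarrow> real) \<Rightarrow> nat \<Rightarrow> 'a \<Rightarrow> real \<Rightarrow> real \<Rightarrow> real" where
  "W_trunc \<psi> z N \<omega> t x = (\<Sum>m=1..N. \<Sum>n=1..N. \<psi> m t * hermite_fun n x * z m n \<omega>)"

definition W_trunc_hat ::
  "(nat \<Rightarrow> real \<Rightarrow> real) \<Rightarrow> (nat \<Rightarrow> nat \<Rightarrow> 'a \<Rightarrow> real) \<Rightarrow> nat \<Rightarrow> 'a \<Rightarrow> real \<Rightarrow> real \<Rightarrow> complex" where
  "W_trunc_hat \<psi> z N \<omega> s \<xi> =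
     (\<integral>x. exp (- \<i> * of_real (\<xi> * x)) * of_real (W_trunc \<psi> z N \<omega> s x) \<partial>lborel)"

definition U_trunc ::
  "(nat \<Rightarrow> real \<Rightarrow> real) \<Rightarrow> (nat \<Rightarrow> nat \<Rightarrow> 'a \<Rightarrow> real) \<Rightarrow> nat \<Rightarrow> 'a \<Rightarrow> real \<Rightarrow> real \<Rightarrow> complex" where
  "U_trunc \<psi> z N \<omega> t x =
     1 / (2 * of_real pi) *
     (\<integral>\<xi>. exp (\<i> * of_real (\<xi> * x)) *
        (LINT s:{0..t}|lborel. of_real (tricomi_C t s \<bar>\<xi>\<bar>) * W_trunc_hat \<psi> z N \<omega> s \<xi>) \<partial>lborel)"

text \<open>
  \<open>U\<close> is a real field, whereas the Fourier representation is written with complex integrals,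
  so the limit is taken in the complex \<open>L\<^sup>2\<close> space.
\<close>

definition tricomi_solution ::
  "'a measure \<Rightarrow> (nat \<Rightarrow> real \<Rightarrow> real) \<Rightarrow> (nat \<Rightarrow> nat \<Rightarrow> 'a \<Rightarrow> real) \<Rightarrow>
   (real \<Rightarrow> real \<Rightarrow> 'a \<Rightarrow> real) \<Rightarrow> bool" where
  "tricomi_solution M \<psi> z U \<longleftrightarrow>
     (\<forall>t\<ge>0. \<forall>x. U t x \<in> borel_measurable M \<and>
        L2_tendsto M (\<lambda>N \<omega>. U_trunc \<psi> z N \<omega> t x) (\<lambda>\<omega>. complex_of_real (U t x \<omega>)))"


section \<open>Modifications and path regularity\<close>

definition modification_on ::
  "'a measure \<Rightarrow> 'i set \<Rightarrow> ('i \<Rightarrow> 'a \<Rightarrow> real) \<Rightarrow> ('i \<Rightarrow> 'a \<Rightarrow> real) \<Rightarrow> bool" where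
  "modification_on M I V X \<longleftrightarrow>
     (\<forall>t\<in>I. V t \<in> borel_measurable M \<and> (AE \<omega> in M. V t \<omega> = X t \<omega>))"

definition hoelder_on :: "real \<Rightarrow> real set \<Rightarrow> (real \<Rightarrow> real) \<Rightarrow> bool" where
  "hoelder_on \<gamma> S f \<longleftrightarrow> (\<exists>K. \<forall>s\<in>S. \<forall>t\<in>S. \<bar>f s - f t\<bar> \<le> K * \<bar>s - t\<bar> powr \<gamma>)"

end

theory Submission
  imports Defs
begin

text \<open>
  For fixed \<open>x\<close> the solution is a Gaussian process in \<open>t\<close>, so its path regularity is decided by the
  variance of its increments: if \<open>E \<bar>U t x - U s x\<bar>\<^sup>2 \<le> K \<bar>t - s\<bar> ^ (1 - 2 \<epsilon>)\<close> for every \<open>\<epsilon> > 0\<close> on bounded time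
  intervals, then all even moments satisfy the corresponding bounds (\<open>gaussian_sum_moment\<close>) and the
  Kolmogorov continuity theorem (\<open>kolmogorov_chentsov\<close>) gives a modification that is Hoelder continuous
  of every order below \<open>1/2\<close>.

  The variance is computed on the approximations. Each of them is a finite sum of the independent
  Gaussian variables \<open>z m n\<close>, with coefficients that are inner products of the kernel with the
  \<open>\<psi> m\<close> in time and with the Hermite functions in frequency, because the Hermite functions are, up to
  constant factors of equal modulus, their own Fourier transforms (\<open>hermite_fun_fourier\<close>). Bessel's inequality in each of
  the two variables (\<open>mode_coeff_sum_le\<close>) bounds the variance of an increment, uniformly in the
  truncation, by the integral over frequencies \<open>\<xi>\<close> and noise times \<open>r\<close> of the square of
  \<open>D = C(t,r,\<bar>\<xi>\<bar>) 1{r \<le> t} - C(s,r,\<bar>\<xi>\<bar>) 1{r \<le> s}\<close>. Moment bounds survive the passage to the mean square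
  limit (\<open>L2_limit_moment_bound\<close>).

  It remains to bound the kernel, and here only the differential equation is used: \<open>y = C(\<cdot>,r,\<rho>)\<close> solves
  \<open>y'' = - \<rho>\<^sup>2 t y\<close> with \<open>y = 0\<close>, \<open>y' = 1\<close> at time \<open>r\<close> (\<open>tricomi_C_ode\<close>). Monotone energies give
  \<open>\<bar>y\<bar> \<le> 1 / (\<rho> \<surd>r)\<close>, \<open>\<bar>y'\<bar> \<le> \<surd>(t / r)\<close> and \<open>\<bar>y\<bar> \<le> t - r\<close> (\<open>tricomi_ode_bounds\<close>), hence \<open>D\<^sup>2\<close> is at most of
  the orders \<open>1 / ((1 + \<rho>\<^sup>2) r)\<close>, \<open>(t - s)\<^sup>2 / r\<close> and \<open>1\<close>. Using the first two with equal weights would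
  give the integral of order \<open>t - s\<close>, were it not for the logarithmic divergences at \<open>\<rho> = \<infinity>\<close> and
  \<open>r = 0\<close>. Shifting the weights by multiples of \<open>\<epsilon>\<close> and using the third bound removes both at the price
  of the exponent \<open>1 - 2 \<epsilon>\<close> (\<open>tricomi_increment_sq_le\<close>), which is harmless since the assertion concerns
  orders strictly below \<open>1/2\<close>.
\<close>

section \<open>Hoelder continuous modifications\<close>

definition dyadic_floor :: "nat \<Rightarrow> real \<Rightarrow> real" where
  "dyadic_floor n t = real_of_int \<lfloor>2 ^ n * t\<rfloor> / 2 ^ n"

lemma dyadic_floor_le: "dyadic_floor n t \<le> t"
proof -
  have "real_of_int \<lfloor>2 ^ n * t\<rfloor> \<le> 2 ^ n * t" by linarith
  thus ?thesis by (simp add: dyadic_floor_def divide_le_eq mult.commute)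
qed

lemma dyadic_floor_gt: "t - 1 / 2 ^ n < dyadic_floor n t"
proof -
  have "2 ^ n * t - 1 < real_of_int \<lfloor>2 ^ n * t\<rfloor>" by linarith
  hence "(2 ^ n * t - 1) / 2 ^ n < dyadic_floor n t"
    unfolding dyadic_floor_def by (intro divide_strict_right_mono) auto
  thus ?thesis by (simp add: diff_divide_distrib)
qed

lemma dyadic_floor_nonneg: "0 \<le> t \<Longrightarrow> 0 \<le> dyadic_floor n t"
  by (simp add: dyadic_floor_def)

lemma dyadic_floor_nat:
  assumes "0 \<le> t"
  obtains k :: nat where "\<lfloor>2 ^ n * t\<rfloor> = int k" "dyadic_floor n t = real k / 2 ^ n"
proof -
  have "0 \<le> \<lfloor>2 ^ n * t\<rfloor>" using assms by simp
  then obtain k where "\<lfloor>2 ^ n * t\<rfloor> = int k" using nonneg_int_cases by blast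
  thus thesis using that[of k] by (simp add: dyadic_floor_def)
qed

lemma dyadic_scale_obtain:
  fixes h :: real
  assumes "0 < h" "h \<le> 1"
  obtains n :: nat where "h \<le> 1 / 2 ^ n" "1 / 2 ^ n < 2 * h"
proof -
  have ex: "\<exists>n::nat. 1 / 2 ^ n < 2 * h"
    using assms real_arch_pow_inv[of "2 * h" "1/2"] by (auto simp: power_one_over)
  define n where "n = (LEAST n::nat. 1 / 2 ^ n < 2 * h)"
  have n: "1 / 2 ^ n < 2 * h" unfolding n_def by (rule LeastI_ex[OF ex])
  have "h \<le> 1 / 2 ^ n"
  proof (cases n)
    case 0 thus ?thesis using assms by simp
  next
    case (Suc m)
    hence "\<not> 1 / 2 ^ m < 2 * h" using not_less_Least[of m "\<lambda>n. 1 / 2 ^ n < 2 * h"]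
      by (auto simp: n_def)
    thus ?thesis using Suc by (simp add: field_simps)
  qed
  thus thesis using that n by blast
qed

text \<open>
  Passing from one dyadic approximation of a point to the next moves it by at most one edge of the
  finer grid, so the values at the approximations converge geometrically. Two points at distance
  about \<open>2 ^ (- n)\<close> have level-\<open>n\<close> approximations that coincide or are neighbours, so comparing
  both limits with level \<open>n\<close> gives the Hoelder bound. Taking the limit along \<^const>\<open>dyadic_floor\<close>
  defines the extension at every point at once, without a separate step from the dyadic rationals.
\<close>

lemma dyadic_chaining:
  fixes f :: "real \<Rightarrow> real" and A \<gamma> :: real and N :: nat
  assumes \<gamma>: "0 < \<gamma>" and A: "0 \<le> A"
    and step: "\<And>n k. k < N * 2 ^ n \<Longrightarrow>
      \<bar>f (real (Suc k) / 2 ^ n) - f (real k / 2 ^ n)\<bar> \<le> A * (2 powr - \<gamma>) ^ n"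
  shows "\<And>t. t \<in> {0..real N} \<Longrightarrow> convergent (\<lambda>n. f (dyadic_floor n t))"
    and "hoelder_on \<gamma> {0..real N} (\<lambda>t. lim (\<lambda>n. f (dyadic_floor n t)))"
proof -
  define r where "r = (2::real) powr - \<gamma>"
  have r: "0 < r" "r < 1" using \<gamma> by (auto simp: r_def powr_less_one)
  \<comment> \<open>the tail of the geometric series, a potential whose drop pays for each refinement\<close>
  define u where "u n = A * r ^ n / (1 - r)" for n
  have u_nonneg: "0 \<le> u n" for n using r A by (simp add: u_def)
  have u_diff: "u n - u (Suc n) = A * r ^ n" for n
  proof -
    have "u n - u (Suc n) = (A * r ^ n - A * r ^ Suc n) / (1 - r)"
      by (simp only: u_def diff_divide_distrib)
    also have "A * r ^ n - A * r ^ Suc n = A * r ^ n * (1 - r)"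
      by (simp add: algebra_simps)
    finally show ?thesis using r by simp
  qed
  define g where "g n t = f (dyadic_floor n t)" for n t
  have edge: "\<bar>f (real (Suc k) / 2 ^ n) - f (real k / 2 ^ n)\<bar> \<le> A * r ^ n"
    if "real (Suc k) / 2 ^ n \<le> real N" for k n
  proof -
    have "real (Suc k) \<le> real (N * 2 ^ n)" using that by (simp add: field_simps)
    thus ?thesis using step[of k n] unfolding r_def by linarith
  qed
  have refine: "\<bar>g (Suc n) t - g n t\<bar> \<le> u n - u (Suc n)" if t: "t \<in> {0..real N}" for n t
  proof -
    obtain k where k: "\<lfloor>2 ^ n * t\<rfloor> = int k" "dyadic_floor n t = real k / 2 ^ n"
      using t dyadic_floor_nat by auto
    have "\<lfloor>2 ^ Suc n * t\<rfloor> = 2 * int k \<or> \<lfloor>2 ^ Suc n * t\<rfloor> = 2 * int k + 1"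
      using k(1) by (simp add: floor_eq_iff) linarith
    thus ?thesis
    proof
      assume "\<lfloor>2 ^ Suc n * t\<rfloor> = 2 * int k"
      hence "dyadic_floor (Suc n) t = dyadic_floor n t"
        using k by (simp add: dyadic_floor_def)
      thus ?thesis using u_diff[of n] A r by (simp add: g_def)
    next
      assume "\<lfloor>2 ^ Suc n * t\<rfloor> = 2 * int k + 1"
      hence *: "dyadic_floor (Suc n) t = real (Suc (2 * k)) / 2 ^ Suc n"
        by (simp add: dyadic_floor_def)
      have **: "dyadic_floor n t = real (2 * k) / 2 ^ Suc n" using k by simp
      have "\<bar>g (Suc n) t - g n t\<bar> \<le> A * r ^ Suc n"
        unfolding g_def * ** by (rule edge) (use dyadic_floor_le[of "Suc n" t] * t in auto)
      also have "\<dots> \<le> A * r ^ n" using r A by (intro mult_left_mono power_decreasing) auto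
      finally show ?thesis using u_diff by simp
    qed
  qed
  have gap: "\<bar>g (n + k) t - g n t\<bar> \<le> u n - u (n + k)" if "t \<in> {0..real N}" for n k t
  proof (induction k)
    case (Suc k)
    show ?case using Suc refine[OF that, of "n + k"] by simp
  qed simp
  have u_le: "\<bar>g m t - g n t\<bar> \<le> u n" if "t \<in> {0..real N}" "n \<le> m" for n m t
    using gap[OF that(1), of n "m - n"] that(2) u_nonneg[of m] by simp
  have u_lim: "u \<longlonglongrightarrow> 0"
    unfolding u_def using r by (auto intro!: tendsto_eq_intros LIMSEQ_power_zero)
  have conv: "convergent (\<lambda>n. g n t)" if t: "t \<in> {0..real N}" for t
  proof (rule Cauchy_convergent, rule metric_CauchyI)
    fix e :: real assume "0 < e"
    hence "\<forall>\<^sub>F n in sequentially. u n < e / 2" using u_lim by (intro order_tendstoD) auto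
    then obtain n where n: "u n < e / 2" by (auto simp: eventually_sequentially)
    have "dist (g m t) (g m' t) < e" if "n \<le> m" "n \<le> m'" for m m'
      using u_le[OF t that(1)] u_le[OF t that(2)] n by (simp add: dist_real_def)
    thus "\<exists>M. \<forall>m\<ge>M. \<forall>n\<ge>M. dist (g m t) (g n t) < e" by blast
  qed
  thus "convergent (\<lambda>n. f (dyadic_floor n t))" if "t \<in> {0..real N}" for t
    using that by (simp add: g_def)
  define V where "V t = lim (\<lambda>n. g n t)" for t
  have V_gap: "\<bar>V t - g n t\<bar> \<le> u n" if t: "t \<in> {0..real N}" for n t
  proof (rule LIMSEQ_le_const2)
    show "(\<lambda>m. \<bar>g m t - g n t\<bar>) \<longlonglongrightarrow> \<bar>V t - g n t\<bar>"
      using conv[OF t] unfolding V_def convergent_LIMSEQ_iff by (intro tendsto_intros)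
    show "\<exists>k. \<forall>m\<ge>k. \<bar>g m t - g n t\<bar> \<le> u n" using u_le[OF t] by blast
  qed
  define K1 where "K1 = A * (1 + 2 / (1 - r)) * 2 powr \<gamma>"
  define K2 where "K2 = 2 * u 0 + 2 * (real N * A)"
  have close: "\<bar>V t - V s\<bar> \<le> K1 * (t - s) powr \<gamma>"
    if st: "0 \<le> s" "s < t" "t \<le> real N" "t - s \<le> 1" for s t
  proof -
    obtain n where n: "t - s \<le> 1 / 2 ^ n" "1 / 2 ^ n < 2 * (t - s)"
      using st dyadic_scale_obtain[of "t - s"] by auto
    obtain k where k: "\<lfloor>2 ^ n * s\<rfloor> = int k" "dyadic_floor n s = real k / 2 ^ n"
      using st dyadic_floor_nat by auto
    have "2 ^ n * s < 2 ^ n * t" "2 ^ n * t \<le> 2 ^ n * s + 1"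
      using n(1) st by (auto simp: field_simps)
    moreover have "real k \<le> 2 ^ n * s" "2 ^ n * s < real k + 1"
      using k(1) by (simp_all add: floor_eq_iff)
    ultimately have "\<lfloor>2 ^ n * t\<rfloor> = int k \<or> \<lfloor>2 ^ n * t\<rfloor> = int (Suc k)"
      using \<open>2 ^ n * s < 2 ^ n * t\<close>
      by (cases "2 ^ n * t < real k + 1") (simp_all only: floor_eq_iff of_int_of_nat_eq of_nat_Suc, linarith+)
    hence "\<bar>g n t - g n s\<bar> \<le> A * r ^ n"
    proof
      assume "\<lfloor>2 ^ n * t\<rfloor> = int k"
      hence "g n t = g n s" using k by (simp add: g_def dyadic_floor_def)
      thus ?thesis using A r by simp
    next
      assume "\<lfloor>2 ^ n * t\<rfloor> = int (Suc k)"
      hence *: "dyadic_floor n t = real (Suc k) / 2 ^ n" by (simp add: dyadic_floor_def)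
      show ?thesis unfolding g_def * k(2)
        by (rule edge) (use dyadic_floor_le[of n t] * st in auto)
    qed
    hence "\<bar>V t - V s\<bar> \<le> A * r ^ n + 2 * u n"
      using V_gap[of t n] V_gap[of s n] st by auto
    also have "\<dots> = A * (1 + 2 / (1 - r)) * r ^ n" by (simp add: u_def algebra_simps)
    also have "r ^ n \<le> 2 powr \<gamma> * (t - s) powr \<gamma>"
    proof -
      have "r ^ n = (1 / 2 ^ n) powr \<gamma>"
      proof -
        have "r ^ n = 2 powr (- \<gamma> * real n)"
          unfolding r_def by (subst powr_powr[symmetric]) (simp add: powr_realpow)
        moreover have "1 / 2 ^ n = (2::real) powr (- real n)"
          by (simp add: powr_minus powr_realpow divide_inverse)
        ultimately show ?thesis by (simp only: powr_powr) (simp add: mult.commute)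
      qed
      also have "\<dots> \<le> (2 * (t - s)) powr \<gamma>" using n \<gamma> by (intro powr_mono2) auto
      also have "\<dots> = 2 powr \<gamma> * (t - s) powr \<gamma>" by (rule powr_mult)
      finally show ?thesis .
    qed
    finally show ?thesis using A r by (simp add: K1_def mult_left_mono mult.assoc)
  qed
  have int_grid: "\<bar>f (real k) - f 0\<bar> \<le> real k * A" if "k \<le> N" for k
    using that
  proof (induction k)
    case (Suc k)
    thus ?case using edge[of k 0] by (simp add: algebra_simps)
  qed simp
  have far: "\<bar>V t - V s\<bar> \<le> K2 * (t - s) powr \<gamma>"
    if st: "0 \<le> s" "s < t" "t \<le> real N" "1 \<le> t - s" for s t
  proof -
    have "\<bar>g 0 x - f 0\<bar> \<le> real N * A" if x: "x \<in> {0..real N}" for x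
    proof -
      obtain k where k: "dyadic_floor 0 x = real k"
        by (rule dyadic_floor_nat[of x 0]) (use x in auto)
      hence "k \<le> N" using dyadic_floor_le[of 0 x] x by simp
      thus ?thesis using int_grid[of k] k A mult_right_mono[of "real k" "real N" A]
        by (simp add: g_def)
    qed
    hence "\<bar>g 0 t - f 0\<bar> \<le> real N * A" "\<bar>g 0 s - f 0\<bar> \<le> real N * A"
      using st by auto
    moreover have "\<bar>V t - g 0 t\<bar> \<le> u 0" "\<bar>V s - g 0 s\<bar> \<le> u 0"
      using st by (auto intro!: V_gap)
    ultimately have "\<bar>V t - V s\<bar> \<le> K2" unfolding K2_def by linarith
    also have "\<dots> \<le> K2 * (t - s) powr \<gamma>"
    proof -
      have "1 \<le> (t - s) powr \<gamma>" "0 \<le> K2"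
        using st \<gamma> A u_nonneg[of 0] by (auto simp: K2_def intro!: ge_one_powr_ge_zero)
      thus ?thesis using mult_left_mono[of 1 "(t - s) powr \<gamma>" K2] by simp
    qed
    finally show ?thesis .
  qed
  have main: "\<bar>V t - V s\<bar> \<le> (K1 + K2) * \<bar>t - s\<bar> powr \<gamma>"
    if st: "0 \<le> s" "s < t" "t \<le> real N" for s t
  proof -
    have "0 \<le> K1" "0 \<le> K2" using A r u_nonneg[of 0] by (auto simp: K1_def K2_def)
    hence "K1 * (t - s) powr \<gamma> \<le> (K1 + K2) * (t - s) powr \<gamma>"
      "K2 * (t - s) powr \<gamma> \<le> (K1 + K2) * (t - s) powr \<gamma>" by (auto intro!: mult_right_mono)
    moreover have "\<bar>V t - V s\<bar> \<le> K1 * (t - s) powr \<gamma> \<or> \<bar>V t - V s\<bar> \<le> K2 * (t - s) powr \<gamma>"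
      using close[OF st] far[OF st] by linarith
    moreover have "\<bar>t - s\<bar> = t - s" using st by simp
    ultimately show ?thesis by linarith
  qed
  have "\<bar>V s - V t\<bar> \<le> (K1 + K2) * \<bar>s - t\<bar> powr \<gamma>" if "s \<in> {0..real N}" "t \<in> {0..real N}" for s t
    using main[of s t] main[of t s] that
    by (cases s t rule: linorder_cases) (auto simp: abs_minus_commute)
  thus "hoelder_on \<gamma> {0..real N} (\<lambda>t. lim (\<lambda>n. f (dyadic_floor n t)))"
    unfolding hoelder_on_def V_def g_def by blast
qed

lemma hoelder_on_mono:
  assumes "hoelder_on \<gamma>' {0..T'} f" "0 < \<gamma>" "\<gamma> \<le> \<gamma>'" "T \<le> T'" "0 < T'"
  shows "hoelder_on \<gamma> {0..T} f"
proof -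
  obtain K where K: "\<And>s t. s \<in> {0..T'} \<Longrightarrow> t \<in> {0..T'} \<Longrightarrow> \<bar>f s - f t\<bar> \<le> K * \<bar>s - t\<bar> powr \<gamma>'"
    using assms(1) unfolding hoelder_on_def by blast
  have "\<bar>f s - f t\<bar> \<le> (\<bar>K\<bar> * T' powr (\<gamma>' - \<gamma>)) * \<bar>s - t\<bar> powr \<gamma>"
    if st: "s \<in> {0..T}" "t \<in> {0..T}" for s t
  proof -
    have "\<bar>f s - f t\<bar> \<le> K * \<bar>s - t\<bar> powr \<gamma>'" using K[of s t] st assms by auto
    also have "\<dots> \<le> \<bar>K\<bar> * \<bar>s - t\<bar> powr \<gamma>'" by (intro mult_right_mono) auto
    also have "\<bar>s - t\<bar> powr \<gamma>' = \<bar>s - t\<bar> powr (\<gamma>' - \<gamma>) * \<bar>s - t\<bar> powr \<gamma>"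
      by (simp flip: powr_add)
    also have "\<dots> \<le> T' powr (\<gamma>' - \<gamma>) * \<bar>s - t\<bar> powr \<gamma>"
      using st assms by (intro mult_right_mono powr_mono2) auto
    finally show ?thesis by (simp add: mult.assoc mult_left_mono)
  qed
  thus ?thesis unfolding hoelder_on_def by blast
qed

lemma hoelder_on_imp_continuous_on:
  assumes "hoelder_on \<gamma> S f" "0 < \<gamma>"
  shows "continuous_on S f"
proof -
  obtain K where K: "\<And>s t. s \<in> S \<Longrightarrow> t \<in> S \<Longrightarrow> \<bar>f s - f t\<bar> \<le> K * \<bar>s - t\<bar> powr \<gamma>"
    using assms(1) unfolding hoelder_on_def by blast
  have "(f \<longlongrightarrow> f t) (at t within S)" if t: "t \<in> S" for t
  proof (subst tendsto_dist_iff, rule tendsto_sandwich[where f = "\<lambda>_. 0"])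
    show "\<forall>\<^sub>F s in at t within S. dist (f s) (f t) \<le> K * \<bar>s - t\<bar> powr \<gamma>"
      unfolding eventually_at_filter using K t by (auto intro!: always_eventually simp: dist_real_def)
    have "((\<lambda>s. K * \<bar>s - t\<bar> powr \<gamma>) \<longlongrightarrow> K * \<bar>t - t\<bar> powr \<gamma>) (at t within S)"
      using assms(2) by (intro tendsto_intros tendsto_powr') auto
    thus "((\<lambda>s. K * \<bar>s - t\<bar> powr \<gamma>) \<longlongrightarrow> 0) (at t within S)" by simp
  qed auto
  thus ?thesis by (simp add: continuous_on_def)
qed

text \<open>
  Level \<open>n\<close> has \<open>N 2 ^ n\<close> edges, each with \<open>q\<close>-th moment at most \<open>K 2 ^ (- n (1 + \<beta>))\<close>. Weighting level
  \<open>n\<close> by \<open>2 ^ (\<gamma> q n)\<close>, the sum over all edges of all levels still has finite expectation because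
  \<open>\<gamma> q < \<beta>\<close>. Wherever this random sum is finite it dominates every single increment.
\<close>

lemma AE_dyadic_increments:
  fixes X :: "real \<Rightarrow> 'a \<Rightarrow> real" and N :: nat
  assumes meas: "\<And>t. 0 \<le> t \<Longrightarrow> X t \<in> borel_measurable M"
    and q: "0 < q" "\<gamma> * q < \<beta>" and K: "0 \<le> K"
    and moment: "\<And>s t. s \<in> {0..real N} \<Longrightarrow> t \<in> {0..real N} \<Longrightarrow> s < t \<Longrightarrow>
      (\<integral>\<^sup>+\<omega>. ennreal (\<bar>X t \<omega> - X s \<omega>\<bar> powr q) \<partial>M) \<le> ennreal (K * (t - s) powr (1 + \<beta>))"
  shows "AE \<omega> in M. \<exists>A\<ge>0. \<forall>n. \<forall>k < N * 2 ^ n.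
    \<bar>X (real (Suc k) / 2 ^ n) \<omega> - X (real k / 2 ^ n) \<omega>\<bar> \<le> A * (2 powr - \<gamma>) ^ n"
proof -
  define d where "d n k \<omega> = \<bar>X (real (Suc k) / 2 ^ n) \<omega> - X (real k / 2 ^ n) \<omega>\<bar>" for n k \<omega>
  define c where "c n = (2::real) powr (\<gamma> * q * real n)" for n
  define S where "S \<omega> = (\<Sum>n. \<Sum>k<N * 2 ^ n. ennreal (c n) * ennreal (d n k \<omega> powr q))" for \<omega>
  define x where "x = (2::real) powr (\<gamma> * q - \<beta>)"
  have x: "0 < x" "x < 1" using q by (auto simp: x_def powr_less_one)
  have [measurable]: "d n k \<in> borel_measurable M" for n k
    unfolding d_def using meas by (intro measurable_abs_powr borel_measurable_abs borel_measurable_diff) auto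
  have [measurable]: "S \<in> borel_measurable M" unfolding S_def by measurable
  have edge: "(\<integral>\<^sup>+\<omega>. ennreal (d n k \<omega> powr q) \<partial>M) \<le> ennreal (K * (1 / 2 ^ n) powr (1 + \<beta>))"
    if "k < N * 2 ^ n" for n k
  proof -
    have "real (Suc k) \<le> real (N * 2 ^ n)" using that by linarith
    hence "real (Suc k) / 2 ^ n \<le> real N" by (simp add: field_simps)
    moreover have "real k / 2 ^ n < real (Suc k) / 2 ^ n" by (simp add: divide_strict_right_mono)
    moreover have "real (Suc k) / 2 ^ n - real k / 2 ^ n = 1 / 2 ^ n"
      by (simp add: field_simps)
    ultimately show ?thesis
      using moment[of "real k / 2 ^ n" "real (Suc k) / 2 ^ n"] unfolding d_def by simp
  qed
  have level: "(\<integral>\<^sup>+\<omega>. (\<Sum>k<N * 2 ^ n. ennreal (c n) * ennreal (d n k \<omega> powr q)) \<partial>M)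
      \<le> ennreal (real N * K * x ^ n)" for n
  proof -
    have "(\<integral>\<^sup>+\<omega>. (\<Sum>k<N * 2 ^ n. ennreal (c n) * ennreal (d n k \<omega> powr q)) \<partial>M)
      = (\<Sum>k<N * 2 ^ n. ennreal (c n) * (\<integral>\<^sup>+\<omega>. ennreal (d n k \<omega> powr q) \<partial>M))"
      by (subst nn_integral_sum) (auto simp: nn_integral_cmult)
    also have "\<dots> \<le> (\<Sum>k<N * 2 ^ n. ennreal (c n) * ennreal (K * (1 / 2 ^ n) powr (1 + \<beta>)))"
      by (intro sum_mono mult_left_mono edge) auto
    also have "\<dots> = ennreal (real (N * 2 ^ n) * (c n * (K * (1 / 2 ^ n) powr (1 + \<beta>))))"
      using K by (simp add: c_def ennreal_mult ennreal_of_nat_eq_real_of_nat ennreal_power)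
    also have "real (N * 2 ^ n) * (c n * (K * (1 / 2 ^ n) powr (1 + \<beta>))) = real N * K * x ^ n"
    proof -
      have "2 ^ n = (2::real) powr real n" by (simp add: powr_realpow)
      moreover have "x ^ n = 2 powr ((\<gamma> * q - \<beta>) * real n)"
        by (simp add: x_def powr_powr flip: powr_realpow)
      moreover have "1 / 2 ^ n = (2::real) powr (- real n)"
        by (simp add: powr_minus powr_realpow divide_inverse)
      hence "(1 / 2 ^ n) powr (1 + \<beta>) = 2 powr (- real n * (1 + \<beta>))"
        by (simp only: powr_powr)
      moreover have "2 powr real n * 2 powr (\<gamma> * q * real n) * 2 powr (- real n * (1 + \<beta>))
          = (2::real) powr ((\<gamma> * q - \<beta>) * real n)"
        by (simp add: algebra_simps flip: powr_add)
      ultimately show ?thesis by (simp add: c_def algebra_simps)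
    qed
    finally show ?thesis .
  qed
  have "(\<integral>\<^sup>+\<omega>. S \<omega> \<partial>M) \<le> (\<Sum>n. ennreal (real N * K * x ^ n))"
    unfolding S_def by (subst nn_integral_suminf) (auto intro!: suminf_le level)
  also have "\<dots> = ennreal (\<Sum>n. real N * K * x ^ n)"
    using x K by (intro suminf_ennreal2) (auto intro!: summable_mult summable_geometric)
  finally have "(\<integral>\<^sup>+\<omega>. S \<omega> \<partial>M) \<noteq> \<infinity>" by (auto simp: top_unique)
  hence "AE \<omega> in M. S \<omega> \<noteq> \<infinity>" by (intro nn_integral_PInf_AE) auto
  thus ?thesis
  proof (eventually_elim, intro exI conjI allI impI)
    fix \<omega> n k assume fin: "S \<omega> \<noteq> \<infinity>" and k: "k < N * 2 ^ n"
    define a where "a = enn2real (S \<omega>)"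
    have a: "0 \<le> a" "S \<omega> = ennreal a" using fin by (auto simp: a_def less_top)
    have "ennreal (c n) * ennreal (d n k \<omega> powr q)
        \<le> (\<Sum>k<N * 2 ^ n. ennreal (c n) * ennreal (d n k \<omega> powr q))"
      using k by (intro member_le_sum) auto
    also have "\<dots> \<le> S \<omega>"
      unfolding S_def using sum_le_suminf[OF summableI, of "{n}"] by simp
    finally have "c n * d n k \<omega> powr q \<le> a"
      using a by (simp add: c_def flip: ennreal_mult)
    hence "d n k \<omega> powr q \<le> a * 2 powr (- (\<gamma> * q * real n))"
      by (simp add: c_def powr_minus field_simps)
    hence "(d n k \<omega> powr q) powr (1 / q) \<le> (a * 2 powr (- (\<gamma> * q * real n))) powr (1 / q)"
      using q by (intro powr_mono2) auto
    also have "\<dots> = a powr (1 / q) * (2 powr - \<gamma>) ^ n"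
      using a q by (simp add: powr_mult powr_powr flip: powr_realpow)
    finally show "\<bar>X (real (Suc k) / 2 ^ n) \<omega> - X (real k / 2 ^ n) \<omega>\<bar>
        \<le> enn2real (S \<omega>) powr (1 / q) * (2 powr - \<gamma>) ^ n"
      using q by (simp add: powr_powr d_def a_def)
  qed auto
qed

text \<open>
  By Fatou's lemma a pointwise limit along the dyadic approximations agrees almost everywhere with
  the value that they approach in the mean of order \<open>q\<close>.
\<close>

lemma AE_eq_dyadic_limit:
  fixes X :: "real \<Rightarrow> 'a \<Rightarrow> real"
  assumes meas: "\<And>t. 0 \<le> t \<Longrightarrow> X t \<in> borel_measurable M"
    and V: "V \<in> borel_measurable M" and lim: "AE \<omega> in M. (\<lambda>n. X (dyadic_floor n t) \<omega>) \<longlonglongrightarrow> V \<omega>"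
    and t: "0 \<le> t" and q: "0 < q" and \<beta>: "0 < \<beta>"
    and moment: "\<And>s. s \<in> {0..<t} \<Longrightarrow>
      (\<integral>\<^sup>+\<omega>. ennreal (\<bar>X t \<omega> - X s \<omega>\<bar> powr q) \<partial>M) \<le> ennreal (K * (t - s) powr \<beta>)"
  shows "AE \<omega> in M. V \<omega> = X t \<omega>"
proof -
  note [measurable] = V meas[OF t] meas[OF dyadic_floor_nonneg[OF t]]
  define D where "D n \<omega> = ennreal (\<bar>X t \<omega> - X (dyadic_floor n t) \<omega>\<bar> powr q)" for n \<omega>
  have le: "(\<integral>\<^sup>+\<omega>. D n \<omega> \<partial>M) \<le> ennreal (K * (t - dyadic_floor n t) powr \<beta>)" for n
    using moment[of "dyadic_floor n t"] dyadic_floor_le[of n t] dyadic_floor_nonneg[OF t, of n]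
    by (cases "dyadic_floor n t = t") (auto simp: D_def)
  have lim0: "(\<lambda>n. ennreal (K * (t - dyadic_floor n t) powr \<beta>)) \<longlonglongrightarrow> 0"
  proof -
    have "(\<lambda>n. t - dyadic_floor n t) \<longlonglongrightarrow> 0"
    proof (rule tendsto_sandwich[where f = "\<lambda>_. 0"])
      show "(\<lambda>n. (1 / 2) ^ n :: real) \<longlonglongrightarrow> 0" by (rule LIMSEQ_power_zero) simp
      show "\<forall>\<^sub>F n in sequentially. t - dyadic_floor n t \<le> (1 / 2) ^ n"
      proof (intro always_eventually allI)
        fix n show "t - dyadic_floor n t \<le> (1 / 2) ^ n"
          using dyadic_floor_gt[of t n] by (simp add: power_one_over)
      qed
      show "\<forall>\<^sub>F n in sequentially. 0 \<le> t - dyadic_floor n t"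
        by (intro always_eventually allI) (simp add: dyadic_floor_le)
    qed simp
    hence "(\<lambda>n. (t - dyadic_floor n t) powr \<beta>) \<longlonglongrightarrow> 0 powr \<beta>"
      by (rule tendsto_powr') (use \<beta> dyadic_floor_le in \<open>auto intro!: always_eventually\<close>)
    hence "(\<lambda>n. K * (t - dyadic_floor n t) powr \<beta>) \<longlonglongrightarrow> K * 0 powr \<beta>"
      by (rule tendsto_mult_left)
    hence "(\<lambda>n. K * (t - dyadic_floor n t) powr \<beta>) \<longlonglongrightarrow> 0" by simp
    thus ?thesis using tendsto_ennrealI by fastforce
  qed
  have "(\<lambda>n. \<integral>\<^sup>+\<omega>. D n \<omega> \<partial>M) \<longlonglongrightarrow> 0"
  proof (rule tendsto_sandwich[OF _ _ tendsto_const lim0])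
    show "\<forall>\<^sub>F n in sequentially. (\<integral>\<^sup>+\<omega>. D n \<omega> \<partial>M) \<le> ennreal (K * (t - dyadic_floor n t) powr \<beta>)"
      by (intro always_eventually allI le)
  qed simp
  hence "liminf (\<lambda>n. \<integral>\<^sup>+\<omega>. D n \<omega> \<partial>M) = 0" by (simp add: lim_imp_Liminf)
  moreover have [measurable]: "D n \<in> borel_measurable M" for n unfolding D_def by measurable
  hence "(\<integral>\<^sup>+\<omega>. liminf (\<lambda>n. D n \<omega>) \<partial>M) \<le> liminf (\<lambda>n. \<integral>\<^sup>+\<omega>. D n \<omega> \<partial>M)"
    by (rule nn_integral_liminf)
  ultimately have "(\<integral>\<^sup>+\<omega>. liminf (\<lambda>n. D n \<omega>) \<partial>M) = 0" by simp
  hence "AE \<omega> in M. liminf (\<lambda>n. D n \<omega>) = 0"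
    by (rule nn_integral_0_iff_AE[THEN iffD1, rotated]) measurable
  with lim show ?thesis
  proof eventually_elim
    case (elim \<omega>)
    have "(\<lambda>n. \<bar>X t \<omega> - X (dyadic_floor n t) \<omega>\<bar>) \<longlonglongrightarrow> \<bar>X t \<omega> - V \<omega>\<bar>"
      by (intro tendsto_intros elim(1))
    hence "(\<lambda>n. \<bar>X t \<omega> - X (dyadic_floor n t) \<omega>\<bar> powr q) \<longlonglongrightarrow> \<bar>X t \<omega> - V \<omega>\<bar> powr q"
      by (rule tendsto_powr') (use q in auto)
    hence "(\<lambda>n. D n \<omega>) \<longlonglongrightarrow> ennreal (\<bar>X t \<omega> - V \<omega>\<bar> powr q)"
      unfolding D_def by (rule tendsto_ennrealI)
    hence "ennreal (\<bar>X t \<omega> - V \<omega>\<bar> powr q) = 0"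
      using elim(2) lim_imp_Liminf[OF trivial_limit_sequentially] by metis
    hence "\<bar>X t \<omega> - V \<omega>\<bar> powr q = 0" by (simp add: ennreal_eq_0_iff)
    thus ?case by simp
  qed
qed

text \<open>
  The modification is the dyadic limit on the event where the increments are controlled for a
  sequence of exponents increasing to \<open>\<gamma>\<^sub>0\<close> and for all time ranges \<open>{0..N}\<close>; these are countably many
  conditions, and every smaller exponent and range is covered by one of them. On a null set
  containing the exceptional event the modification is set to \<open>0\<close>, so that all of its paths are regular.
\<close>

theorem kolmogorov_chentsov:
  fixes X :: "real \<Rightarrow> 'a \<Rightarrow> real"
  assumes meas: "\<And>t. 0 \<le> t \<Longrightarrow> X t \<in> borel_measurable M"
    and \<gamma>0: "0 < \<gamma>\<^sub>0"
    and moment: "\<And>\<gamma> N. 0 < \<gamma> \<Longrightarrow> \<gamma> < \<gamma>\<^sub>0 \<Longrightarrow> \<exists>q \<beta> K. 0 < q \<and> \<gamma> * q < \<beta> \<and> 0 \<le> K \<and>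
      (\<forall>s\<in>{0..real N}. \<forall>t\<in>{0..real N}. s < t \<longrightarrow>
        (\<integral>\<^sup>+\<omega>. ennreal (\<bar>X t \<omega> - X s \<omega>\<bar> powr q) \<partial>M) \<le> ennreal (K * (t - s) powr (1 + \<beta>)))"
  shows "\<exists>V. modification_on M {0..} V X \<and>
    (\<forall>\<omega>\<in>space M. continuous_on {0..} (\<lambda>t. V t \<omega>) \<and>
      (\<forall>\<gamma> T. 0 < \<gamma> \<longrightarrow> \<gamma> < \<gamma>\<^sub>0 \<longrightarrow> 0 < T \<longrightarrow> hoelder_on \<gamma> {0..T} (\<lambda>t. V t \<omega>)))"
proof -
  define g where "g j = \<gamma>\<^sub>0 * (1 - 1 / real (j + 2))" for j :: nat
  have g: "0 < g j" "g j < \<gamma>\<^sub>0" for j using \<gamma>0 by (auto simp: g_def mult_less_cancel_left1)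
  have g_dense: "\<exists>j. \<gamma> \<le> g j" if "\<gamma> < \<gamma>\<^sub>0" for \<gamma>
  proof -
    have "g \<longlonglongrightarrow> \<gamma>\<^sub>0 * (1 - 0)"
      unfolding g_def by (intro tendsto_intros LIMSEQ_ignore_initial_segment[OF lim_1_over_n])
    hence "\<forall>\<^sub>F j in sequentially. \<gamma> < g j" using that by (intro order_tendstoD) auto
    thus ?thesis by (auto simp: eventually_sequentially intro: less_imp_le)
  qed
  define good where "good j N \<omega> \<longleftrightarrow> (\<exists>A\<ge>0. \<forall>n. \<forall>k < N * 2 ^ n.
    \<bar>X (real (Suc k) / 2 ^ n) \<omega> - X (real k / 2 ^ n) \<omega>\<bar> \<le> A * (2 powr - g j) ^ n)" for j N \<omega>
  have AE_good: "AE \<omega> in M. \<forall>j N. good j N \<omega>"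
    unfolding AE_all_countable good_def
  proof (intro allI)
    fix j N
    obtain q \<beta> K where "0 < q" "g j * q < \<beta>" "0 \<le> K" "\<And>s t. s \<in> {0..real N} \<Longrightarrow>
      t \<in> {0..real N} \<Longrightarrow> s < t \<Longrightarrow>
        (\<integral>\<^sup>+\<omega>. ennreal (\<bar>X t \<omega> - X s \<omega>\<bar> powr q) \<partial>M) \<le> ennreal (K * (t - s) powr (1 + \<beta>))"
      using moment[OF g[of j], of N] by blast
    thus "AE \<omega> in M. \<exists>A\<ge>0. \<forall>n. \<forall>k < N * 2 ^ n.
        \<bar>X (real (Suc k) / 2 ^ n) \<omega> - X (real k / 2 ^ n) \<omega>\<bar> \<le> A * (2 powr - g j) ^ n"
      by (intro AE_dyadic_increments[OF meas]) auto
  qed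
  then obtain Z where Z: "Z \<in> null_sets M" "{\<omega> \<in> space M. \<not> (\<forall>j N. good j N \<omega>)} \<subseteq> Z"
    by (auto simp: eventually_ae_filter)
  define G where "G = space M - Z"
  have G: "G \<in> sets M" "\<And>\<omega> j N. \<omega> \<in> G \<Longrightarrow> good j N \<omega>"
    using Z by (auto simp: G_def)
  have AE_G: "AE \<omega> in M. \<omega> \<in> G" using AE_not_in[OF Z(1)] AE_space by eventually_elim (simp add: G_def)
  define V where "V t \<omega> = (if \<omega> \<in> G then lim (\<lambda>n. X (dyadic_floor n t) \<omega>) else 0)" for t \<omega>
  have V_conv: "(\<lambda>n. X (dyadic_floor n t) \<omega>) \<longlonglongrightarrow> V t \<omega>" if \<omega>: "\<omega> \<in> G" and t: "0 \<le> t" for t \<omega>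
  proof -
    obtain N :: nat where "t \<le> real N" using real_arch_simple by blast
    moreover obtain A where "0 \<le> A" "\<And>n k. k < N * 2 ^ n \<Longrightarrow>
        \<bar>X (real (Suc k) / 2 ^ n) \<omega> - X (real k / 2 ^ n) \<omega>\<bar> \<le> A * (2 powr - g 0) ^ n"
      using G(2)[OF \<omega>, of 0 N] unfolding good_def by blast
    ultimately have "convergent (\<lambda>n. X (dyadic_floor n t) \<omega>)"
      using t by (intro dyadic_chaining(1)[OF g(1)[of 0], where f = "\<lambda>t. X t \<omega>"]) auto
    thus ?thesis using \<omega> by (simp add: V_def convergent_LIMSEQ_iff)
  qed
  have V_meas: "V t \<in> borel_measurable M" if "0 \<le> t" for t
    unfolding V_def using G(1) meas[OF dyadic_floor_nonneg[OF that]] by measurable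
  have hoelder: "hoelder_on \<gamma> {0..T} (\<lambda>t. V t \<omega>)" if "0 < \<gamma>" "\<gamma> < \<gamma>\<^sub>0" "0 < T" for \<gamma> T \<omega>
  proof (cases "\<omega> \<in> G")
    case False thus ?thesis by (auto simp: V_def hoelder_on_def intro!: exI[of _ 0])
  next
    case True
    obtain j where j: "\<gamma> \<le> g j" using g_dense[OF \<open>\<gamma> < \<gamma>\<^sub>0\<close>] by blast
    obtain N :: nat where N: "T \<le> real N" using real_arch_simple by blast
    obtain A where A: "0 \<le> A" "\<And>n k. k < N * 2 ^ n \<Longrightarrow>
        \<bar>X (real (Suc k) / 2 ^ n) \<omega> - X (real k / 2 ^ n) \<omega>\<bar> \<le> A * (2 powr - g j) ^ n"
      using G(2)[OF True, of j N] unfolding good_def by blast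
    have "hoelder_on (g j) {0..real N} (\<lambda>t. V t \<omega>)"
      using dyadic_chaining(2)[OF g(1) A] True by (simp add: V_def)
    thus ?thesis by (rule hoelder_on_mono) (use j N that in auto)
  qed
  have cont: "continuous_on {0..} (\<lambda>t. V t \<omega>)" for \<omega>
  proof -
    have "continuous (at t within {0..}) (\<lambda>t. V t \<omega>)" if "0 \<le> t" for t
    proof -
      have "continuous_on {0..t + 1} (\<lambda>t. V t \<omega>)"
        using hoelder_on_imp_continuous_on[OF hoelder[OF g(1) g(2)] g(1)] that by simp
      hence "continuous (at t within {0..t + 1}) (\<lambda>t. V t \<omega>)"
        using that by (simp add: continuous_on_eq_continuous_within)
      moreover have "at t within {0..t + 1} = at t within {0..}"
        by (rule at_within_nhd[of _ "{..<t + 1}"]) auto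
      ultimately show ?thesis by simp
    qed
    thus ?thesis by (simp add: continuous_on_eq_continuous_within)
  qed
  have "AE \<omega> in M. V t \<omega> = X t \<omega>" if t: "0 \<le> t" for t
  proof -
    obtain N :: nat where N: "t \<le> real N" using real_arch_simple by blast
    obtain q \<beta> K where *: "0 < q" "g 0 * q < \<beta>" "\<And>s t. s \<in> {0..real N} \<Longrightarrow>
      t \<in> {0..real N} \<Longrightarrow> s < t \<Longrightarrow>
        (\<integral>\<^sup>+\<omega>. ennreal (\<bar>X t \<omega> - X s \<omega>\<bar> powr q) \<partial>M) \<le> ennreal (K * (t - s) powr (1 + \<beta>))"
      using moment[OF g[of 0], of N] by blast
    have "0 < g 0 * q" using g[of 0] * by simp
    hence pos: "0 < 1 + \<beta>" using * by linarith
    have lim: "AE \<omega> in M. (\<lambda>n. X (dyadic_floor n t) \<omega>) \<longlonglongrightarrow> V t \<omega>"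
      using AE_G by eventually_elim (use V_conv t in auto)
    have mom: "(\<integral>\<^sup>+\<omega>. ennreal (\<bar>X t \<omega> - X s \<omega>\<bar> powr q) \<partial>M) \<le> ennreal (K * (t - s) powr (1 + \<beta>))"
      if "s \<in> {0..<t}" for s using *(3)[of s t] that t N by simp
    show ?thesis by (rule AE_eq_dyadic_limit[OF meas V_meas[OF t] lim t *(1) pos mom])
  qed
  hence "modification_on M {0..} V X" using V_meas unfolding modification_on_def by blast
  thus ?thesis
    by (intro exI[of _ V] conjI ballI allI impI cont hoelder)
qed

section \<open>Moments of Gaussian sums and of their limits\<close>

lemma (in prob_space) std_normal_mgf:
  assumes Z: "distributed M lborel Z std_normal_density"
  shows "integrable M (\<lambda>\<omega>. exp (a * Z \<omega>))" and "expectation (\<lambda>\<omega>. exp (a * Z \<omega>)) = exp (a\<^sup>2 / 2)"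
proof -
  have shift: "std_normal_density x * exp (a * x) = exp (a\<^sup>2 / 2) * normal_density a 1 x" for x
  proof -
    have "exp (- x\<^sup>2 / 2) * exp (a * x) = exp (a\<^sup>2 / 2) * exp (- (x - a)\<^sup>2 / 2)"
      by (simp add: power2_eq_square field_simps flip: exp_add)
    thus ?thesis by (simp add: normal_density_def)
  qed
  show "integrable M (\<lambda>\<omega>. exp (a * Z \<omega>))"
    by (subst distributed_integrable[OF Z, of "\<lambda>x. exp (a * x)", symmetric]) (auto simp: shift)
  have "expectation (\<lambda>\<omega>. exp (a * Z \<omega>)) = (\<integral>x. std_normal_density x * exp (a * x) \<partial>lborel)"
    by (rule distributed_integral[OF Z, symmetric]) auto
  thus "expectation (\<lambda>\<omega>. exp (a * Z \<omega>)) = exp (a\<^sup>2 / 2)" by (simp add: shift)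
qed

lemma (in prob_space) gaussian_sum_mgf:
  fixes Z :: "'i \<Rightarrow> 'a \<Rightarrow> real"
  assumes I: "finite I" and indep: "indep_vars (\<lambda>_. borel) Z I"
    and Z: "\<And>i. i \<in> I \<Longrightarrow> distributed M lborel (Z i) std_normal_density"
  shows "integrable M (\<lambda>\<omega>. exp (\<Sum>i\<in>I. c i * Z i \<omega>))"
    and "expectation (\<lambda>\<omega>. exp (\<Sum>i\<in>I. c i * Z i \<omega>)) = exp ((\<Sum>i\<in>I. (c i)\<^sup>2) / 2)"
proof -
  have ind: "indep_vars (\<lambda>_. borel) (\<lambda>i \<omega>. exp (c i * Z i \<omega>)) I"
    by (rule indep_vars_compose2[OF indep]) measurable
  have int: "integrable M (\<lambda>\<omega>. exp (c i * Z i \<omega>))" if "i \<in> I" for i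
    using std_normal_mgf(1)[OF Z[OF that]] .
  have prod: "exp (\<Sum>i\<in>I. c i * Z i \<omega>) = (\<Prod>i\<in>I. exp (c i * Z i \<omega>))" for \<omega>
    using I by (rule exp_sum)
  show "integrable M (\<lambda>\<omega>. exp (\<Sum>i\<in>I. c i * Z i \<omega>))"
    unfolding prod by (rule indep_vars_integrable[OF I ind int])
  have "expectation (\<lambda>\<omega>. exp (\<Sum>i\<in>I. c i * Z i \<omega>)) = (\<Prod>i\<in>I. expectation (\<lambda>\<omega>. exp (c i * Z i \<omega>)))"
    unfolding prod by (rule indep_vars_lebesgue_integral[OF I ind int])
  also have "\<dots> = (\<Prod>i\<in>I. exp ((c i)\<^sup>2 / 2))"
    by (intro prod.cong refl std_normal_mgf(2) Z)
  also have "\<dots> = exp ((\<Sum>i\<in>I. (c i)\<^sup>2) / 2)"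
    by (simp add: exp_sum[OF I, symmetric] sum_divide_distrib)
  finally show "expectation (\<lambda>\<omega>. exp (\<Sum>i\<in>I. c i * Z i \<omega>)) = exp ((\<Sum>i\<in>I. (c i)\<^sup>2) / 2)" .
qed

lemma even_power_le_fact_exp:
  fixes x :: real
  shows "x ^ (2 * p) \<le> fact (2 * p) * (exp x + exp (- x))"
proof -
  have pos: "y ^ n \<le> fact n * exp y" if "0 \<le> y" for y :: real and n
  proof -
    have "(\<Sum>k\<in>{n}. y ^ k /\<^sub>R fact k) \<le> exp y"
      unfolding exp_def using that by (intro sum_le_suminf summable_exp_generic) auto
    thus ?thesis by (simp add: field_simps)
  qed
  have "x ^ (2 * p) = \<bar>x\<bar> ^ (2 * p)" by (simp add: power_even_abs)
  also have "\<dots> \<le> fact (2 * p) * exp \<bar>x\<bar>" by (rule pos) simp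
  also have "\<dots> \<le> fact (2 * p) * (exp x + exp (- x))"
    by (intro mult_left_mono) (auto simp: abs_if)
  finally show ?thesis .
qed

text \<open>
  At the scale \<open>\<surd>v\<close> the moment generating function is at most \<open>exp (1/2)\<close>, whatever the number of
  summands, and even powers are dominated by exponentials. Arguing with the moment generating
  function instead of the density of the sum covers degenerate sums as well.
\<close>

lemma (in prob_space) gaussian_sum_moment:
  fixes Z :: "'i \<Rightarrow> 'a \<Rightarrow> real"
  assumes I: "finite I" and indep: "indep_vars (\<lambda>_. borel) Z I"
    and Z: "\<And>i. i \<in> I \<Longrightarrow> distributed M lborel (Z i) std_normal_density"
    and var: "(\<Sum>i\<in>I. (c i)\<^sup>2) \<le> v" and v: "0 < v"
  shows "(\<integral>\<^sup>+\<omega>. ennreal ((\<Sum>i\<in>I. c i * Z i \<omega>) ^ (2 * p)) \<partial>M)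
    \<le> ennreal (2 * fact (2 * p) * exp (1 / 2) * v ^ p)"
proof -
  define X where "X \<omega> = (\<Sum>i\<in>I. c i * Z i \<omega>)" for \<omega>
  define \<tau> where "\<tau> = sqrt v"
  have \<tau>: "0 < \<tau>" "\<tau>\<^sup>2 = v" using v by (auto simp: \<tau>_def)
  have exp_int: "integrable M (\<lambda>\<omega>. exp (a * X \<omega>))" and
    exp_le: "expectation (\<lambda>\<omega>. exp (a * X \<omega>)) \<le> exp (1 / 2)" if a: "a\<^sup>2 = 1 / v" for a
  proof -
    have eq: "a * X \<omega> = (\<Sum>i\<in>I. (a * c i) * Z i \<omega>)" for \<omega>
      by (simp add: X_def sum_distrib_left mult.assoc)
    show "integrable M (\<lambda>\<omega>. exp (a * X \<omega>))"
      unfolding eq by (rule gaussian_sum_mgf(1)[OF I indep Z])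
    have "expectation (\<lambda>\<omega>. exp (a * X \<omega>)) = exp ((\<Sum>i\<in>I. (a * c i)\<^sup>2) / 2)"
      unfolding eq by (rule gaussian_sum_mgf(2)[OF I indep Z])
    also have "(\<Sum>i\<in>I. (a * c i)\<^sup>2) = (\<Sum>i\<in>I. (c i)\<^sup>2) / v"
      by (simp add: power_mult_distrib a sum_divide_distrib)
    also have "exp ((\<Sum>i\<in>I. (c i)\<^sup>2) / v / 2) \<le> exp (1 / 2)" using var v by simp
    finally show "expectation (\<lambda>\<omega>. exp (a * X \<omega>)) \<le> exp (1 / 2)" .
  qed
  have sq: "(1 / \<tau>)\<^sup>2 = 1 / v" "(- (1 / \<tau>))\<^sup>2 = 1 / v" using \<tau> by (auto simp: power_divide)
  define K where "K = v ^ p * fact (2 * p)"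
  have K: "0 \<le> K" using v by (simp add: K_def)
  have "X \<omega> ^ (2 * p) \<le> K * (exp (1 / \<tau> * X \<omega>) + exp (- (1 / \<tau>) * X \<omega>))" for \<omega>
  proof -
    have "X \<omega> ^ (2 * p) = \<tau> ^ (2 * p) * (1 / \<tau> * X \<omega>) ^ (2 * p)"
      using \<tau> by (simp flip: power_mult_distrib)
    also have "\<tau> ^ (2 * p) = v ^ p" using \<tau> by (simp add: power_mult)
    also have "v ^ p * (1 / \<tau> * X \<omega>) ^ (2 * p)
        \<le> v ^ p * (fact (2 * p) * (exp (1 / \<tau> * X \<omega>) + exp (- (1 / \<tau> * X \<omega>))))"
      using v by (intro mult_left_mono even_power_le_fact_exp) auto
    finally show ?thesis by (simp add: K_def mult.assoc)
  qed
  hence "(\<integral>\<^sup>+\<omega>. ennreal (X \<omega> ^ (2 * p)) \<partial>M)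
      \<le> (\<integral>\<^sup>+\<omega>. ennreal (K * (exp (1 / \<tau> * X \<omega>) + exp (- (1 / \<tau>) * X \<omega>))) \<partial>M)"
    by (intro nn_integral_mono ennreal_leI)
  also have "\<dots> = ennreal (expectation (\<lambda>\<omega>. K * (exp (1 / \<tau> * X \<omega>) + exp (- (1 / \<tau>) * X \<omega>))))"
    using K exp_int[OF sq(1)] exp_int[OF sq(2)]
    by (intro nn_integral_eq_integral integrable_mult_right Bochner_Integration.integrable_add) auto
  also have "expectation (\<lambda>\<omega>. K * (exp (1 / \<tau> * X \<omega>) + exp (- (1 / \<tau>) * X \<omega>)))
      = K * (expectation (\<lambda>\<omega>. exp (1 / \<tau> * X \<omega>)) + expectation (\<lambda>\<omega>. exp (- (1 / \<tau>) * X \<omega>)))"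
    using exp_int[OF sq(1)] exp_int[OF sq(2)] by (subst Bochner_Integration.integral_add[symmetric]) auto
  also have "\<dots> \<le> K * (exp (1 / 2) + exp (1 / 2))"
    using exp_le[OF sq(1)] exp_le[OF sq(2)] K by (intro mult_left_mono add_mono) auto
  also have "\<dots> = 2 * fact (2 * p) * exp (1 / 2) * v ^ p" by (simp add: K_def)
  finally show ?thesis by (simp add: X_def ennreal_leI)
qed

text \<open>
  Convergence in the mean square gives almost everywhere convergence along a subsequence, and
  Fatou's lemma then carries moment bounds of any order over to the limit.
\<close>

lemma L2_limit_moment_bound:
  fixes X :: "nat \<Rightarrow> 'a \<Rightarrow> real"
  assumes [measurable]: "\<And>n. X n \<in> borel_measurable M" "Y \<in> borel_measurable M"
    and int: "\<And>n. integrable M (\<lambda>\<omega>. (X n \<omega> - Y \<omega>)\<^sup>2)"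
    and lim: "(\<lambda>n. \<integral>\<omega>. (X n \<omega> - Y \<omega>)\<^sup>2 \<partial>M) \<longlonglongrightarrow> 0"
    and bound: "\<And>n. (\<integral>\<^sup>+\<omega>. ennreal (X n \<omega> ^ k) \<partial>M) \<le> B"
  shows "(\<integral>\<^sup>+\<omega>. ennreal (Y \<omega> ^ k) \<partial>M) \<le> B"
proof -
  obtain r where r: "strict_mono r" "AE \<omega> in M. (\<lambda>n. (X (r n) \<omega> - Y \<omega>)\<^sup>2) \<longlonglongrightarrow> 0"
    using tendsto_L1_AE_subseq[of M "\<lambda>n \<omega>. (X n \<omega> - Y \<omega>)\<^sup>2"] int lim by auto
  have "AE \<omega> in M. liminf (\<lambda>n. ennreal (X (r n) \<omega> ^ k)) = ennreal (Y \<omega> ^ k)"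
    using r(2)
  proof eventually_elim
    case (elim \<omega>)
    hence "(\<lambda>n. sqrt ((X (r n) \<omega> - Y \<omega>)\<^sup>2)) \<longlonglongrightarrow> sqrt 0" by (intro tendsto_intros)
    hence "(\<lambda>n. X (r n) \<omega> - Y \<omega>) \<longlonglongrightarrow> 0" by (simp add: tendsto_rabs_zero_iff)
    hence "(\<lambda>n. X (r n) \<omega>) \<longlonglongrightarrow> Y \<omega>" by (simp add: LIM_zero_iff)
    hence "(\<lambda>n. ennreal (X (r n) \<omega> ^ k)) \<longlonglongrightarrow> ennreal (Y \<omega> ^ k)"
      by (intro tendsto_ennrealI tendsto_power)
    thus ?case by (simp add: lim_imp_Liminf)
  qed
  hence "(\<integral>\<^sup>+\<omega>. ennreal (Y \<omega> ^ k) \<partial>M) = (\<integral>\<^sup>+\<omega>. liminf (\<lambda>n. ennreal (X (r n) \<omega> ^ k)) \<partial>M)"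
    by (intro nn_integral_cong_AE) auto
  also have "\<dots> \<le> liminf (\<lambda>n. \<integral>\<^sup>+\<omega>. ennreal (X (r n) \<omega> ^ k) \<partial>M)"
    by (rule nn_integral_liminf) measurable
  also have "\<dots> \<le> liminf (\<lambda>n. B)"
    by (intro Liminf_mono always_eventually allI bound)
  also have "\<dots> = B" by (simp add: Liminf_const)
  finally show ?thesis .
qed

section \<open>The Tricomi kernel\<close>

text \<open>
  Under \<open>w'' = x w\<close> the coefficients shift by three places. The recursion keeps \<open>c n * y ^ n\<close> bounded
  for every \<open>y\<close>, which gives convergence on the whole line.
\<close>

lemma airy_series:
  fixes c :: "nat \<Rightarrow> real"
  assumes rec: "\<And>n. c n = real (n + 2) * real (n + 3) * c (n + 3)" and c2: "c 2 = 0"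
  defines "w \<equiv> \<lambda>x. \<Sum>n. c n * x ^ n"
  shows "summable (\<lambda>n. c n * x ^ n)"
    and "(w has_real_derivative (\<Sum>n. diffs c n * x ^ n)) (at x)"
    and "((\<lambda>x. \<Sum>n. diffs c n * x ^ n) has_real_derivative x * w x) (at x)"
proof -
  have bdd: "\<exists>K. \<forall>n. \<bar>c n * y ^ n\<bar> \<le> K" for y :: real
  proof -
    obtain m :: nat where m: "\<bar>y\<bar> ^ 3 \<le> real m" using real_arch_simple by blast
    define K where "K = Max ((\<lambda>n. \<bar>c n * y ^ n\<bar>) ` {..m + 3})"
    have "\<bar>c n * y ^ n\<bar> \<le> K" for n
    proof (induction n rule: less_induct)
      case (less n)
      show ?case
      proof (cases "n \<le> m + 3")
        case True thus ?thesis unfolding K_def by (intro Max_ge) auto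
      next
        case False
        then obtain k where k: "n = k + 3" "m \<le> k" by (metis add.commute le_add_diff_inverse
              nat_add_left_cancel_le not_less_eq_eq le_trans le_add2 add_le_cancel_right nat_le_linear)
        have "\<bar>y\<bar> ^ 3 \<le> real k" using m k by linarith
        also have "\<dots> \<le> real (k + 2) * real (k + 3)" by (simp add: algebra_simps)
        finally have *: "\<bar>y\<bar> ^ 3 \<le> real (k + 2) * real (k + 3)" .
        have "\<bar>c n * y ^ n\<bar> = \<bar>c (k + 3)\<bar> * \<bar>y\<bar> ^ k * \<bar>y\<bar> ^ 3"
          by (simp add: k abs_mult power_add power_abs)
        also have "\<dots> \<le> \<bar>c (k + 3)\<bar> * \<bar>y\<bar> ^ k * (real (k + 2) * real (k + 3))"
          using * by (intro mult_left_mono) auto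
        also have "\<dots> = \<bar>c k * y ^ k\<bar>"
          by (subst rec[of k]) (simp add: abs_mult power_abs)
        also have "\<dots> \<le> K" using less k by simp
        finally show ?thesis .
      qed
    qed
    thus ?thesis by blast
  qed
  have summ: "summable (\<lambda>n. c n * y ^ n)" for y
  proof -
    obtain K where K: "\<And>n. \<bar>c n * (2 * y) ^ n\<bar> \<le> K" using bdd by blast
    show ?thesis
    proof (rule summable_comparison_test'[of "\<lambda>n. K * (1 / 2) ^ n"])
      show "norm (c n * y ^ n) \<le> K * (1 / 2) ^ n" for n
        using mult_right_mono[OF K[of n], of "(1 / 2) ^ n"]
        by (simp add: abs_mult power_mult_distrib power_one_over)
    qed (auto intro!: summable_mult summable_geometric)
  qed
  thus "summable (\<lambda>n. c n * x ^ n)" .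
  show "(w has_real_derivative (\<Sum>n. diffs c n * x ^ n)) (at x)"
    unfolding w_def using summ by (rule termdiffs_strong_converges_everywhere)
  have summ': "summable (\<lambda>n. diffs c n * y ^ n)" for y
    using summ by (rule termdiff_converges_all)
  have shift: "diffs (diffs c) (Suc n) * x ^ Suc n = x * (c n * x ^ n)" for n
  proof -
    have "diffs (diffs c) (Suc n) = real (n + 2) * real (n + 3) * c (n + 3)"
      by (simp add: diffs_def numeral_2_eq_2 numeral_3_eq_3)
    thus ?thesis using rec[of n] by simp
  qed
  have diffs_0: "diffs (diffs c) 0 = 0" using c2 by (simp add: diffs_def numeral_2_eq_2)
  have "(\<Sum>n. diffs (diffs c) n * x ^ n)
      = diffs (diffs c) 0 * x ^ 0 + (\<Sum>n. diffs (diffs c) (Suc n) * x ^ Suc n)"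
    using suminf_split_initial_segment[OF termdiff_converges_all[OF summ', of x], of 1] by simp
  also have "\<dots> = (\<Sum>n. x * (c n * x ^ n))"
    by (simp only: shift diffs_0 mult_zero_left add_0)
  also have "\<dots> = x * w x" unfolding w_def using summ by (rule suminf_mult)
  finally have "(\<Sum>n. diffs (diffs c) n * x ^ n) = x * w x" .
  with termdiffs_strong_converges_everywhere[OF summ', of x]
  show "((\<lambda>x. \<Sum>n. diffs c n * x ^ n) has_real_derivative x * w x) (at x)" by (rule DERIV_cong)
qed

text \<open>
  One statement for both series: \<open>i = 0\<close>, \<open>a = 1/3\<close> is \<^const>\<open>airy_f\<close> and \<open>i = 1\<close>, \<open>a = 2/3\<close> is \<^const>\<open>airy_g\<close>.
  The coefficients are spread out to all exponents so that termwise differentiation applies.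
\<close>

lemma airy_solution:
  fixes a :: real and i :: nat
  assumes i: "i \<le> 1" and a: "3 * a = real i + 1"
  defines "w \<equiv> \<lambda>x. \<Sum>k. 3 ^ k * pochhammer a k * x ^ (3 * k + i) / fact (3 * k + i)"
  obtains w' where "\<And>x. (w has_real_derivative w' x) (at x)"
    "\<And>x. (w' has_real_derivative x * w x) (at x)"
    "w 0 = (if i = 0 then 1 else 0)" "w' 0 = (if i = 0 then 0 else 1)"
proof -
  define c where "c n = (if n mod 3 = i then 3 ^ (n div 3) * pochhammer a (n div 3) / fact n else 0)"
    for n
  have rec: "c n = real (n + 2) * real (n + 3) * c (n + 3)" for n
  proof (cases "n mod 3 = i")
    case True
    define k where "k = n div 3"
    have n: "n = 3 * k + i" using mult_div_mod_eq[of 3 n] True by (simp add: k_def)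
    have "3 * (a + real k) = real (n + 1)" using a n by simp
    hence "3 ^ Suc k * pochhammer a (Suc k) = 3 ^ k * pochhammer a k * real (n + 1)"
      by (simp add: pochhammer_Suc)
    moreover have "fact (n + 3) = real (n + 3) * real (n + 2) * real (n + 1) * fact n"
      by (simp add: eval_nat_numeral)
    moreover have "(n + 3) div 3 = Suc k" "(n + 3) mod 3 = i" using True by (auto simp: k_def)
    ultimately show ?thesis using True by (simp add: c_def k_def[symmetric] divide_simps)
  next
    case False thus ?thesis by (simp add: c_def)
  qed
  have c_small: "c 2 = 0" "c 0 = (if i = 0 then 1 else 0)" "c 1 = (if i = 0 then 0 else 1)"
    using i by (auto simp: c_def)
  have w_eq: "w = (\<lambda>x. \<Sum>n. c n * x ^ n)"
  proof
    fix x
    have sm: "strict_mono (\<lambda>k. 3 * k + i)" by (auto simp: strict_mono_def)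
    have zero: "c n * x ^ n = 0" if "n \<notin> range (\<lambda>k. 3 * k + i)" for n
    proof -
      have "n mod 3 \<noteq> i" using that by (metis mult_div_mod_eq rangeI)
      thus ?thesis by (simp add: c_def)
    qed
    have "(\<lambda>n. c n * x ^ n) sums (\<Sum>n. c n * x ^ n)"
      by (intro summable_sums airy_series(1)[OF rec c_small(1)])
    hence "(\<lambda>k. c (3 * k + i) * x ^ (3 * k + i)) sums (\<Sum>n. c n * x ^ n)"
      using sums_mono_reindex[OF sm, of "\<lambda>n. c n * x ^ n", OF zero] by blast
    moreover have "c (3 * k + i) * x ^ (3 * k + i)
        = 3 ^ k * pochhammer a k * x ^ (3 * k + i) / fact (3 * k + i)" for k
      using i by (simp add: c_def)
    ultimately show "w x = (\<Sum>n. c n * x ^ n)" unfolding w_def by (simp add: sums_iff)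
  qed
  show thesis
  proof (rule that)
    show "(w has_real_derivative (\<Sum>n. diffs c n * x ^ n)) (at x)"
      "((\<lambda>x. \<Sum>n. diffs c n * x ^ n) has_real_derivative x * w x) (at x)" for x
      unfolding w_eq by (rule airy_series[OF rec c_small(1)])+
    show "w 0 = (if i = 0 then 1 else 0)" using c_small by (simp add: w_eq)
    show "(\<Sum>n. diffs c n * 0 ^ n) = (if i = 0 then 0 else 1)" using c_small by (simp add: diffs_def)
  qed
qed

text \<open>
  This is the reflection formula of the Gamma function at \<open>1/3\<close>; it normalises the Wronskian of the
  Airy functions to \<open>1 / \<pi>\<close>.
\<close>

lemma airy_constants: "2 * pi * sqrt 3 * (airy_c1 * airy_c2) = 1"
proof -
  have "Gamma (1/3 :: real) * Gamma (2/3) = 2 * pi / sqrt 3"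
  proof -
    have "Gamma (1/3 :: complex) * Gamma (1 - 1/3) = of_real pi / sin (of_real pi * (1/3))"
      by (rule Gamma_reflection_complex)
    hence "complex_of_real (Gamma (1/3) * Gamma (2/3)) = complex_of_real (pi / sin (pi / 3))"
      by (simp flip: Gamma_complex_of_real sin_of_real)
    hence "Gamma (1/3) * Gamma (2/3) = pi / sin (pi / 3)" by (simp only: of_real_eq_iff)
    thus ?thesis by (simp add: sin_60)
  qed
  moreover have "3 powr (-2/3) * 3 powr (-1/3) = (1/3 :: real)"
    by (simp add: powr_minus_divide flip: powr_add)
  moreover have "airy_c1 * airy_c2
      = (3 powr (-2/3) * 3 powr (-1/3)) / (Gamma (1/3) * Gamma (2/3))"
    by (simp add: airy_c1_def airy_c2_def)
  ultimately have "airy_c1 * airy_c2 = (1/3) / (2 * pi / sqrt 3)" by (simp only:)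
  hence "2 * pi * sqrt 3 * (airy_c1 * airy_c2) = 2 * pi * sqrt 3 * ((1/3) / (2 * pi / sqrt 3))"
    by (simp only:)
  also have "\<dots> = sqrt 3 * sqrt 3 / 3" by (simp add: divide_simps)
  finally show ?thesis by simp
qed

lemma tricomi_C_airy_fg:
  assumes "0 < \<rho>"
  shows "tricomi_C t s \<rho> = - (1 / \<rho> powr (2/3)) *
    (airy_g (- (\<rho> powr (2/3)) * t) * airy_f (- (\<rho> powr (2/3)) * s)
     - airy_f (- (\<rho> powr (2/3)) * t) * airy_g (- (\<rho> powr (2/3)) * s))"
proof -
  have "Bi u * Ai v - Ai u * Bi v
      = 2 * sqrt 3 * (airy_c1 * airy_c2) * (airy_g u * airy_f v - airy_f u * airy_g v)" for u v
    by (simp add: Ai_def Bi_def algebra_simps)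
  hence "pi * (Bi u * Ai v - Ai u * Bi v)
      = (2 * pi * sqrt 3 * (airy_c1 * airy_c2)) * (airy_g u * airy_f v - airy_f u * airy_g v)" for u v
    by (simp only: ac_simps)
  hence "pi * (Bi u * Ai v - Ai u * Bi v) = airy_g u * airy_f v - airy_f u * airy_g v" for u v
    unfolding airy_constants by simp
  thus ?thesis using assms by (simp add: tricomi_C_def divide_simps)
qed

text \<open>
  As a function of \<open>t\<close> the kernel solves the Tricomi equation at frequency \<open>\<rho>\<close>, starting from \<open>0\<close> at
  time \<open>s\<close>; its initial velocity is the Wronskian of the two Airy series, which is constantly \<open>1\<close>.
\<close>

lemma tricomi_C_ode:
  assumes \<rho>: "0 < \<rho>"
  obtains D where "\<And>t. ((\<lambda>t. tricomi_C t s \<rho>) has_real_derivative D t) (at t)"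
    "\<And>t. (D has_real_derivative - (\<rho>\<^sup>2 * t * tricomi_C t s \<rho>)) (at t)" "D s = 1"
proof -
  obtain f' where f: "\<And>x. (airy_f has_real_derivative f' x) (at x)"
    "\<And>x. (f' has_real_derivative x * airy_f x) (at x)" "airy_f 0 = 1" "f' 0 = 0"
    by (rule airy_solution[of 0 "1/3"]) (auto simp: airy_f_def[abs_def])
  obtain g' where g: "\<And>x. (airy_g has_real_derivative g' x) (at x)"
    "\<And>x. (g' has_real_derivative x * airy_g x) (at x)" "airy_g 0 = 0" "g' 0 = 1"
    by (rule airy_solution[of 1 "2/3"]) (auto simp: airy_g_def[abs_def])
  have "((\<lambda>x. airy_f x * g' x - f' x * airy_g x) has_real_derivative 0) (at x)" for x
    by (rule derivative_eq_intros f g refl | simp)+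
  hence "airy_f x * g' x - f' x * airy_g x = airy_f 0 * g' 0 - f' 0 * airy_g 0" for x
    by (intro DERIV_isconst_all) auto
  hence wronskian: "airy_f x * g' x - f' x * airy_g x = 1" for x using f g by simp
  define \<mu> where "\<mu> = \<rho> powr (2/3)"
  have \<mu>: "0 < \<mu>" "\<mu> ^ 3 = \<rho>\<^sup>2"
  proof -
    have "\<mu> ^ 3 = \<mu> powr real 3" using \<rho> by (subst powr_realpow) (auto simp: \<mu>_def)
    also have "\<dots> = \<rho> powr real 2" by (simp add: \<mu>_def powr_powr)
    also have "\<dots> = \<rho>\<^sup>2" using \<rho> by (subst powr_realpow) auto
    finally show "\<mu> ^ 3 = \<rho>\<^sup>2" .
  qed (use \<rho> in \<open>simp add: \<mu>_def\<close>)
  define y where "y = (\<lambda>t. - (1 / \<mu>) *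
    (airy_g (- \<mu> * t) * airy_f (- \<mu> * s) - airy_f (- \<mu> * t) * airy_g (- \<mu> * s)))"
  have y_eq: "y = (\<lambda>t. tricomi_C t s \<rho>)"
    by (simp add: y_def tricomi_C_airy_fg[OF \<rho>] \<mu>_def)
  define D where "D = (\<lambda>t. g' (- \<mu> * t) * airy_f (- \<mu> * s) - f' (- \<mu> * t) * airy_g (- \<mu> * s))"
  have chain: "((\<lambda>t. h (- \<mu> * t)) has_real_derivative - \<mu> * h' (- \<mu> * t)) (at t)"
    if "\<And>x. (h has_real_derivative h' x) (at x)" for h h' t
  proof -
    have "((\<lambda>t. - \<mu> * t) has_real_derivative - \<mu>) (at t)"
      by (auto intro!: derivative_eq_intros)
    from DERIV_chain2[OF that this] show ?thesis by (simp add: mult.commute)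
  qed
  have "(y has_real_derivative D t) (at t)" for t
  proof -
    have "(y has_real_derivative - (1 / \<mu>) * ((- \<mu> * g' (- \<mu> * t)) * airy_f (- \<mu> * s)
        - (- \<mu> * f' (- \<mu> * t)) * airy_g (- \<mu> * s))) (at t)"
      unfolding y_def by (intro DERIV_cmult DERIV_diff DERIV_cmult_right chain f g)
    thus ?thesis using \<mu>(1) by (elim DERIV_cong) (simp add: D_def field_simps)
  qed
  moreover have "(D has_real_derivative - (\<rho>\<^sup>2 * t * y t)) (at t)" for t
  proof -
    have "(D has_real_derivative
        (- \<mu> * (- \<mu> * t * airy_g (- \<mu> * t))) * airy_f (- \<mu> * s)
        - (- \<mu> * (- \<mu> * t * airy_f (- \<mu> * t))) * airy_g (- \<mu> * s)) (at t)"
      unfolding D_def by (intro DERIV_diff DERIV_cmult_right chain f g)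
    thus ?thesis unfolding \<mu>(2)[symmetric] using \<mu>(1)
      by (elim DERIV_cong) (simp add: y_def field_simps power3_eq_cube)
  qed
  moreover have "D s = 1" using wronskian[of "- \<mu> * s"] by (simp add: D_def algebra_simps)
  ultimately show thesis using that unfolding y_eq by blast
qed

lemma tricomi_C_diag [simp]: "tricomi_C t t \<rho> = 0"
  by (simp add: tricomi_C_def)

text \<open>
  Two quantities do not increase along the solution, because the coefficient \<open>\<rho>\<^sup>2 t\<close> grows. The first
  is \<open>y'\<^sup>2 / t + \<rho>\<^sup>2 y\<^sup>2\<close>, with initial value \<open>1 / r\<close>; it bounds both \<open>y\<close> and \<open>y'\<close>. The second is
  \<open>v\<^sup>2 + v'\<^sup>2 / (\<rho>\<^sup>2 t)\<close> for the quotient \<open>v = y / (t - r)\<close>, which solves the damped equation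
  \<open>v'' + 2 / (t - r) v' + \<rho>\<^sup>2 t v = 0\<close>; it tends to \<open>1\<close> as \<open>t\<close> decreases to \<open>r\<close>, which gives the bound
  \<open>\<bar>y\<bar> \<le> t - r\<close> uniformly in the frequency.
\<close>

lemma tricomi_ode_bounds:
  fixes y D :: "real \<Rightarrow> real"
  assumes r: "0 < r" and \<rho>: "0 < \<rho>"
    and y: "\<And>t. r \<le> t \<Longrightarrow> (y has_real_derivative D t) (at t)"
    and D: "\<And>t. r \<le> t \<Longrightarrow> (D has_real_derivative - (\<rho>\<^sup>2 * t * y t)) (at t)"
    and init: "y r = 0" "D r = 1" and t: "r \<le> t"
  shows "(y t)\<^sup>2 \<le> 1 / (\<rho>\<^sup>2 * r)" and "(D t)\<^sup>2 \<le> t / r" and "\<bar>y t\<bar> \<le> t - r"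
proof -
  have "(D t)\<^sup>2 / t + \<rho>\<^sup>2 * (y t)\<^sup>2 \<le> (D r)\<^sup>2 / r + \<rho>\<^sup>2 * (y r)\<^sup>2"
  proof (rule DERIV_nonpos_imp_nonincreasing[OF t])
    fix x assume x: "r \<le> x" "x \<le> t"
    hence "((\<lambda>x. (D x)\<^sup>2 / x + \<rho>\<^sup>2 * (y x)\<^sup>2) has_real_derivative - (D x)\<^sup>2 / x\<^sup>2) (at x)"
      using r by (auto intro!: derivative_eq_intros y D simp: field_simps power2_eq_square)
    thus "\<exists>z. ((\<lambda>x. (D x)\<^sup>2 / x + \<rho>\<^sup>2 * (y x)\<^sup>2) has_real_derivative z) (at x) \<and> z \<le> 0"
      by (intro exI[of _ "- (D x)\<^sup>2 / x\<^sup>2"]) auto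
  qed
  hence E: "(D t)\<^sup>2 / t + \<rho>\<^sup>2 * (y t)\<^sup>2 \<le> 1 / r" using init by simp
  have "0 \<le> (D t)\<^sup>2 / t" "0 \<le> \<rho>\<^sup>2 * (y t)\<^sup>2" using r t by auto
  hence "\<rho>\<^sup>2 * (y t)\<^sup>2 \<le> 1 / r" "(D t)\<^sup>2 / t \<le> 1 / r" using E by linarith+
  thus "(y t)\<^sup>2 \<le> 1 / (\<rho>\<^sup>2 * r)" "(D t)\<^sup>2 \<le> t / r"
    using r t \<rho> by (auto simp: field_simps)
  show "\<bar>y t\<bar> \<le> t - r"
  proof (cases "t = r")
    case True thus ?thesis using init by simp
  next
    case False
    define z where "z x = (x - r) * D x - y x" for x
    define v where "v x = y x / (x - r)" for x
    define v' where "v' x = z x / (x - r)\<^sup>2" for x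
    have z': "(z has_real_derivative - ((x - r) * (\<rho>\<^sup>2 * x * y x))) (at x)" if "r \<le> x" for x
      unfolding z_def using that by (auto intro!: derivative_eq_intros y D)
    define G where "G x = (v x)\<^sup>2 + (v' x)\<^sup>2 / (\<rho>\<^sup>2 * x)" for x
    have mono: "G t \<le> G u" if u: "r < u" "u \<le> t" for u
    proof (rule DERIV_nonpos_imp_nonincreasing[OF u(2)])
      fix x assume x: "u \<le> x" "x \<le> t"
      hence xr: "r < x" "0 < x" using u r by auto
      have dv: "(v has_real_derivative v' x) (at x)"
        unfolding v_def v'_def z_def using xr
        by (auto intro!: derivative_eq_intros y simp: field_simps power2_eq_square)
      have dv': "(v' has_real_derivative - (2 / (x - r)) * v' x - \<rho>\<^sup>2 * x * v x) (at x)"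
        unfolding v'_def v_def using xr
        by (auto intro!: derivative_eq_intros z' simp: divide_simps) (simp add: algebra_simps power2_eq_square power4_eq_xxxx)
      have "((\<lambda>x. \<rho>\<^sup>2 * x) has_real_derivative \<rho>\<^sup>2) (at x)" by (auto intro!: derivative_eq_intros)
      note dq = DERIV_divide[OF DERIV_power[OF dv', of 2] this]
      have pos: "x - r \<noteq> 0" "x \<noteq> 0" "\<rho> \<noteq> 0" using xr \<rho> by auto
      have d1: "((\<lambda>x. (v x)\<^sup>2) has_real_derivative 2 * v x * v' x) (at x)"
        using DERIV_power[OF dv, of 2] by (rule DERIV_cong) simp
      have "((\<lambda>x. (v' x)\<^sup>2 / (\<rho>\<^sup>2 * x)) has_real_derivative
          (2 * v' x * (- (2 / (x - r)) * v' x - \<rho>\<^sup>2 * x * v x) * (\<rho>\<^sup>2 * x) - (v' x)\<^sup>2 * \<rho>\<^sup>2)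
            / (\<rho>\<^sup>2 * x * (\<rho>\<^sup>2 * x))) (at x)"
        by (rule DERIV_cong[OF dq]) (use pos in simp_all)
      moreover have "2 * v' x * (- (2 / (x - r)) * v' x - \<rho>\<^sup>2 * x * v x) * (\<rho>\<^sup>2 * x)
            / (\<rho>\<^sup>2 * x * (\<rho>\<^sup>2 * x)) = - (4 * (v' x)\<^sup>2 / ((x - r) * \<rho>\<^sup>2 * x)) - 2 * v x * v' x"
        using pos by (simp add: divide_simps) (simp add: algebra_simps power2_eq_square)
      moreover have "(v' x)\<^sup>2 * \<rho>\<^sup>2 / (\<rho>\<^sup>2 * x * (\<rho>\<^sup>2 * x)) = (v' x)\<^sup>2 / (\<rho>\<^sup>2 * x\<^sup>2)"
        using pos by (simp add: divide_simps) (simp add: algebra_simps power2_eq_square)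
      ultimately have d2: "((\<lambda>x. (v' x)\<^sup>2 / (\<rho>\<^sup>2 * x)) has_real_derivative
          - (4 * (v' x)\<^sup>2 / ((x - r) * \<rho>\<^sup>2 * x)) - 2 * v x * v' x - (v' x)\<^sup>2 / (\<rho>\<^sup>2 * x\<^sup>2)) (at x)"
        by (simp only: diff_divide_distrib)
      have dG: "(G has_real_derivative
          - (4 * (v' x)\<^sup>2 / ((x - r) * \<rho>\<^sup>2 * x) + (v' x)\<^sup>2 / (\<rho>\<^sup>2 * x\<^sup>2))) (at x)"
        unfolding G_def using DERIV_add[OF d1 d2] by (rule DERIV_cong) simp
      have "0 \<le> 4 * (v' x)\<^sup>2 / ((x - r) * \<rho>\<^sup>2 * x)"
        using xr by (intro divide_nonneg_nonneg mult_nonneg_nonneg) auto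
      moreover have "0 \<le> (v' x)\<^sup>2 / (\<rho>\<^sup>2 * x\<^sup>2)" by simp
      ultimately have le: "- (4 * (v' x)\<^sup>2 / ((x - r) * \<rho>\<^sup>2 * x) + (v' x)\<^sup>2 / (\<rho>\<^sup>2 * x\<^sup>2)) \<le> 0"
        by linarith
      show "\<exists>d. (G has_real_derivative d) (at x) \<and> d \<le> 0"
        by (rule exI, rule conjI, rule dG, rule le)
    qed
    \<comment> \<open>the numerator \<open>z\<close> vanishes to third order at \<open>r\<close>\<close>
    have z_lim: "(v' \<longlongrightarrow> 0) (at_right r)"
    proof -
      have "((\<lambda>x. z x / (x - r)\<^sup>2) \<longlongrightarrow> 0) (at_right r)"
      proof (rule lhopital_right[where f' = "\<lambda>x. - ((x - r) * (\<rho>\<^sup>2 * x * y x))" and g' = "\<lambda>x. 2 * (x - r)"])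
        have "isCont z r" using z'[of r] by (auto intro: DERIV_isCont)
        moreover have "z r = 0" using init by (simp add: z_def)
        ultimately show "(z \<longlongrightarrow> 0) (at_right r)"
          using isCont_def tendsto_within_subset by (metis subset_UNIV)
        have "((\<lambda>x. (x - r)\<^sup>2) \<longlongrightarrow> (r - r)\<^sup>2) (at_right r)" by (intro tendsto_intros)
        thus "((\<lambda>x. (x - r)\<^sup>2) \<longlongrightarrow> 0) (at_right r)" by simp
        show "\<forall>\<^sub>F x in at_right r. (x - r)\<^sup>2 \<noteq> 0" by (auto simp: eventually_at_filter)
        show "\<forall>\<^sub>F x in at_right r. 2 * (x - r) \<noteq> 0" by (auto simp: eventually_at_filter)
        show "\<forall>\<^sub>F x in at_right r. (z has_real_derivative - ((x - r) * (\<rho>\<^sup>2 * x * y x))) (at x)"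
          by (auto simp: eventually_at_filter intro!: always_eventually z')
        show "\<forall>\<^sub>F x in at_right r. ((\<lambda>x. (x - r)\<^sup>2) has_real_derivative 2 * (x - r)) (at x)"
          by (auto intro!: always_eventually derivative_eq_intros)
        have "isCont y r" using y[of r] by (auto intro: DERIV_isCont)
        hence "((\<lambda>x. - (\<rho>\<^sup>2 * x * y x) / 2) \<longlongrightarrow> - (\<rho>\<^sup>2 * r * y r) / 2) (at_right r)"
          by (intro tendsto_intros) (auto simp: isCont_def intro: tendsto_within_subset)
        hence "((\<lambda>x. - (\<rho>\<^sup>2 * x * y x) / 2) \<longlongrightarrow> 0) (at_right r)" using init by simp
        thus "((\<lambda>x. - ((x - r) * (\<rho>\<^sup>2 * x * y x)) / (2 * (x - r))) \<longlongrightarrow> 0) (at_right r)"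
        proof (rule Lim_transform_eventually)
          have "- (\<rho>\<^sup>2 * x * y x) / 2 = - ((x - r) * (\<rho>\<^sup>2 * x * y x)) / (2 * (x - r))" if "r < x" for x
            using that by (simp add: divide_simps)
          thus "\<forall>\<^sub>F x in at_right r. - (\<rho>\<^sup>2 * x * y x) / 2
              = - ((x - r) * (\<rho>\<^sup>2 * x * y x)) / (2 * (x - r))"
            unfolding eventually_at_filter by (intro always_eventually) auto
        qed
      qed
      thus ?thesis by (simp add: v'_def[abs_def])
    qed
    have v_lim: "(v \<longlongrightarrow> 1) (at_right r)"
    proof -
      have "((\<lambda>x. (y x - y r) / (x - r)) \<longlongrightarrow> D r) (at r)"
        using y[of r] unfolding has_field_derivative_iff by simp
      hence "((\<lambda>x. (y x - y r) / (x - r)) \<longlongrightarrow> D r) (at_right r)"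
        by (rule tendsto_within_subset) auto
      thus ?thesis using init by (simp add: v_def[abs_def])
    qed
    have "(G \<longlongrightarrow> 1\<^sup>2 + 0\<^sup>2 / (\<rho>\<^sup>2 * r)) (at_right r)"
      unfolding G_def using r \<rho> by (intro tendsto_intros z_lim v_lim) auto
    moreover have "\<forall>\<^sub>F u in at_right r. G t \<le> G u"
      using False t mono by (auto simp: eventually_at_right_field intro!: exI[of _ t])
    ultimately have "G t \<le> 1" by (intro tendsto_lowerbound[of G 1 "at_right r"]) auto
    moreover have "0 \<le> (v' t)\<^sup>2 / (\<rho>\<^sup>2 * t)" using r t by auto
    ultimately have "(v t)\<^sup>2 \<le> 1" by (simp add: G_def)
    hence "\<bar>v t\<bar> \<le> 1" by (simp add: abs_square_le_1)
    thus ?thesis using t False by (simp add: v_def divide_le_eq)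
  qed
qed

lemma tricomi_C_sq_le:
  assumes "0 < r" "0 < \<rho>" "r \<le> t"
  shows "(tricomi_C t r \<rho>)\<^sup>2 \<le> 1 / (\<rho>\<^sup>2 * r)"
proof -
  obtain D where "\<And>t. ((\<lambda>t. tricomi_C t r \<rho>) has_real_derivative D t) (at t)"
    "\<And>t. (D has_real_derivative - (\<rho>\<^sup>2 * t * tricomi_C t r \<rho>)) (at t)" "D r = 1"
    using tricomi_C_ode[OF assms(2)] by blast
  thus ?thesis using tricomi_ode_bounds(1)[of r \<rho> "\<lambda>t. tricomi_C t r \<rho>" D t] assms by auto
qed

lemma tricomi_C_abs_le:
  assumes "0 < r" "0 \<le> \<rho>" "r \<le> t"
  shows "\<bar>tricomi_C t r \<rho>\<bar> \<le> t - r"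
proof (cases "\<rho> = 0")
  case True thus ?thesis using assms by (simp add: tricomi_C_def)
next
  case False
  hence \<rho>: "0 < \<rho>" using assms by simp
  obtain D where "\<And>t. ((\<lambda>t. tricomi_C t r \<rho>) has_real_derivative D t) (at t)"
    "\<And>t. (D has_real_derivative - (\<rho>\<^sup>2 * t * tricomi_C t r \<rho>)) (at t)" "D r = 1"
    using tricomi_C_ode[OF \<rho>] by blast
  thus ?thesis using tricomi_ode_bounds(3)[of r \<rho> "\<lambda>t. tricomi_C t r \<rho>" D t] assms \<rho> by auto
qed

lemma tricomi_C_diff_sq_le:
  assumes "0 < r" "0 < \<rho>" "r \<le> s" "s \<le> t"
  shows "(tricomi_C t r \<rho> - tricomi_C s r \<rho>)\<^sup>2 \<le> (t - s)\<^sup>2 * (t / r)"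
proof (cases "s = t")
  case False
  hence st: "s < t" using assms by simp
  obtain D where D: "\<And>t. ((\<lambda>t. tricomi_C t r \<rho>) has_real_derivative D t) (at t)"
    "\<And>t. (D has_real_derivative - (\<rho>\<^sup>2 * t * tricomi_C t r \<rho>)) (at t)" "D r = 1"
    using tricomi_C_ode[OF assms(2)] by blast
  obtain u where u: "s < u" "u < t" "tricomi_C t r \<rho> - tricomi_C s r \<rho> = (t - s) * D u"
    using MVT2[OF st, of "\<lambda>t. tricomi_C t r \<rho>" D] D(1) by blast
  have "(D u)\<^sup>2 \<le> u / r"
    using tricomi_ode_bounds(2)[of r \<rho> "\<lambda>t. tricomi_C t r \<rho>" D u] D assms u by auto
  also have "\<dots> \<le> t / r" using u assms by (simp add: divide_right_mono)
  finally show ?thesis unfolding u power_mult_distrib by (rule mult_left_mono) simp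
qed auto

lemma airy_series_isCont: "isCont airy_f x" "isCont airy_g x"
proof -
  obtain f' where "\<And>x. (airy_f has_real_derivative f' x) (at x)"
    by (rule airy_solution[of 0 "1/3"]) (auto simp: airy_f_def[abs_def])
  thus "isCont airy_f x" by (rule DERIV_isCont)
  obtain g' where "\<And>x. (airy_g has_real_derivative g' x) (at x)"
    by (rule airy_solution[of 1 "2/3"]) (auto simp: airy_g_def[abs_def])
  thus "isCont airy_g x" by (rule DERIV_isCont)
qed

lemma airy_continuous_on: "continuous_on UNIV Ai" "continuous_on UNIV Bi"
  unfolding Ai_def[abs_def] Bi_def[abs_def]
  by (auto intro!: continuous_at_imp_continuous_on continuous_intros airy_series_isCont)

lemma airy_measurable [measurable]: "Ai \<in> borel_measurable borel" "Bi \<in> borel_measurable borel"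
  by (auto intro: borel_measurable_continuous_onI airy_continuous_on)

lemma tricomi_C_measurable [measurable]:
  assumes [measurable]: "f \<in> borel_measurable M" "g \<in> borel_measurable M" "h \<in> borel_measurable M"
  shows "(\<lambda>x. tricomi_C (f x) (g x) (h x)) \<in> borel_measurable M"
  unfolding tricomi_C_def by measurable

lemma tricomi_C_continuous_on: "continuous_on S (\<lambda>r. tricomi_C t r \<rho>)"
proof (cases "\<rho> = 0")
  case True thus ?thesis by (auto simp: tricomi_C_def intro!: continuous_intros)
next
  case False
  have *: "continuous_on S (\<lambda>r. Ai (- (\<rho> powr (2/3)) * r))" "continuous_on S (\<lambda>r. Bi (- (\<rho> powr (2/3)) * r))"
    by (rule continuous_on_compose2[OF airy_continuous_on(1)], auto intro!: continuous_intros)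
       (rule continuous_on_compose2[OF airy_continuous_on(2)], auto intro!: continuous_intros)
  show ?thesis
    unfolding tricomi_C_def if_not_P[OF False]
    by (intro continuous_on_mult continuous_on_diff continuous_on_const *)
qed

section \<open>Bessel's inequality and integrable power weights\<close>

lemma square_integrable_mult:
  fixes f g :: "'a \<Rightarrow> real"
  assumes "square_integrable M f" "square_integrable M g"
  shows "integrable M (\<lambda>x. f x * g x)"
proof (rule Bochner_Integration.integrable_bound)
  show "integrable M (\<lambda>x. (norm (f x))\<^sup>2 + (norm (g x))\<^sup>2)"
    using assms by (auto simp: square_integrable_def)
  show "(\<lambda>x. f x * g x) \<in> borel_measurable M"
    using assms by (auto simp: square_integrable_def)
  have "norm (f x * g x) \<le> norm ((norm (f x))\<^sup>2 + (norm (g x))\<^sup>2)" for x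
  proof -
    have "0 \<le> (\<bar>f x\<bar> - \<bar>g x\<bar>)\<^sup>2" by simp
    hence "2 * (\<bar>f x\<bar> * \<bar>g x\<bar>) \<le> (f x)\<^sup>2 + (g x)\<^sup>2" by (simp add: power2_diff)
    moreover have "0 \<le> \<bar>f x\<bar> * \<bar>g x\<bar>" by simp
    ultimately have "\<bar>f x\<bar> * \<bar>g x\<bar> \<le> (f x)\<^sup>2 + (g x)\<^sup>2" by linarith
    thus ?thesis by (simp add: abs_mult)
  qed
  thus "AE x in M. norm (f x * g x) \<le> norm ((norm (f x))\<^sup>2 + (norm (g x))\<^sup>2)" by simp
qed

lemma bessel_inequality:
  fixes e :: "'i \<Rightarrow> 'a \<Rightarrow> real" and g :: "'a \<Rightarrow> real"
  assumes I: "finite I" and e: "\<And>i. i \<in> I \<Longrightarrow> square_integrable M (e i)"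
    and on: "\<And>i j. i \<in> I \<Longrightarrow> j \<in> I \<Longrightarrow> (\<integral>x. e i x * e j x \<partial>M) = (if i = j then 1 else 0)"
    and g: "square_integrable M g"
  shows "(\<Sum>i\<in>I. (\<integral>x. g x * e i x \<partial>M)\<^sup>2) \<le> (\<integral>x. (g x)\<^sup>2 \<partial>M)"
proof -
  define c where "c i = (\<integral>x. g x * e i x \<partial>M)" for i
  have expand: "(g x - (\<Sum>i\<in>I. c i * e i x))\<^sup>2 = (g x)\<^sup>2 - (\<Sum>i\<in>I. 2 * c i * (g x * e i x))
      + (\<Sum>i\<in>I. \<Sum>j\<in>I. c i * c j * (e i x * e j x))" for x
  proof -
    have "(\<Sum>i\<in>I. c i * e i x)\<^sup>2 = (\<Sum>i\<in>I. \<Sum>j\<in>I. c i * c j * (e i x * e j x))"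
      unfolding power2_eq_square sum_product by (intro sum.cong refl) simp
    moreover have "2 * g x * (\<Sum>i\<in>I. c i * e i x) = (\<Sum>i\<in>I. 2 * c i * (g x * e i x))"
      unfolding sum_distrib_left by (intro sum.cong refl) simp
    ultimately show ?thesis by (simp only: power2_diff)
  qed
  have int_g: "integrable M (\<lambda>x. (g x)\<^sup>2)"
    using g by (simp add: square_integrable_def)
  have int1: "integrable M (\<lambda>x. \<Sum>i\<in>I. 2 * c i * (g x * e i x))"
    by (intro Bochner_Integration.integrable_sum integrable_mult_right square_integrable_mult g e)
  have int2: "integrable M (\<lambda>x. \<Sum>i\<in>I. \<Sum>j\<in>I. c i * c j * (e i x * e j x))"
    by (intro Bochner_Integration.integrable_sum integrable_mult_right square_integrable_mult e)
  have "0 \<le> (\<integral>x. (g x - (\<Sum>i\<in>I. c i * e i x))\<^sup>2 \<partial>M)" by simp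
  also have "\<dots> = (\<integral>x. (g x)\<^sup>2 \<partial>M) - (\<integral>x. (\<Sum>i\<in>I. 2 * c i * (g x * e i x)) \<partial>M)
      + (\<integral>x. (\<Sum>i\<in>I. \<Sum>j\<in>I. c i * c j * (e i x * e j x)) \<partial>M)"
    unfolding expand using int_g int1 int2
    by (simp only: Bochner_Integration.integral_add Bochner_Integration.integral_diff
        Bochner_Integration.integrable_diff)
  also have "(\<integral>x. (\<Sum>i\<in>I. 2 * c i * (g x * e i x)) \<partial>M) = (\<Sum>i\<in>I. 2 * c i * c i)"
  proof (subst Bochner_Integration.integral_sum)
    show "(\<Sum>i\<in>I. \<integral>x. 2 * c i * (g x * e i x) \<partial>M) = (\<Sum>i\<in>I. 2 * c i * c i)"
      by (intro sum.cong refl) (simp add: c_def)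
  qed (intro integrable_mult_right square_integrable_mult g e)
  also have "(\<integral>x. (\<Sum>i\<in>I. \<Sum>j\<in>I. c i * c j * (e i x * e j x)) \<partial>M) = (\<Sum>i\<in>I. c i * c i)"
  proof -
    have "(\<integral>x. (\<Sum>i\<in>I. \<Sum>j\<in>I. c i * c j * (e i x * e j x)) \<partial>M)
        = (\<Sum>i\<in>I. \<Sum>j\<in>I. \<integral>x. c i * c j * (e i x * e j x) \<partial>M)"
      by (subst Bochner_Integration.integral_sum, intro Bochner_Integration.integrable_sum integrable_mult_right square_integrable_mult e, assumption+,
        intro sum.cong refl Bochner_Integration.integral_sum integrable_mult_right square_integrable_mult e)
    also have "\<dots> = (\<Sum>i\<in>I. \<Sum>j\<in>I. if i = j then c i * c j else 0)"
      by (intro sum.cong refl) (simp add: on)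
    also have "\<dots> = (\<Sum>i\<in>I. c i * c i)" using I by (simp add: sum.delta)
    finally show ?thesis .
  qed
  finally show ?thesis
    by (simp add: c_def power2_eq_square flip: sum_distrib_left mult.assoc)
       (simp add: mult.assoc flip: sum_distrib_left)
qed

lemma integrable_indicator_powr_from_0:
  fixes a c :: real
  assumes "-1 < a"
  shows "integrable lborel (\<lambda>x. indicator {0..c} x * x powr a)"
proof (cases "0 \<le> c")
  case True
  have "(\<lambda>x. x powr a) absolutely_integrable_on {0..c}"
    using integrable_on_powr_from_0[OF assms True] by (intro nonnegative_absolutely_integrable_1) auto
  hence "integrable lebesgue (\<lambda>x. indicator {0..c} x * x powr a)"
    by (simp add: set_integrable_def)
  thus ?thesis by (subst (asm) integrable_completion) auto
qed simp

lemma integrable_one_plus_square_powr: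
  assumes a: "1/2 < a"
  shows "integrable lborel (\<lambda>x::real. (1 + x\<^sup>2) powr - a)"
proof -
  define h where "h x = indicator {1..} x * x powr (- 2 * a)" for x :: real
  have "(\<lambda>x. x powr (- 2 * a)) integrable_on {1..}"
    using has_integral_powr_to_inf[of "- 2 * a" 1] a by (auto simp: integrable_on_def)
  hence "(\<lambda>x. x powr (- 2 * a)) absolutely_integrable_on {1..}"
    by (intro nonnegative_absolutely_integrable_1) auto
  hence "integrable lebesgue h" by (simp add: set_integrable_def h_def[abs_def])
  hence h: "integrable lborel h" by (subst (asm) integrable_completion) (auto simp: h_def[abs_def])
  hence "integrable lborel (\<lambda>x. h (0 + (-1) * x))"
    by (subst lborel_integrable_real_affine_iff) auto
  hence h': "integrable lborel (\<lambda>x. h (- x))" by simp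
  have "integrable lborel (\<lambda>x::real. indicator {-1..1} x :: real)"
    using borel_integrable_compact[of "{-1..1::real}" "\<lambda>_. 1 :: real"] by simp
  with h h' have "integrable lborel (\<lambda>x. indicator {-1..1} x + h x + h (- x))"
    by (intro Bochner_Integration.integrable_add)
  thus ?thesis
  proof (rule Bochner_Integration.integrable_bound)
    have le: "(1 + x\<^sup>2) powr - a \<le> \<bar>x\<bar> powr (- 2 * a)" if "1 \<le> \<bar>x\<bar>" for x :: real
    proof -
      have "(1 + x\<^sup>2) powr - a \<le> (\<bar>x\<bar> ^ 2) powr - a"
        using that a by (intro powr_mono2') auto
      also have "\<dots> = (\<bar>x\<bar> powr real 2) powr - a" using that by (subst powr_realpow) auto
      also have "\<dots> = \<bar>x\<bar> powr (- 2 * a)" by (simp only: powr_powr) simp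
      finally show ?thesis .
    qed
    have one: "(1 + x\<^sup>2) powr - a \<le> 1" for x :: real
      using a powr_mono2'[of "- a" 1 "1 + x\<^sup>2"] by simp
    have h0: "0 \<le> h x" for x by (simp add: h_def)
    have "(1 + x\<^sup>2) powr - a \<le> indicator {-1..1} x + h x + h (- x)" for x :: real
    proof (cases "\<bar>x\<bar> \<le> 1")
      case True thus ?thesis using one[of x] h0[of x] h0[of "-x"] by (simp add: abs_le_iff)
    next
      case False
      thus ?thesis using le[of x] h0[of x] h0[of "-x"] by (cases "0 \<le> x") (auto simp: h_def)
    qed
    thus "AE x in lborel. norm ((1 + x\<^sup>2) powr - a) \<le> norm (indicator {-1..1} x + h x + h (- x))"
      using h0 by auto
  qed simp
qed

section \<open>Time increments of the kernel\<close>

text \<open>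
  The kernel is cut off after the current time, so that the increment of the solution between two
  times becomes a single pairing in the time variable of the noise.
\<close>

definition tricomi_increment :: "real \<Rightarrow> real \<Rightarrow> real \<Rightarrow> real \<Rightarrow> real" where
  "tricomi_increment s t \<rho> r
    = indicator {0..t} r * tricomi_C t r \<rho> - indicator {0..s} r * tricomi_C s r \<rho>"

text \<open>
  The first bound gives decay in the frequency, the second smallness in the increment of time, and the
  third is free of the singularity at \<open>r = 0\<close> that the other two have. For noise times \<open>r\<close> between \<open>s\<close>
  and \<open>t\<close> only one kernel is present; there \<open>\<bar>C\<bar> \<le> t - r \<le> t - s\<close> takes the place of the bound on the
  velocity.
\<close>

lemma tricomi_increment_bounds:
  assumes st: "0 \<le> s" "s < t" "t \<le> T" and r: "0 < r" "r \<le> t" and \<rho>: "0 < \<rho>"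
  defines "D \<equiv> tricomi_increment s t \<rho> r"
  shows "D\<^sup>2 \<le> 4 * (1 + T ^ 3) / (r * (1 + \<rho>\<^sup>2))" and "D\<^sup>2 \<le> (t - s)\<^sup>2 * T / r" and "D\<^sup>2 \<le> 4 * T\<^sup>2"
proof -
  have T: "0 < T" using st by linarith
  have Tr: "1 \<le> T / r" using r st by simp
  have "D\<^sup>2 \<le> 4 / (\<rho>\<^sup>2 * r) \<and> D\<^sup>2 \<le> (t - s)\<^sup>2 * (T / r) \<and> D\<^sup>2 \<le> (2 * T)\<^sup>2"
  proof (cases "r \<le> s")
    case True
    hence D: "D = tricomi_C t r \<rho> - tricomi_C s r \<rho>" using r by (simp add: D_def tricomi_increment_def)
    have "D\<^sup>2 \<le> 2 * (tricomi_C t r \<rho>)\<^sup>2 + 2 * (tricomi_C s r \<rho>)\<^sup>2"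
      using zero_le_power2[of "tricomi_C t r \<rho> + tricomi_C s r \<rho>"]
      unfolding D power2_diff power2_sum by linarith
    also have "\<dots> \<le> 2 * (1 / (\<rho>\<^sup>2 * r)) + 2 * (1 / (\<rho>\<^sup>2 * r))"
      using r \<rho> True by (intro add_mono mult_left_mono tricomi_C_sq_le) auto
    finally have 1: "D\<^sup>2 \<le> 4 / (\<rho>\<^sup>2 * r)" by (simp add: mult.commute)
    have "D\<^sup>2 \<le> (t - s)\<^sup>2 * (t / r)" unfolding D using r \<rho> True st by (intro tricomi_C_diff_sq_le) auto
    also have "\<dots> \<le> (t - s)\<^sup>2 * (T / r)"
      using st r by (intro mult_left_mono divide_right_mono) auto
    finally have 2: "D\<^sup>2 \<le> (t - s)\<^sup>2 * (T / r)" .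
    have "\<bar>D\<bar> \<le> (t - r) + (s - r)"
      using tricomi_C_abs_le[of r \<rho> t] tricomi_C_abs_le[of r \<rho> s] r \<rho> True unfolding D by linarith
    also have "\<dots> \<le> \<bar>2 * T\<bar>" using r st True by linarith
    finally have "D\<^sup>2 \<le> (2 * T)\<^sup>2" by (simp only: abs_le_square_iff)
    with 1 2 show ?thesis by blast
  next
    case False
    hence D: "D = tricomi_C t r \<rho>" using r by (simp add: D_def tricomi_increment_def)
    have "D\<^sup>2 \<le> 1 / (\<rho>\<^sup>2 * r)" unfolding D using r \<rho> by (intro tricomi_C_sq_le) auto
    also have "\<dots> \<le> 4 / (\<rho>\<^sup>2 * r)" using r by (intro divide_right_mono) auto
    finally have 1: "D\<^sup>2 \<le> 4 / (\<rho>\<^sup>2 * r)" .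
    have "\<bar>D\<bar> \<le> t - r" unfolding D using r \<rho> by (intro tricomi_C_abs_le) auto
    also have "\<dots> \<le> \<bar>t - s\<bar>" using False by linarith
    finally have D2: "D\<^sup>2 \<le> (t - s)\<^sup>2" by (simp only: abs_le_square_iff)
    also have "\<dots> \<le> (t - s)\<^sup>2 * (T / r)" using Tr mult_left_mono[of 1 "T / r" "(t - s)\<^sup>2"] by simp
    finally have 2: "D\<^sup>2 \<le> (t - s)\<^sup>2 * (T / r)" .
    have "(t - s)\<^sup>2 \<le> (2 * T)\<^sup>2" using st by (intro power_mono) auto
    with 1 2 D2 show ?thesis by linarith
  qed
  hence b: "D\<^sup>2 \<le> 4 / (\<rho>\<^sup>2 * r)" "D\<^sup>2 \<le> (t - s)\<^sup>2 * (T / r)" "D\<^sup>2 \<le> (2 * T)\<^sup>2" by blast+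
  show "D\<^sup>2 \<le> (t - s)\<^sup>2 * T / r" using b(2) by simp
  show b3: "D\<^sup>2 \<le> 4 * T\<^sup>2" using b(3) by (simp add: power_mult_distrib)
  have "\<rho>\<^sup>2 * D\<^sup>2 \<le> \<rho>\<^sup>2 * (4 / (\<rho>\<^sup>2 * r))" using b(1) by (intro mult_left_mono) auto
  hence "\<rho>\<^sup>2 * D\<^sup>2 \<le> 4 / r" using \<rho> by simp
  moreover have "4 * T\<^sup>2 \<le> 4 * T\<^sup>2 * (T / r)" using Tr mult_left_mono[of 1 "T / r" "4 * T\<^sup>2"] by simp
  ultimately have "D\<^sup>2 + \<rho>\<^sup>2 * D\<^sup>2 \<le> 4 * T\<^sup>2 * (T / r) + 4 / r" using b3 by linarith
  also have "\<dots> = 4 * (1 + T ^ 3) / r"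
    by (simp add: add_divide_distrib power2_eq_square power3_eq_cube distrib_left)
  finally have "D\<^sup>2 * (1 + \<rho>\<^sup>2) \<le> 4 * (1 + T ^ 3) / r" by (simp add: algebra_simps)
  moreover have "0 < 1 + \<rho>\<^sup>2" by (simp add: add_pos_nonneg)
  ultimately have "D\<^sup>2 \<le> 4 * (1 + T ^ 3) / r / (1 + \<rho>\<^sup>2)" by (simp only: pos_le_divide_eq)
  thus "D\<^sup>2 \<le> 4 * (1 + T ^ 3) / (r * (1 + \<rho>\<^sup>2))" by (simp only: divide_divide_eq_left)
qed

text \<open>
  The product of the constants of the three bounds, each raised to its interpolation weight.
\<close>

definition incr_const :: "real \<Rightarrow> real \<Rightarrow> real" where
  "incr_const T \<epsilon> = (4 * (1 + T ^ 3)) powr ((1 + \<epsilon>) / 2) * T powr (1 / 2 - \<epsilon>) * (4 * T\<^sup>2) powr (\<epsilon> / 2)"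

text \<open>
  The three bounds are interpolated with exponents \<open>(1 + \<epsilon>) / 2\<close>, \<open>1/2 - \<epsilon>\<close> and \<open>\<epsilon> / 2\<close>. The first
  exceeds \<open>1/2\<close>, which makes the frequency weight integrable; the first two sum to \<open>1 - \<epsilon> / 2 < 1\<close>,
  which makes the weight in \<open>r\<close> integrable at \<open>0\<close>; the second leaves the power \<open>1 - 2 \<epsilon>\<close> of \<open>t - s\<close>.
\<close>

lemma tricomi_increment_sq_le:
  assumes st: "0 \<le> s" "s < t" "t \<le> T" and r: "r \<noteq> 0" and \<rho>: "0 < \<rho>" and \<epsilon>: "0 < \<epsilon>" "\<epsilon> < 1/2"
  shows "(tricomi_increment s t \<rho> r)\<^sup>2 \<le> incr_const T \<epsilon> * (t - s) powr (1 - 2 * \<epsilon>)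
    * (1 + \<rho>\<^sup>2) powr - ((1 + \<epsilon>) / 2) * (indicator {0..T} r * r powr (\<epsilon> / 2 - 1))"
proof (cases "0 < r \<and> r \<le> t")
  case False
  hence "tricomi_increment s t \<rho> r = 0" using r st by (auto simp: tricomi_increment_def indicator_def)
  moreover have "0 \<le> incr_const T \<epsilon>" by (simp add: incr_const_def)
  ultimately show ?thesis by simp
next
  case True
  define D where "D = tricomi_increment s t \<rho> r"
  define h where "h = t - s"
  note b = tricomi_increment_bounds[OF st conjunct1[OF True] conjunct2[OF True] \<rho>, folded D_def h_def]
  have T: "0 < T" and h: "0 < h" using st by (auto simp: h_def)
  have r0: "0 < r" using True by simp
  have w: "0 < 1 + \<rho>\<^sup>2" by (simp add: add_pos_nonneg)
  let ?a = "(1 + \<epsilon>) / 2" and ?b = "1 / 2 - \<epsilon>" and ?c = "\<epsilon> / 2"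
  have "D\<^sup>2 = (D\<^sup>2) powr ?a * (D\<^sup>2) powr ?b * (D\<^sup>2) powr ?c"
  proof -
    have "?a + ?b + ?c = 1" by (simp add: field_simps)
    thus ?thesis by (simp only: powr_add[symmetric]) simp
  qed
  also have "\<dots> \<le> (4 * (1 + T ^ 3) / (r * (1 + \<rho>\<^sup>2))) powr ?a * (h\<^sup>2 * T / r) powr ?b * (4 * T\<^sup>2) powr ?c"
    using \<epsilon> b by (intro mult_mono powr_mono2) auto
  also have "\<dots> = incr_const T \<epsilon> * h powr (1 - 2 * \<epsilon>) * (1 + \<rho>\<^sup>2) powr - ?a * r powr (\<epsilon> / 2 - 1)"
  proof -
    have quot: "(x / (y * z)) powr a = x powr a * (y powr - a * z powr - a)" for x y z a :: real
      by (simp only: powr_divide powr_mult powr_minus) (simp add: divide_inverse)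
    have "(4 * (1 + T ^ 3) / (r * (1 + \<rho>\<^sup>2))) powr ?a
        = (4 * (1 + T ^ 3)) powr ?a * (r powr - ?a * (1 + \<rho>\<^sup>2) powr - ?a)"
      by (rule quot)
    moreover have "(h\<^sup>2 * T / r) powr ?b = h powr (1 - 2 * \<epsilon>) * T powr ?b * r powr - ?b"
    proof -
      have "h\<^sup>2 = h powr real 2" using h by (subst powr_realpow) auto
      hence "(h\<^sup>2) powr ?b = h powr (real 2 * ?b)" by (simp only: powr_powr)
      also have "real 2 * ?b = 1 - 2 * \<epsilon>" by simp
      finally have "(h\<^sup>2) powr ?b = h powr (1 - 2 * \<epsilon>)" .
      thus ?thesis using quot[of "h\<^sup>2 * T" r 1 ?b] by (simp only: powr_mult mult_1_right powr_one_eq_one)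
    qed
    moreover have "r powr (\<epsilon> / 2 - 1) = r powr - ?a * r powr - ?b"
    proof -
      have "\<epsilon> / 2 - 1 = - ?a + - ?b" by (simp add: field_simps)
      thus ?thesis by (simp only: powr_add)
    qed
    ultimately show ?thesis unfolding incr_const_def by (simp only: ac_simps)
  qed
  also have "\<dots> = incr_const T \<epsilon> * h powr (1 - 2 * \<epsilon>) * (1 + \<rho>\<^sup>2) powr - ?a
      * (indicator {0..T} r * r powr (\<epsilon> / 2 - 1))"
    using True st by simp
  finally show ?thesis unfolding D_def h_def .
qed

definition tricomi_transform :: "(real \<Rightarrow> real) \<Rightarrow> real \<Rightarrow> real \<Rightarrow> real" where
  "tricomi_transform \<psi> t \<xi> = (LINT r:{0..t}|lborel. tricomi_C t r \<bar>\<xi>\<bar> * \<psi> r)"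

lemma continuous_half_line_measurable:
  fixes \<psi> :: "real \<Rightarrow> real"
  assumes "continuous_on {0..} \<psi>"
  shows "(\<lambda>r. indicator {0..} r * \<psi> r) \<in> borel_measurable borel"
proof -
  have "(\<lambda>r. indicator {0..} r *\<^sub>R \<psi> r) \<in> borel_measurable borel"
    using assms by (intro borel_measurable_continuous_on_indicator) auto
  thus ?thesis by simp
qed

lemma set_integrable_tricomi_transform:
  assumes "continuous_on {0..} \<psi>"
  shows "set_integrable lborel {0..t} (\<lambda>r. tricomi_C t r \<rho> * \<psi> r)"
  unfolding set_integrable_def
  by (intro borel_integrable_compact compact_Icc continuous_on_mult tricomi_C_continuous_on
      continuous_on_subset[OF assms]) auto

lemma tricomi_transform_measurable:
  assumes "continuous_on {0..} \<psi>"
  shows "tricomi_transform \<psi> t \<in> borel_measurable borel"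
proof -
  note [measurable] = continuous_half_line_measurable[OF assms]
  have "(\<lambda>\<xi>. \<integral>r. indicator {0..t} r * (tricomi_C t r \<bar>\<xi>\<bar> * (indicator {0..} r * \<psi> r)) \<partial>lborel)
      \<in> borel_measurable borel"
    by measurable
  moreover have "tricomi_transform \<psi> t
      = (\<lambda>\<xi>. \<integral>r. indicator {0..t} r * (tricomi_C t r \<bar>\<xi>\<bar> * (indicator {0..} r * \<psi> r)) \<partial>lborel)"
    unfolding tricomi_transform_def[abs_def] set_lebesgue_integral_def
    by (intro ext Bochner_Integration.integral_cong refl) (auto simp: indicator_def)
  ultimately show ?thesis by simp
qed

lemma tricomi_transform_bounded:
  assumes cont: "continuous_on {0..} \<psi>"
  obtains K where "\<And>\<xi>. \<bar>tricomi_transform \<psi> t \<xi>\<bar> \<le> K"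
proof
  fix \<xi> :: real
  have "continuous_on {0..t} (\<lambda>r. t * \<bar>\<psi> r\<bar>)"
    by (intro continuous_intros continuous_on_subset[OF cont]) auto
  hence int: "integrable lborel (\<lambda>r. indicator {0..t} r *\<^sub>R (t * \<bar>\<psi> r\<bar>))"
    by (intro borel_integrable_compact compact_Icc)
  note int' = set_integrable_tricomi_transform[OF cont, of t "\<bar>\<xi>\<bar>", unfolded set_integrable_def]
  have "norm (tricomi_transform \<psi> t \<xi>)
      \<le> (\<integral>r. norm (indicator {0..t} r *\<^sub>R (tricomi_C t r \<bar>\<xi>\<bar> * \<psi> r)) \<partial>lborel)"
    unfolding tricomi_transform_def set_lebesgue_integral_def by (rule integral_norm_bound)
  also have "\<dots> \<le> (\<integral>r. indicator {0..t} r *\<^sub>R (t * \<bar>\<psi> r\<bar>) \<partial>lborel)"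
  proof (rule integral_mono_AE[OF integrable_norm[OF int'] int])
    show "AE r in lborel. norm (indicator {0..t} r *\<^sub>R (tricomi_C t r \<bar>\<xi>\<bar> * \<psi> r))
        \<le> indicator {0..t} r *\<^sub>R (t * \<bar>\<psi> r\<bar>)"
      using AE_lborel_singleton[of 0]
    proof eventually_elim
      case (elim r)
      show ?case
      proof (cases "r \<in> {0..t}")
        case True
        hence "\<bar>tricomi_C t r \<bar>\<xi>\<bar>\<bar> \<le> t" using tricomi_C_abs_le[of r "\<bar>\<xi>\<bar>" t] elim by auto
        thus ?thesis using True by (simp add: abs_mult mult_right_mono)
      qed simp
    qed
  qed
  finally show "\<bar>tricomi_transform \<psi> t \<xi>\<bar> \<le> (\<integral>r. indicator {0..t} r *\<^sub>R (t * \<bar>\<psi> r\<bar>) \<partial>lborel)"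
    by simp
qed

lemma tricomi_transform_increment:
  assumes cont: "continuous_on {0..} \<psi>"
  shows "tricomi_transform \<psi> t \<xi> - tricomi_transform \<psi> s \<xi>
    = (\<integral>r. tricomi_increment s t \<bar>\<xi>\<bar> r * \<psi> r \<partial>restrict_space lborel {0..})"
proof -
  note int = set_integrable_tricomi_transform[OF cont, of _ "\<bar>\<xi>\<bar>", unfolded set_integrable_def]
  have "tricomi_transform \<psi> t \<xi> - tricomi_transform \<psi> s \<xi>
      = (\<integral>r. indicator {0..t} r *\<^sub>R (tricomi_C t r \<bar>\<xi>\<bar> * \<psi> r)
          - indicator {0..s} r *\<^sub>R (tricomi_C s r \<bar>\<xi>\<bar> * \<psi> r) \<partial>lborel)"
    unfolding tricomi_transform_def set_lebesgue_integral_def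
    by (rule Bochner_Integration.integral_diff[symmetric, OF int int])
  also have "\<dots> = (\<integral>r. indicator {0..} r *\<^sub>R (tricomi_increment s t \<bar>\<xi>\<bar> r * \<psi> r) \<partial>lborel)"
    by (intro Bochner_Integration.integral_cong refl) (auto simp: tricomi_increment_def indicator_def left_diff_distrib)
  also have "\<dots> = (\<integral>r. tricomi_increment s t \<bar>\<xi>\<bar> r * \<psi> r \<partial>restrict_space lborel {0..})"
    by (subst integral_restrict_space) auto
  finally show ?thesis .
qed

definition incr_time_weight :: "real \<Rightarrow> real \<Rightarrow> real" where
  "incr_time_weight T \<epsilon> = (\<integral>r. indicator {0..T} r * r powr (\<epsilon> / 2 - 1) \<partial>lborel)"

lemma tricomi_increment_L2:
  assumes st: "0 \<le> s" "s < t" "t \<le> T" and \<rho>: "0 < \<rho>" and \<epsilon>: "0 < \<epsilon>" "\<epsilon> < 1/2"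
  shows "square_integrable (restrict_space lborel {0..}) (tricomi_increment s t \<rho>)"
    and "(\<integral>r. (tricomi_increment s t \<rho> r)\<^sup>2 \<partial>restrict_space lborel {0..})
      \<le> incr_const T \<epsilon> * (t - s) powr (1 - 2 * \<epsilon>) * (1 + \<rho>\<^sup>2) powr - ((1 + \<epsilon>) / 2) * incr_time_weight T \<epsilon>"
proof -
  have [measurable]: "tricomi_increment s t \<rho> \<in> borel_measurable borel"
    unfolding tricomi_increment_def[abs_def] by measurable
  define c where "c = incr_const T \<epsilon> * (t - s) powr (1 - 2 * \<epsilon>) * (1 + \<rho>\<^sup>2) powr - ((1 + \<epsilon>) / 2)"
  have w: "integrable lborel (\<lambda>r. c * (indicator {0..T} r * r powr (\<epsilon> / 2 - 1)))"
    using \<epsilon> by (intro integrable_mult_right integrable_indicator_powr_from_0) auto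
  have AE: "AE r in lborel. indicator {0..} r *\<^sub>R (tricomi_increment s t \<rho> r)\<^sup>2
      \<le> c * (indicator {0..T} r * r powr (\<epsilon> / 2 - 1))"
    using AE_lborel_singleton[of 0]
  proof eventually_elim
    case (elim r)
    have "indicator {0..} r *\<^sub>R (tricomi_increment s t \<rho> r)\<^sup>2 \<le> (tricomi_increment s t \<rho> r)\<^sup>2"
      by (auto simp: indicator_def)
    also have "\<dots> \<le> c * (indicator {0..T} r * r powr (\<epsilon> / 2 - 1))"
      unfolding c_def by (rule tricomi_increment_sq_le[OF st elim \<rho> \<epsilon>])
    finally show ?case .
  qed
  have int: "integrable lborel (\<lambda>r. indicator {0..} r *\<^sub>R (tricomi_increment s t \<rho> r)\<^sup>2)"
  proof (rule Bochner_Integration.integrable_bound[OF w])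
    show "AE r in lborel. norm (indicator {0..} r *\<^sub>R (tricomi_increment s t \<rho> r)\<^sup>2)
        \<le> norm (c * (indicator {0..T} r * r powr (\<epsilon> / 2 - 1)))"
      using AE by eventually_elim auto
  qed measurable
  have "integrable (restrict_space lborel {0..}) (\<lambda>r. (tricomi_increment s t \<rho> r)\<^sup>2)"
    using int by (subst integrable_restrict_space) auto
  thus "square_integrable (restrict_space lborel {0..}) (tricomi_increment s t \<rho>)"
    unfolding square_integrable_def by (auto intro: measurable_restrict_space1)
  have "(\<integral>r. (tricomi_increment s t \<rho> r)\<^sup>2 \<partial>restrict_space lborel {0..})
      = (\<integral>r. indicator {0..} r *\<^sub>R (tricomi_increment s t \<rho> r)\<^sup>2 \<partial>lborel)"
    by (subst integral_restrict_space) auto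
  also have "\<dots> \<le> (\<integral>r. c * (indicator {0..T} r * r powr (\<epsilon> / 2 - 1)) \<partial>lborel)"
    by (rule integral_mono_AE[OF int w AE])
  also have "\<dots> = c * incr_time_weight T \<epsilon>" unfolding incr_time_weight_def by (rule integral_mult_right_zero)
  finally show "(\<integral>r. (tricomi_increment s t \<rho> r)\<^sup>2 \<partial>restrict_space lborel {0..})
      \<le> incr_const T \<epsilon> * (t - s) powr (1 - 2 * \<epsilon>) * (1 + \<rho>\<^sup>2) powr - ((1 + \<epsilon>) / 2) * incr_time_weight T \<epsilon>"
    unfolding c_def .
qed

section \<open>Hermite functions and their Fourier transforms\<close>

fun hermite_poly :: "nat \<Rightarrow> real poly" where
  "hermite_poly 0 = 1"
| "hermite_poly (Suc k) = [:0, 2:] * hermite_poly k - pderiv (hermite_poly k)"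

lemma gaussian_derivs:
  "(deriv ^^ k) (\<lambda>u. exp (- u\<^sup>2)) = (\<lambda>x. (-1) ^ k * poly (hermite_poly k) x * exp (- x\<^sup>2))"
proof (induction k)
  case (Suc k)
  have "((\<lambda>x. (-1) ^ k * poly (hermite_poly k) x * exp (- x\<^sup>2)) has_real_derivative
      (-1) ^ Suc k * poly (hermite_poly (Suc k)) x * exp (- x\<^sup>2)) (at x)" for x
    by (auto intro!: derivative_eq_intros poly_DERIV simp: algebra_simps)
  hence "deriv (\<lambda>x. (-1) ^ k * poly (hermite_poly k) x * exp (- x\<^sup>2))
      = (\<lambda>x. (-1) ^ Suc k * poly (hermite_poly (Suc k)) x * exp (- x\<^sup>2))"
    by (intro ext DERIV_imp_deriv)
  thus ?case using Suc.IH by simp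
qed simp

lemma hermite_eq_poly: "hermite k x = poly (hermite_poly k) x"
proof -
  have "((-1) ^ k * (-1) ^ k :: real) = 1" by (simp flip: power_mult_distrib)
  moreover have "exp (x\<^sup>2) * exp (- x\<^sup>2) = 1" by (simp flip: exp_add)
  ultimately show ?thesis unfolding hermite_def gaussian_derivs
    by (metis (no_types, lifting) mult.assoc mult.commute mult_1)
qed

lemma pderiv_hermite_poly: "pderiv (hermite_poly (Suc k)) = smult (2 * real (Suc k)) (hermite_poly k)"
proof (induction k)
  case 0 show ?case by (simp add: pderiv_mult pderiv_pCons)
next
  case (Suc k)
  let ?H = hermite_poly
  have "pderiv ([:0, 2:] * q - pderiv q) = smult 2 q + [:0, 2:] * pderiv q - pderiv (pderiv q)"
    for q :: "real poly" by (simp add: pderiv_mult pderiv_diff pderiv_pCons pderiv_smult algebra_simps)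
  hence "pderiv (?H (Suc (Suc k)))
      = smult 2 (?H (Suc k)) + [:0, 2:] * pderiv (?H (Suc k)) - pderiv (pderiv (?H (Suc k)))"
    by (simp only: hermite_poly.simps(2)[of "Suc k"])
  also have "\<dots> = smult 2 (?H (Suc k)) + smult (2 * real (Suc k)) ([:0, 2:] * ?H k - pderiv (?H k))"
    unfolding Suc by (simp add: pderiv_smult smult_diff_right del: mult_pCons_left hermite_poly.simps)
  also have "[:0, 2:] * ?H k - pderiv (?H k) = ?H (Suc k)" by simp
  also have "smult 2 (?H (Suc k)) + smult (2 * real (Suc k)) (?H (Suc k))
      = smult (2 * real (Suc (Suc k))) (?H (Suc k))"
    by (simp add: smult_add_left[symmetric])
  finally show ?case .
qed

lemma poly_measurable [measurable]: "poly (p :: real poly) \<in> borel_measurable borel"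
  by (intro borel_measurable_continuous_onI continuous_intros)

lemma integrable_poly_gaussian_half:
  fixes p :: "real poly"
  shows "integrable lborel (\<lambda>x. poly p x * exp (- x\<^sup>2 / 2))"
proof -
  have "integrable lborel (\<lambda>x. \<Sum>i\<le>degree p. sqrt (2 * pi) * coeff p i * (std_normal_density x * x ^ i))"
    by (intro Bochner_Integration.integrable_sum integrable_mult_right integrable_std_normal_moment)
  also have "(\<lambda>x. \<Sum>i\<le>degree p. sqrt (2 * pi) * coeff p i * (std_normal_density x * x ^ i))
      = (\<lambda>x. poly p x * exp (- x\<^sup>2 / 2))"
  proof
    fix x :: real
    have "sqrt (2 * pi) * coeff p i * (std_normal_density x * x ^ i)
        = coeff p i * x ^ i * exp (- x\<^sup>2 / 2)" for i
      by (simp add: std_normal_density_def)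
    thus "(\<Sum>i\<le>degree p. sqrt (2 * pi) * coeff p i * (std_normal_density x * x ^ i))
        = poly p x * exp (- x\<^sup>2 / 2)"
      by (simp only: poly_altdef sum_distrib_right)
  qed
  finally show ?thesis .
qed

lemma integrable_poly_gaussian:
  fixes p :: "real poly"
  shows "integrable lborel (\<lambda>x. poly p x * exp (- x\<^sup>2))"
proof (rule Bochner_Integration.integrable_bound[OF integrable_poly_gaussian_half[of p]])
  show "AE x in lborel. norm (poly p x * exp (- x\<^sup>2)) \<le> norm (poly p x * exp (- x\<^sup>2 / 2))"
    by (auto simp: abs_mult intro!: mult_left_mono)
qed measurable

lemma power_gaussian_half_tendsto_0: "((\<lambda>x::real. x ^ i * exp (- x\<^sup>2 / 2)) \<longlongrightarrow> 0) at_top"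
proof (rule Lim_null_comparison[OF _ tendsto_power_div_exp_0[of i]])
  show "\<forall>\<^sub>F x in at_top. norm (x ^ i * exp (- x\<^sup>2 / 2)) \<le> x ^ i / exp x"
    using eventually_ge_at_top[of 2]
  proof eventually_elim
    case (elim x)
    hence "x * 2 \<le> x * x" using mult_left_mono[of 2 x x] by linarith
    hence "- x\<^sup>2 / 2 \<le> - x" unfolding power2_eq_square by linarith
    hence "exp (- x\<^sup>2 / 2) \<le> exp (- x)" by (simp only: exp_le_cancel_iff)
    hence "x ^ i * exp (- x\<^sup>2 / 2) \<le> x ^ i * exp (- x)" using elim by (intro mult_left_mono) auto
    moreover have "norm (x ^ i * exp (- x\<^sup>2 / 2)) = x ^ i * exp (- x\<^sup>2 / 2)"
      using elim by (simp only: real_norm_def abs_mult power_abs) simp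
    ultimately show ?case by (simp only: exp_minus divide_inverse)
  qed
qed

lemma poly_gaussian_half_tendsto_0:
  fixes p :: "real poly"
  shows "((\<lambda>x::real. poly p x * exp (- x\<^sup>2 / 2)) \<longlongrightarrow> 0) at_top"
  "((\<lambda>x::real. poly p x * exp (- x\<^sup>2 / 2)) \<longlongrightarrow> 0) at_bot"
proof -
  have top: "((\<lambda>x::real. poly p x * exp (- x\<^sup>2 / 2)) \<longlongrightarrow> 0) at_top" for p :: "real poly"
  proof -
    have "((\<lambda>x. \<Sum>i\<le>degree p. coeff p i * (x ^ i * exp (- x\<^sup>2 / 2))) \<longlongrightarrow>
        (\<Sum>i\<le>degree p. coeff p i * 0)) at_top"
      by (intro tendsto_intros power_gaussian_half_tendsto_0)
    thus ?thesis by (simp add: poly_altdef sum_distrib_right mult.assoc)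
  qed
  show "((\<lambda>x::real. poly p x * exp (- x\<^sup>2 / 2)) \<longlongrightarrow> 0) at_top" by (rule top)
  show "((\<lambda>x::real. poly p x * exp (- x\<^sup>2 / 2)) \<longlongrightarrow> 0) at_bot"
    using top[of "pcompose p [:0, -1:]"]
    by (subst filterlim_at_bot_mirror) (simp add: poly_pcompose)
qed

lemma integral_derivative_eq_0:
  fixes F f :: "real \<Rightarrow> 'a :: euclidean_space"
  assumes "\<And>x. (F has_vector_derivative f x) (at x)" "\<And>x. isCont f x" "integrable lborel f"
    and "(F \<longlongrightarrow> 0) at_top" "(F \<longlongrightarrow> 0) at_bot"
  shows "(\<integral>x. f x \<partial>lborel) = 0"
proof -
  have "(LBINT x=-\<infinity>..\<infinity>. f x) = 0 - 0"
    using assms by (intro interval_integral_FTC_integrable[where F = F])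
      (auto simp: ereal_tendsto_simps set_integrable_def einterval_def)
  thus ?thesis by (simp add: interval_lebesgue_integral_def set_lebesgue_integral_def einterval_def)
qed

definition gauss_fourier :: "real poly \<Rightarrow> real \<Rightarrow> complex" where
  "gauss_fourier p \<xi> =
    (\<integral>x. exp (- \<i> * of_real (\<xi> * x)) * of_real (poly p x * exp (- x\<^sup>2 / 2)) \<partial>lborel)"

lemma integrable_gauss_fourier:
  "integrable lborel (\<lambda>x. exp (- \<i> * of_real (\<xi> * x)) * of_real (poly p x * exp (- x\<^sup>2 / 2)) :: complex)"
proof (rule Bochner_Integration.integrable_bound[OF integrable_poly_gaussian_half[of p]])
  have "norm (exp (- \<i> * complex_of_real (\<xi> * x))) = 1" for x
    by (simp add: norm_exp_eq_Re)
  thus "AE x in lborel. norm (exp (- \<i> * of_real (\<xi> * x)) * of_real (poly p x * exp (- x\<^sup>2 / 2)) :: complex)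
      \<le> norm (poly p x * exp (- x\<^sup>2 / 2))"
    by (auto simp: norm_mult)
qed measurable

lemma gauss_fourier_diff: "gauss_fourier (p - q) \<xi> = gauss_fourier p \<xi> - gauss_fourier q \<xi>"
  unfolding gauss_fourier_def
  by (subst Bochner_Integration.integral_diff[symmetric, OF integrable_gauss_fourier integrable_gauss_fourier])
     (simp add: algebra_simps)

lemma gauss_fourier_smult: "gauss_fourier (smult c p) \<xi> = of_real c * gauss_fourier p \<xi>"
proof -
  have "gauss_fourier (smult c p) \<xi> = (\<integral>x. of_real c *
      (exp (- \<i> * of_real (\<xi> * x)) * of_real (poly p x * exp (- x\<^sup>2 / 2))) \<partial>lborel)"
    unfolding gauss_fourier_def by (intro Bochner_Integration.integral_cong) (auto simp: algebra_simps)
  thus ?thesis unfolding gauss_fourier_def by simp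
qed

lemma gauss_fourier_derivative:
  "gauss_fourier (pderiv p - [:0, 1:] * p) \<xi> = \<i> * of_real \<xi> * gauss_fourier p \<xi>"
proof -
  let ?e = "\<lambda>x. exp (- \<i> * complex_of_real (\<xi> * x))"
  let ?w = "\<lambda>p x. complex_of_real (poly p x * exp (- x\<^sup>2 / 2))"
  define f where "f x = ?e x * ?w (pderiv p - [:0, 1:] * p) x - \<i> * of_real \<xi> * (?e x * ?w p x)" for x
  have "((\<lambda>x. poly p x * exp (- x\<^sup>2 / 2)) has_real_derivative
      poly (pderiv p - [:0, 1:] * p) x * exp (- x\<^sup>2 / 2)) (at x)" for x
    by (auto intro!: derivative_eq_intros poly_DERIV simp: algebra_simps)
  hence w: "(?w p has_vector_derivative ?w (pderiv p - [:0, 1:] * p) x) (at x)" for x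
    by (intro has_vector_derivative_of_real) (simp add: has_real_derivative_iff_has_vector_derivative)
  have e: "(?e has_vector_derivative - \<i> * of_real \<xi> * ?e x) (at x)" for x
    by (auto intro!: derivative_eq_intros has_vector_derivative_real_field simp: algebra_simps)
  have "(\<integral>x. f x \<partial>lborel) = 0"
  proof (rule integral_derivative_eq_0)
    show "((\<lambda>x. ?e x * ?w p x) has_vector_derivative f x) (at x)" for x
    proof -
      have "E * A - \<i> * c * (E * B) = E * A + - \<i> * c * E * B" for E A B c :: complex by simp
      hence "f x = ?e x * ?w (pderiv p - [:0, 1:] * p) x + - \<i> * of_real \<xi> * ?e x * ?w p x"
        unfolding f_def by blast
      with has_vector_derivative_mult[OF e w] show ?thesis by (rule has_vector_derivative_eq_rhs[OF _ sym])
    qed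
    have "continuous_on UNIV f" unfolding f_def by (auto intro!: continuous_intros)
    thus "isCont f x" for x by (simp add: continuous_on_eq_continuous_at)
    show "integrable lborel f"
      unfolding f_def by (intro Bochner_Integration.integrable_diff integrable_mult_right integrable_gauss_fourier)
    have norm: "norm (?e x * ?w p x) = norm (poly p x * exp (- x\<^sup>2 / 2))" for x
      by (simp add: norm_mult norm_exp_eq_Re abs_mult)
    show "((\<lambda>x. ?e x * ?w p x) \<longlongrightarrow> 0) at_top"
      by (subst tendsto_norm_zero_iff[symmetric], unfold norm)
         (intro tendsto_norm_zero poly_gaussian_half_tendsto_0)
    show "((\<lambda>x. ?e x * ?w p x) \<longlongrightarrow> 0) at_bot"
      by (subst tendsto_norm_zero_iff[symmetric], unfold norm)
         (intro tendsto_norm_zero poly_gaussian_half_tendsto_0)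
  qed
  moreover have "(\<integral>x. f x \<partial>lborel)
      = gauss_fourier (pderiv p - [:0, 1:] * p) \<xi> - \<i> * of_real \<xi> * gauss_fourier p \<xi>"
    unfolding f_def gauss_fourier_def
    by (subst Bochner_Integration.integral_diff)
       (intro integrable_gauss_fourier integrable_mult_right | simp)+
  ultimately show ?thesis by simp
qed

lemma gauss_fourier_1: "gauss_fourier 1 \<xi> = sqrt (2 * pi) * exp (- \<xi>\<^sup>2 / 2)"
proof -
  have "complex_of_real (exp (- (- \<xi>)\<^sup>2 / 2)) = (CLINT x|std_normal_distribution. iexp (- \<xi> * x))"
    using fun_cong[OF char_std_normal_distribution, of "- \<xi>"] by (simp add: char_def)
  also have "\<dots> = (CLINT x|lborel. std_normal_density x *\<^sub>R iexp (- \<xi> * x))"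
    by (subst integral_density) (auto simp: std_normal_density_def)
  also have "\<dots> = (CLINT x|lborel. complex_of_real (1 / sqrt (2 * pi)) *
      (exp (- \<i> * of_real (\<xi> * x)) * of_real (poly 1 x * exp (- x\<^sup>2 / 2))))"
    by (intro Bochner_Integration.integral_cong refl)
       (simp add: std_normal_density_def scaleR_conv_of_real)
  also have "\<dots> = complex_of_real (1 / sqrt (2 * pi)) * gauss_fourier 1 \<xi>"
    unfolding gauss_fourier_def by (rule integral_mult_right_zero)
  finally have "complex_of_real (sqrt (2 * pi)) * complex_of_real (exp (- \<xi>\<^sup>2 / 2))
      = complex_of_real (sqrt (2 * pi)) * (complex_of_real (1 / sqrt (2 * pi)) * gauss_fourier 1 \<xi>)"
    by simp
  thus ?thesis by simp
qed

text \<open>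
  The Hermite recursion reads \<open>H\<^sub>j\<^sub>+\<^sub>1 = H\<^sub>j' - 2 (H\<^sub>j' - x H\<^sub>j)\<close>. The bracket is the weighted derivative, which
  the transform turns into multiplication by \<open>\<i> \<xi>\<close>, and \<open>H\<^sub>j'\<close> is a multiple of \<open>H\<^sub>j\<^sub>-\<^sub>1\<close>. Hence the
  eigenvalue \<open>(- \<i>) ^ k\<close> follows by induction without differentiating the transform in \<open>\<xi>\<close>.
\<close>

lemma gauss_fourier_hermite:
  "gauss_fourier (hermite_poly k) \<xi>
    = sqrt (2 * pi) * (- \<i>) ^ k * of_real (poly (hermite_poly k) \<xi> * exp (- \<xi>\<^sup>2 / 2))"
proof (induction k rule: less_induct)
  case (less k)
  let ?H = hermite_poly
  show ?case
  proof (cases k)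
    case 0 thus ?thesis by (simp add: gauss_fourier_1)
  next
    case (Suc j)
    have "[:0, 2:] * q - pderiv q = pderiv q - smult 2 (pderiv q - [:0, 1:] * q)"
      for q :: "real poly"
      by (subst poly_eq_poly_eq_iff[symmetric], rule ext) (simp add: algebra_simps)
    hence H: "?H (Suc j) = pderiv (?H j) - smult 2 (pderiv (?H j) - [:0, 1:] * ?H j)"
      by (simp only: hermite_poly.simps)
    have "gauss_fourier (?H (Suc j)) \<xi> = gauss_fourier (pderiv (?H j)) \<xi>
        - gauss_fourier (smult 2 (pderiv (?H j) - [:0, 1:] * ?H j)) \<xi>"
      unfolding H by (rule gauss_fourier_diff)
    hence rec: "gauss_fourier (?H (Suc j)) \<xi>
        = gauss_fourier (pderiv (?H j)) \<xi> - 2 * (\<i> * of_real \<xi> * gauss_fourier (?H j) \<xi>)"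
      by (simp only: gauss_fourier_smult gauss_fourier_derivative of_real_numeral)
    have IHj: "gauss_fourier (?H j) \<xi>
        = sqrt (2 * pi) * (- \<i>) ^ j * of_real (poly (?H j) \<xi> * exp (- \<xi>\<^sup>2 / 2))"
      using Suc by (intro less.IH) simp
    have "gauss_fourier (pderiv (?H j)) \<xi>
        = - (sqrt (2 * pi) * (- \<i>) ^ Suc j * of_real (poly (pderiv (?H j)) \<xi> * exp (- \<xi>\<^sup>2 / 2)))"
    proof (cases j)
      case 0 thus ?thesis by (simp add: gauss_fourier_def)
    next
      case (Suc i)
      hence "gauss_fourier (?H i) \<xi>
          = sqrt (2 * pi) * (- \<i>) ^ i * of_real (poly (?H i) \<xi> * exp (- \<xi>\<^sup>2 / 2))"
        using \<open>k = Suc j\<close> by (intro less.IH) simp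
      thus ?thesis unfolding Suc pderiv_hermite_poly gauss_fourier_smult by simp
    qed
    thus ?thesis unfolding \<open>k = Suc j\<close> rec IHj by (simp add: algebra_simps)
  qed
qed

definition gauss_integral :: "real poly \<Rightarrow> real" where
  "gauss_integral p = (\<integral>x. poly p x * exp (- x\<^sup>2) \<partial>lborel)"

lemma gauss_integral_add: "gauss_integral (p + q) = gauss_integral p + gauss_integral q"
  unfolding gauss_integral_def
  by (subst Bochner_Integration.integral_add[symmetric, OF integrable_poly_gaussian integrable_poly_gaussian])
     (simp add: algebra_simps)

lemma gauss_integral_smult: "gauss_integral (smult c p) = c * gauss_integral p"
  unfolding gauss_integral_def by (simp add: mult.assoc)

lemma gauss_integral_by_parts: "gauss_integral (pderiv p - [:0, 2:] * p) = 0"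
  unfolding gauss_integral_def
proof (rule integral_derivative_eq_0)
  show "((\<lambda>x. poly p x * exp (- x\<^sup>2)) has_vector_derivative
      poly (pderiv p - [:0, 2:] * p) x * exp (- x\<^sup>2)) (at x)" for x
    unfolding has_real_derivative_iff_has_vector_derivative[symmetric]
    by (auto intro!: derivative_eq_intros poly_DERIV simp: algebra_simps)
  show "isCont (\<lambda>x. poly (pderiv p - [:0, 2:] * p) x * exp (- x\<^sup>2)) x" for x
    by (intro continuous_intros)
  have le: "norm (poly p x * exp (- x\<^sup>2)) \<le> norm (poly p x * exp (- x\<^sup>2 / 2))" for x
    by (auto simp: abs_mult intro!: mult_left_mono)
  show "((\<lambda>x. poly p x * exp (- x\<^sup>2)) \<longlongrightarrow> 0) at_top"
    by (rule Lim_null_comparison[OF always_eventually tendsto_norm_zero[OF poly_gaussian_half_tendsto_0(1)]])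
       (use le in blast)
  show "((\<lambda>x. poly p x * exp (- x\<^sup>2)) \<longlongrightarrow> 0) at_bot"
    by (rule Lim_null_comparison[OF always_eventually tendsto_norm_zero[OF poly_gaussian_half_tendsto_0(2)]])
       (use le in blast)
qed (rule integrable_poly_gaussian)

text \<open>
  In the Gaussian inner product the raising operator \<open>p \<mapsto> 2 x p - p'\<close> is adjoint to differentiation.
\<close>

lemma gauss_integral_hermite_Suc:
  "gauss_integral (hermite_poly (Suc k) * q) = gauss_integral (hermite_poly k * pderiv q)"
proof -
  have "hermite_poly (Suc k) * q
      = hermite_poly k * pderiv q + smult (-1) (pderiv (hermite_poly k * q) - [:0, 2:] * (hermite_poly k * q))"
    by (simp add: pderiv_mult algebra_simps)
  thus ?thesis by (simp only: gauss_integral_add gauss_integral_smult gauss_integral_by_parts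
    mult_zero_right add_0_right)
qed

lemma gauss_integral_1: "gauss_integral 1 = sqrt pi"
proof -
  have "(\<integral>x. normal_density 0 (1 / sqrt 2) x \<partial>lborel) = 1" by simp
  moreover have "normal_density 0 (1 / sqrt 2) x = (1 / sqrt pi) * exp (- x\<^sup>2)" for x
    by (simp add: normal_density_def power_divide)
  ultimately show ?thesis by (simp add: gauss_integral_def field_simps)
qed

lemma gauss_integral_hermite:
  "gauss_integral (hermite_poly j * hermite_poly k) = (if j = k then 2 ^ k * fact k * sqrt pi else 0)"
proof (induction j arbitrary: k)
  case 0
  show ?case
  proof (cases k)
    case (Suc i)
    have "gauss_integral (hermite_poly (Suc i) * 1) = 0"
      unfolding gauss_integral_hermite_Suc by (simp add: gauss_integral_def)
    thus ?thesis using Suc by simp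
  qed (simp add: gauss_integral_1)
next
  case (Suc j)
  show ?case
  proof (cases k)
    case 0
    thus ?thesis unfolding gauss_integral_hermite_Suc by (simp add: gauss_integral_def)
  next
    case (Suc i)
    have "gauss_integral (hermite_poly (Suc j) * hermite_poly k)
        = 2 * real (Suc i) * gauss_integral (hermite_poly j * hermite_poly i)"
      unfolding gauss_integral_hermite_Suc Suc pderiv_hermite_poly
      by (simp only: mult_smult_right gauss_integral_smult)
    thus ?thesis unfolding Suc.IH Suc by simp
  qed
qed

lemma hermite_fun_eq:
  "hermite_fun n x = (2 ^ (n - 1) * fact (n - 1) * sqrt pi) powr (-1/2)
    * (poly (hermite_poly (n - 1)) x * exp (- x\<^sup>2 / 2))"
  by (simp add: hermite_fun_def hermite_eq_poly)

lemma hermite_fun_measurable [measurable]: "hermite_fun n \<in> borel_measurable borel"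
  unfolding hermite_fun_eq[abs_def] by measurable

lemma integrable_hermite_fun: "integrable lborel (hermite_fun n)"
  unfolding hermite_fun_eq[abs_def] by (intro integrable_mult_right integrable_poly_gaussian_half)

lemma hermite_fun_mult:
  "hermite_fun m x * hermite_fun n x
    = ((2 ^ (m - 1) * fact (m - 1) * sqrt pi) powr (-1/2) * (2 ^ (n - 1) * fact (n - 1) * sqrt pi) powr (-1/2))
      * (poly (hermite_poly (m - 1) * hermite_poly (n - 1)) x * exp (- x\<^sup>2))"
proof -
  have "exp (- x\<^sup>2 / 2) * exp (- x\<^sup>2 / 2) = exp (- x\<^sup>2)" by (simp flip: exp_add)
  thus ?thesis unfolding hermite_fun_eq by (simp add: ac_simps)
qed

lemma hermite_fun_square_integrable: "square_integrable lborel (hermite_fun n)"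
proof -
  have "(norm (hermite_fun n x))\<^sup>2 = hermite_fun n x * hermite_fun n x" for x
    by (simp add: power2_eq_square)
  thus ?thesis
    unfolding square_integrable_def hermite_fun_mult
    by (auto simp del: poly_mult intro!: integrable_mult_right integrable_poly_gaussian)
qed

lemma hermite_fun_orthonormal:
  assumes "1 \<le> m" "1 \<le> n"
  shows "(\<integral>x. hermite_fun m x * hermite_fun n x \<partial>lborel) = (if m = n then 1 else 0)"
proof -
  define c where "c n = 2 ^ (n - 1) * fact (n - 1) * sqrt pi" for n :: nat
  have c: "0 < c n" for n by (simp add: c_def)
  have "(\<integral>x. hermite_fun m x * hermite_fun n x \<partial>lborel)
      = c m powr (-1/2) * c n powr (-1/2) * gauss_integral (hermite_poly (m - 1) * hermite_poly (n - 1))"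
    unfolding hermite_fun_mult gauss_integral_def c_def by (rule integral_mult_right_zero)
  also have "\<dots> = (if m = n then c n powr (-1/2 + -1/2) * c n else 0)"
    using assms unfolding gauss_integral_hermite powr_add by (auto simp: c_def)
  also have "c n powr (-1/2 + -1/2) * c n = 1"
    using c[of n] by (simp add: powr_minus_divide)
  finally show ?thesis .
qed

lemma hermite_fun_fourier:
  "(\<integral>x. exp (- \<i> * of_real (\<xi> * x)) * of_real (hermite_fun n x) \<partial>lborel)
    = sqrt (2 * pi) * (- \<i>) ^ (n - 1) * of_real (hermite_fun n \<xi>)"
proof -
  define c where "c = (2 ^ (n - 1) * fact (n - 1) * sqrt pi) powr (-1/2)"
  have "(\<integral>x. exp (- \<i> * of_real (\<xi> * x)) * of_real (hermite_fun n x) \<partial>lborel)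
      = (\<integral>x. of_real c * (exp (- \<i> * of_real (\<xi> * x))
          * of_real (poly (hermite_poly (n - 1)) x * exp (- x\<^sup>2 / 2))) \<partial>lborel)"
    by (intro Bochner_Integration.integral_cong refl) (simp add: hermite_fun_eq c_def)
  also have "\<dots> = of_real c * gauss_fourier (hermite_poly (n - 1)) \<xi>"
    unfolding gauss_fourier_def by (rule integral_mult_right_zero)
  finally show ?thesis unfolding gauss_fourier_hermite by (simp add: hermite_fun_eq c_def)
qed

section \<open>Mode expansion of the approximate solutions\<close>

text \<open>
  The exponential has modulus \<open>1\<close>. Splitting it into cosine and sine reduces the claim to two real
  Bessel inequalities whose right-hand sides add up by \<open>cos\<^sup>2 + sin\<^sup>2 = 1\<close>.
\<close>

lemma hermite_fourier_bessel:
  fixes b :: "real \<Rightarrow> real"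
  assumes b: "square_integrable lborel b"
  shows "(\<Sum>n=1..N. (cmod (\<integral>\<xi>. exp (\<i> * of_real (\<xi> * x)) * of_real (hermite_fun n \<xi> * b \<xi>) \<partial>lborel))\<^sup>2)
    \<le> (\<integral>\<xi>. (b \<xi>)\<^sup>2 \<partial>lborel)"
proof -
  have bm [measurable]: "b \<in> borel_measurable borel" and b2: "integrable lborel (\<lambda>\<xi>. (b \<xi>)\<^sup>2)"
    using b by (auto simp: square_integrable_def)
  let ?I = "\<lambda>n. \<integral>\<xi>. exp (\<i> * of_real (\<xi> * x)) * of_real (hermite_fun n \<xi> * b \<xi>) \<partial>lborel"
  have sq: "square_integrable lborel (\<lambda>\<xi>. k \<xi> * b \<xi>)"
    if [measurable]: "k \<in> borel_measurable borel" and k: "\<And>\<xi>. \<bar>k \<xi>\<bar> \<le> 1" for k :: "real \<Rightarrow> real"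
  proof -
    have "(k \<xi>)\<^sup>2 * (b \<xi>)\<^sup>2 \<le> (b \<xi>)\<^sup>2" for \<xi>
    proof -
      have "(k \<xi>)\<^sup>2 \<le> 1" using k[of \<xi>] by (simp add: abs_square_le_1)
      thus ?thesis using mult_right_mono[of "(k \<xi>)\<^sup>2" 1 "(b \<xi>)\<^sup>2"] by simp
    qed
    hence "integrable lborel (\<lambda>\<xi>. (k \<xi>)\<^sup>2 * (b \<xi>)\<^sup>2)"
      by (intro Bochner_Integration.integrable_bound[OF b2]) auto
    thus ?thesis by (simp add: square_integrable_def power_mult_distrib)
  qed
  have cos_sq: "square_integrable lborel (\<lambda>\<xi>. cos (\<xi> * x) * b \<xi>)"
    and sin_sq: "square_integrable lborel (\<lambda>\<xi>. sin (\<xi> * x) * b \<xi>)"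
    by (auto intro!: sq)
  have int: "integrable lborel (\<lambda>\<xi>. exp (\<i> * complex_of_real (\<xi> * x)) * of_real (hermite_fun n \<xi> * b \<xi>))" for n
  proof (rule Bochner_Integration.integrable_bound)
    show "integrable lborel (\<lambda>\<xi>. hermite_fun n \<xi> * b \<xi>)"
      by (intro square_integrable_mult hermite_fun_square_integrable b)
  qed (auto simp: norm_mult)
  have "(cmod (?I n))\<^sup>2 = (\<integral>\<xi>. cos (\<xi> * x) * b \<xi> * hermite_fun n \<xi> \<partial>lborel)\<^sup>2
      + (\<integral>\<xi>. sin (\<xi> * x) * b \<xi> * hermite_fun n \<xi> \<partial>lborel)\<^sup>2" for n
  proof -
    have "Re (?I n) = (\<integral>\<xi>. cos (\<xi> * x) * b \<xi> * hermite_fun n \<xi> \<partial>lborel)"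
      by (subst integral_Re[symmetric, OF int], intro Bochner_Integration.integral_cong refl)
         (simp add: Re_exp mult_ac)
    moreover have "Im (?I n) = (\<integral>\<xi>. sin (\<xi> * x) * b \<xi> * hermite_fun n \<xi> \<partial>lborel)"
      by (subst integral_Im[symmetric, OF int], intro Bochner_Integration.integral_cong refl)
         (simp add: Im_exp mult_ac)
    ultimately show ?thesis by (simp only: cmod_power2)
  qed
  hence "(\<Sum>n=1..N. (cmod (?I n))\<^sup>2)
      = (\<Sum>n=1..N. (\<integral>\<xi>. cos (\<xi> * x) * b \<xi> * hermite_fun n \<xi> \<partial>lborel)\<^sup>2)
      + (\<Sum>n=1..N. (\<integral>\<xi>. sin (\<xi> * x) * b \<xi> * hermite_fun n \<xi> \<partial>lborel)\<^sup>2)"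
    by (simp only: sum.distrib)
  also have "\<dots> \<le> (\<integral>\<xi>. (cos (\<xi> * x) * b \<xi>)\<^sup>2 \<partial>lborel) + (\<integral>\<xi>. (sin (\<xi> * x) * b \<xi>)\<^sup>2 \<partial>lborel)"
    by (intro add_mono bessel_inequality cos_sq sin_sq hermite_fun_square_integrable hermite_fun_orthonormal) auto
  also have "\<dots> = (\<integral>\<xi>. (cos (\<xi> * x) * b \<xi>)\<^sup>2 + (sin (\<xi> * x) * b \<xi>)\<^sup>2 \<partial>lborel)"
    using cos_sq sin_sq by (intro Bochner_Integration.integral_add[symmetric]) (auto simp: square_integrable_def)
  also have "(\<lambda>\<xi>. (cos (\<xi> * x) * b \<xi>)\<^sup>2 + (sin (\<xi> * x) * b \<xi>)\<^sup>2) = (\<lambda>\<xi>. (b \<xi>)\<^sup>2)"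
    by (simp add: power_mult_distrib flip: distrib_right)
  finally show ?thesis .
qed

text \<open>
  The coefficient with which the Gaussian variable of the time mode \<open>\<psi>\<close> and the \<open>n\<close>-th Hermite mode
  enters the solution; the factor in the middle is the Fourier transform of the Hermite function.
\<close>

definition mode_coeff :: "(real \<Rightarrow> real) \<Rightarrow> nat \<Rightarrow> real \<Rightarrow> real \<Rightarrow> complex" where
  "mode_coeff \<psi> n t x = 1 / (2 * of_real pi) *
    (\<integral>\<xi>. exp (\<i> * of_real (\<xi> * x)) * (sqrt (2 * pi) * (- \<i>) ^ (n - 1) * of_real (hermite_fun n \<xi>))
      * of_real (tricomi_transform \<psi> t \<xi>) \<partial>lborel)"

lemma integrable_mode_coeff:
  assumes cont: "continuous_on {0..} \<psi>"
  shows "integrable lborel (\<lambda>\<xi>. exp (\<i> * of_real (\<xi> * x))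
    * (complex_of_real (sqrt (2 * pi)) * (- \<i>) ^ k * of_real (hermite_fun n \<xi>)) * of_real (tricomi_transform \<psi> t \<xi>))"
proof -
  note [measurable] = tricomi_transform_measurable[OF cont]
  obtain K where K: "\<And>\<xi>. \<bar>tricomi_transform \<psi> t \<xi>\<bar> \<le> K"
    using tricomi_transform_bounded[OF cont, of t] by blast
  have "integrable lborel (\<lambda>\<xi>. sqrt (2 * pi) * K * hermite_fun n \<xi>)"
    by (intro integrable_mult_right integrable_hermite_fun)
  thus ?thesis
  proof (rule Bochner_Integration.integrable_bound)
    have "norm (exp (\<i> * of_real (\<xi> * x)) * (complex_of_real (sqrt (2 * pi)) * (- \<i>) ^ k * of_real (hermite_fun n \<xi>))
        * of_real (tricomi_transform \<psi> t \<xi>)) \<le> norm (sqrt (2 * pi) * K * hermite_fun n \<xi>)" for \<xi>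
    proof -
      have "sqrt (2 * pi) * \<bar>hermite_fun n \<xi>\<bar> * \<bar>tricomi_transform \<psi> t \<xi>\<bar>
          \<le> sqrt (2 * pi) * \<bar>hermite_fun n \<xi>\<bar> * \<bar>K\<bar>"
        using K[of \<xi>] by (intro mult_left_mono) auto
      thus ?thesis by (simp add: norm_mult norm_power abs_mult mult_ac)
    qed
    thus "AE \<xi> in lborel. norm (exp (\<i> * of_real (\<xi> * x))
        * (complex_of_real (sqrt (2 * pi)) * (- \<i>) ^ k * of_real (hermite_fun n \<xi>))
        * of_real (tricomi_transform \<psi> t \<xi>)) \<le> norm (sqrt (2 * pi) * K * hermite_fun n \<xi>)" by simp
  qed measurable
qed

lemma mode_coeff_diff_sq:
  assumes cont: "continuous_on {0..} \<psi>"
  shows "(cmod (mode_coeff \<psi> n t x - mode_coeff \<psi> n s x))\<^sup>2 = 1 / (2 * pi) *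
    (cmod (\<integral>\<xi>. exp (\<i> * of_real (\<xi> * x)) * of_real (hermite_fun n \<xi> *
      (tricomi_transform \<psi> t \<xi> - tricomi_transform \<psi> s \<xi>)) \<partial>lborel))\<^sup>2"
proof -
  let ?c = "complex_of_real (sqrt (2 * pi)) * (- \<i>) ^ (n - 1)"
  have "mode_coeff \<psi> n t x - mode_coeff \<psi> n s x = 1 / (2 * of_real pi) *
      (\<integral>\<xi>. exp (\<i> * of_real (\<xi> * x)) * (?c * of_real (hermite_fun n \<xi>)) * of_real (tricomi_transform \<psi> t \<xi>)
        - exp (\<i> * of_real (\<xi> * x)) * (?c * of_real (hermite_fun n \<xi>)) * of_real (tricomi_transform \<psi> s \<xi>) \<partial>lborel)"
    unfolding mode_coeff_def
    by (simp only: Bochner_Integration.integral_diff[OF integrable_mode_coeff[OF cont]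
          integrable_mode_coeff[OF cont]] right_diff_distrib)
  also have "(\<lambda>\<xi>. exp (\<i> * of_real (\<xi> * x)) * (?c * of_real (hermite_fun n \<xi>)) * of_real (tricomi_transform \<psi> t \<xi>)
        - exp (\<i> * of_real (\<xi> * x)) * (?c * of_real (hermite_fun n \<xi>)) * of_real (tricomi_transform \<psi> s \<xi>))
      = (\<lambda>\<xi>. ?c * (exp (\<i> * of_real (\<xi> * x)) * of_real (hermite_fun n \<xi> *
          (tricomi_transform \<psi> t \<xi> - tricomi_transform \<psi> s \<xi>))))"
    by (simp add: algebra_simps)
  also have "(\<integral>\<xi>. ?c * (exp (\<i> * of_real (\<xi> * x)) * of_real (hermite_fun n \<xi> *
          (tricomi_transform \<psi> t \<xi> - tricomi_transform \<psi> s \<xi>))) \<partial>lborel)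
      = ?c * (\<integral>\<xi>. exp (\<i> * of_real (\<xi> * x)) * of_real (hermite_fun n \<xi> *
          (tricomi_transform \<psi> t \<xi> - tricomi_transform \<psi> s \<xi>)) \<partial>lborel)"
    by (rule integral_mult_right_zero)
  finally have "cmod (mode_coeff \<psi> n t x - mode_coeff \<psi> n s x) = sqrt (2 * pi) / (2 * pi) *
      cmod (\<integral>\<xi>. exp (\<i> * of_real (\<xi> * x)) * of_real (hermite_fun n \<xi> *
          (tricomi_transform \<psi> t \<xi> - tricomi_transform \<psi> s \<xi>)) \<partial>lborel)"
    by (simp only: norm_mult norm_divide norm_power) simp
  moreover have "(sqrt (2 * pi) / (2 * pi))\<^sup>2 = 1 / (2 * pi)"
    by (simp add: power_divide power2_eq_square)
  ultimately show ?thesis by (simp only: power_mult_distrib)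
qed

lemma integral_sum_sum_mult:
  fixes f :: "'i \<Rightarrow> 'j \<Rightarrow> 'a \<Rightarrow> complex"
  assumes "\<And>i j. i \<in> I \<Longrightarrow> j \<in> J \<Longrightarrow> integrable M (f i j)"
  shows "(\<integral>x. (\<Sum>i\<in>I. \<Sum>j\<in>J. c i j * f i j x) \<partial>M) = (\<Sum>i\<in>I. \<Sum>j\<in>J. c i j * (\<integral>x. f i j x \<partial>M))"
proof -
  have "(\<integral>x. (\<Sum>i\<in>I. \<Sum>j\<in>J. c i j * f i j x) \<partial>M) = (\<Sum>i\<in>I. \<integral>x. (\<Sum>j\<in>J. c i j * f i j x) \<partial>M)"
    by (intro Bochner_Integration.integral_sum Bochner_Integration.integrable_sum integrable_mult_right assms)
  also have "\<dots> = (\<Sum>i\<in>I. \<Sum>j\<in>J. \<integral>x. c i j * f i j x \<partial>M)"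
    by (intro sum.cong refl Bochner_Integration.integral_sum integrable_mult_right assms)
  finally show ?thesis by simp
qed

lemma U_trunc_eq_sum:
  assumes cont: "\<And>m. 1 \<le> m \<Longrightarrow> continuous_on {0..} (\<psi> m)"
  shows "U_trunc \<psi> z N \<omega> t x = (\<Sum>m=1..N. \<Sum>n=1..N. of_real (z m n \<omega>) * mode_coeff (\<psi> m) n t x)"
proof -
  define F where "F n \<xi> = complex_of_real (sqrt (2 * pi)) * (- \<i>) ^ (n - 1) * of_real (hermite_fun n \<xi>)" for n \<xi>
  have hat: "W_trunc_hat \<psi> z N \<omega> s \<xi> = (\<Sum>m=1..N. \<Sum>n=1..N. of_real (\<psi> m s * z m n \<omega>) * F n \<xi>)" for s \<xi>
  proof -
    have "W_trunc_hat \<psi> z N \<omega> s \<xi> = (\<integral>y. (\<Sum>m=1..N. \<Sum>n=1..N. of_real (\<psi> m s * z m n \<omega>) *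
        (exp (- \<i> * of_real (\<xi> * y)) * of_real (hermite_fun n y))) \<partial>lborel)"
      unfolding W_trunc_hat_def W_trunc_def
      by (intro Bochner_Integration.integral_cong refl) (simp add: sum_distrib_left mult_ac)
    also have "\<dots> = (\<Sum>m=1..N. \<Sum>n=1..N. of_real (\<psi> m s * z m n \<omega>) *
        (\<integral>y. exp (- \<i> * of_real (\<xi> * y)) * of_real (hermite_fun n y) \<partial>lborel))"
    proof (rule integral_sum_sum_mult)
      show "integrable lborel (\<lambda>y. exp (- \<i> * complex_of_real (\<xi> * y)) * of_real (hermite_fun n y))" for n
        by (rule Bochner_Integration.integrable_bound[OF integrable_hermite_fun[of n]])
           (auto simp: norm_mult norm_exp_eq_Re)
    qed
    finally show ?thesis unfolding hermite_fun_fourier F_def .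
  qed
  have inner: "(LINT s:{0..t}|lborel. of_real (tricomi_C t s \<bar>\<xi>\<bar>) * W_trunc_hat \<psi> z N \<omega> s \<xi>)
      = (\<Sum>m=1..N. \<Sum>n=1..N. (of_real (z m n \<omega>) * F n \<xi>) * of_real (tricomi_transform (\<psi> m) t \<xi>))" for \<xi>
  proof -
    have "(LINT s:{0..t}|lborel. of_real (tricomi_C t s \<bar>\<xi>\<bar>) * W_trunc_hat \<psi> z N \<omega> s \<xi>)
        = (\<integral>s. (\<Sum>m=1..N. \<Sum>n=1..N. (of_real (z m n \<omega>) * F n \<xi>) *
            of_real (indicator {0..t} s *\<^sub>R (tricomi_C t s \<bar>\<xi>\<bar> * \<psi> m s))) \<partial>lborel)"
      unfolding set_lebesgue_integral_def hat
      by (intro Bochner_Integration.integral_cong refl)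
         (simp add: sum_distrib_left scaleR_conv_of_real mult_ac)
    also have "\<dots> = (\<Sum>m=1..N. \<Sum>n=1..N. (of_real (z m n \<omega>) * F n \<xi>) *
            (\<integral>s. of_real (indicator {0..t} s *\<^sub>R (tricomi_C t s \<bar>\<xi>\<bar> * \<psi> m s)) \<partial>lborel))"
    proof (rule integral_sum_sum_mult)
      fix m assume "m \<in> {1..N}"
      thus "integrable lborel (\<lambda>s. complex_of_real (indicator {0..t} s *\<^sub>R (tricomi_C t s \<bar>\<xi>\<bar> * \<psi> m s)))"
        using set_integrable_tricomi_transform[OF cont, of m t "\<bar>\<xi>\<bar>"]
        by (intro integrable_of_real) (auto simp: set_integrable_def)
    qed
    finally show ?thesis
      unfolding tricomi_transform_def set_lebesgue_integral_def integral_complex_of_real .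
  qed
  have "U_trunc \<psi> z N \<omega> t x = 1 / (2 * of_real pi) * (\<integral>\<xi>. (\<Sum>m=1..N. \<Sum>n=1..N. of_real (z m n \<omega>) *
      (exp (\<i> * of_real (\<xi> * x)) * F n \<xi> * of_real (tricomi_transform (\<psi> m) t \<xi>))) \<partial>lborel)"
    unfolding U_trunc_def inner
    by (intro arg_cong2[where f = "(*)"] Bochner_Integration.integral_cong refl)
       (simp add: sum_distrib_left mult_ac)
  also have "(\<integral>\<xi>. (\<Sum>m=1..N. \<Sum>n=1..N. of_real (z m n \<omega>) *
      (exp (\<i> * of_real (\<xi> * x)) * F n \<xi> * of_real (tricomi_transform (\<psi> m) t \<xi>))) \<partial>lborel)
    = (\<Sum>m=1..N. \<Sum>n=1..N. of_real (z m n \<omega>) *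
      (\<integral>\<xi>. exp (\<i> * of_real (\<xi> * x)) * F n \<xi> * of_real (tricomi_transform (\<psi> m) t \<xi>) \<partial>lborel))"
    unfolding F_def by (rule integral_sum_sum_mult, rule integrable_mode_coeff, rule cont) simp
  finally show ?thesis unfolding mode_coeff_def F_def
    by (simp add: sum_distrib_left mult_ac)
qed

definition incr_frequency_weight :: "real \<Rightarrow> real" where
  "incr_frequency_weight \<epsilon> = (\<integral>\<xi>. (1 + \<xi>\<^sup>2) powr - ((1 + \<epsilon>) / 2) \<partial>lborel)"

text \<open>
  Bessel's inequality is applied twice: for fixed frequency in the time variable of the noise, against
  the \<open>\<psi> m\<close>, and then in the frequency variable, against the Hermite functions. The bound that results
  is the squared norm of the kernel increment in both variables and does not depend on \<open>N\<close>.
\<close>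

lemma mode_coeff_sum_le:
  assumes cont: "\<And>m. 1 \<le> m \<Longrightarrow> continuous_on {0..} (\<psi> m)"
    and sq: "\<And>m. 1 \<le> m \<Longrightarrow> square_integrable (restrict_space lborel {0..}) (\<psi> m)"
    and on: "\<And>m k. 1 \<le> m \<Longrightarrow> 1 \<le> k \<Longrightarrow>
      (\<integral>r. \<psi> m r * \<psi> k r \<partial>restrict_space lborel {0..}) = (if m = k then 1 else 0)"
    and st: "0 \<le> s" "s < t" "t \<le> T" and \<epsilon>: "0 < \<epsilon>" "\<epsilon> < 1/2"
  shows "(\<Sum>m=1..N. \<Sum>n=1..N. (cmod (mode_coeff (\<psi> m) n t x - mode_coeff (\<psi> m) n s x))\<^sup>2)
    \<le> 1 / (2 * pi) * (incr_const T \<epsilon> * incr_time_weight T \<epsilon> * incr_frequency_weight \<epsilon>)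
      * (t - s) powr (1 - 2 * \<epsilon>)"
proof -
  define \<Delta> where "\<Delta> m \<xi> = tricomi_transform (\<psi> m) t \<xi> - tricomi_transform (\<psi> m) s \<xi>" for m \<xi>
  define c where "c = incr_const T \<epsilon> * (t - s) powr (1 - 2 * \<epsilon>) * incr_time_weight T \<epsilon>"
  define w where "w \<xi> = (1 + \<xi>\<^sup>2) powr - ((1 + \<epsilon>) / 2)" for \<xi> :: real
  have w: "integrable lborel (\<lambda>\<xi>. c * w \<xi>)"
    unfolding w_def using \<epsilon> by (intro integrable_mult_right integrable_one_plus_square_powr) simp
  have time: "AE \<xi> in lborel. (\<Sum>m=1..N. (\<Delta> m \<xi>)\<^sup>2) \<le> c * w \<xi>"
    using AE_lborel_singleton[of 0]
  proof eventually_elim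
    case (elim \<xi>)
    hence \<xi>: "0 < \<bar>\<xi>\<bar>" by simp
    have "(\<Sum>m=1..N. (\<Delta> m \<xi>)\<^sup>2)
        = (\<Sum>m=1..N. (\<integral>r. tricomi_increment s t \<bar>\<xi>\<bar> r * \<psi> m r \<partial>restrict_space lborel {0..})\<^sup>2)"
      unfolding \<Delta>_def by (intro sum.cong refl) (simp add: tricomi_transform_increment cont)
    also have "\<dots> \<le> (\<integral>r. (tricomi_increment s t \<bar>\<xi>\<bar> r)\<^sup>2 \<partial>restrict_space lborel {0..})"
      by (intro bessel_inequality tricomi_increment_L2(1)[OF st \<xi> \<epsilon>] sq on) auto
    also have "\<dots> \<le> c * w \<xi>"
      using tricomi_increment_L2(2)[OF st \<xi> \<epsilon>] by (simp add: c_def w_def mult_ac)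
    finally show ?case .
  qed
  have \<Delta>_meas: "\<Delta> m \<in> borel_measurable borel" if "1 \<le> m" for m
    unfolding \<Delta>_def using tricomi_transform_measurable[OF cont[OF that]] by measurable
  have int: "integrable lborel (\<lambda>\<xi>. (\<Delta> m \<xi>)\<^sup>2)" if m: "m \<in> {1..N}" for m
  proof (rule Bochner_Integration.integrable_bound[OF w])
    show "AE \<xi> in lborel. norm ((\<Delta> m \<xi>)\<^sup>2) \<le> norm (c * w \<xi>)"
      using time
    proof eventually_elim
      case (elim \<xi>)
      have "(\<Delta> m \<xi>)\<^sup>2 \<le> (\<Sum>m=1..N. (\<Delta> m \<xi>)\<^sup>2)" using m by (intro member_le_sum) auto
      with elim show ?case by simp
    qed
    have "\<Delta> m \<in> borel_measurable borel" using m \<Delta>_meas by simp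
    thus "(\<lambda>\<xi>. (\<Delta> m \<xi>)\<^sup>2) \<in> borel_measurable lborel" by measurable
  qed
  have space: "(\<Sum>n=1..N. (cmod (mode_coeff (\<psi> m) n t x - mode_coeff (\<psi> m) n s x))\<^sup>2)
      \<le> 1 / (2 * pi) * (\<integral>\<xi>. (\<Delta> m \<xi>)\<^sup>2 \<partial>lborel)" if m: "m \<in> {1..N}" for m
  proof -
    have m1: "1 \<le> m" using m by simp
    have "square_integrable lborel (\<Delta> m)"
      using int[OF m] \<Delta>_meas[OF m1] by (simp add: square_integrable_def)
    note bessel = hermite_fourier_bessel[OF this, of x N]
    show ?thesis
      unfolding mode_coeff_diff_sq[OF cont[OF m1]] sum_distrib_left[symmetric] \<Delta>_def[symmetric]
      by (rule mult_left_mono[OF bessel]) simp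
  qed
  have "(\<Sum>m=1..N. \<Sum>n=1..N. (cmod (mode_coeff (\<psi> m) n t x - mode_coeff (\<psi> m) n s x))\<^sup>2)
      \<le> (\<Sum>m=1..N. 1 / (2 * pi) * (\<integral>\<xi>. (\<Delta> m \<xi>)\<^sup>2 \<partial>lborel))"
    by (intro sum_mono space)
  also have "\<dots> = 1 / (2 * pi) * (\<integral>\<xi>. (\<Sum>m=1..N. (\<Delta> m \<xi>)\<^sup>2) \<partial>lborel)"
    by (simp only: sum_distrib_left[symmetric] Bochner_Integration.integral_sum[OF int])
  also have "\<dots> \<le> 1 / (2 * pi) * (\<integral>\<xi>. c * w \<xi> \<partial>lborel)"
    by (intro mult_left_mono integral_mono_AE w time Bochner_Integration.integrable_sum int) auto
  also have "(\<integral>\<xi>. c * w \<xi> \<partial>lborel) = c * incr_frequency_weight \<epsilon>"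
    unfolding incr_frequency_weight_def w_def by (rule integral_mult_right_zero)
  finally show ?thesis by (simp add: c_def mult_ac)
qed

lemma square_integrable_diff:
  assumes "square_integrable M f" "square_integrable M g"
  shows "integrable M (\<lambda>x. (norm (f x - g x))\<^sup>2)"
proof (rule Bochner_Integration.integrable_bound)
  show "integrable M (\<lambda>x. 2 * (norm (f x))\<^sup>2 + 2 * (norm (g x))\<^sup>2)"
    using assms by (auto simp: square_integrable_def)
  have "(norm (a - b))\<^sup>2 \<le> 2 * (norm a)\<^sup>2 + 2 * (norm b)\<^sup>2" for a b :: 'b
  proof -
    have "(norm (a - b))\<^sup>2 \<le> (norm a + norm b)\<^sup>2" by (intro power_mono norm_triangle_ineq4) simp
    also have "\<dots> \<le> 2 * (norm a)\<^sup>2 + 2 * (norm b)\<^sup>2"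
      using zero_le_power2[of "norm a - norm b"] unfolding power2_sum power2_diff by linarith
    finally show ?thesis .
  qed
  thus "AE x in M. norm ((norm (f x - g x))\<^sup>2) \<le> norm (2 * (norm (f x))\<^sup>2 + 2 * (norm (g x))\<^sup>2)"
    by auto
  show "(\<lambda>x. (norm (f x - g x))\<^sup>2) \<in> borel_measurable M"
    using assms by (auto simp: square_integrable_def)
qed

text \<open>
  The increments of the real parts of the approximations are Gaussian sums whose variance is bounded
  uniformly in \<open>N\<close>, so all their even moments are, and the bound passes to the mean square limit. The
  summand \<open>1\<close> in \<open>v\<close> keeps the variance bound positive.
\<close>

lemma tricomi_solution_increment_moment:
  fixes z :: "nat \<Rightarrow> nat \<Rightarrow> 'a \<Rightarrow> real"
  assumes M: "prob_space M"
    and cont: "\<And>m. 1 \<le> m \<Longrightarrow> continuous_on {0..} (\<psi> m)"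
    and onb: "orthonormal_basis_L2 (restrict_space lborel {0..}) \<psi>"
    and gauss: "\<forall>m\<ge>1. \<forall>n\<ge>1. distributed M lborel (z m n) std_normal_density"
    and indep: "prob_space.indep_vars M (\<lambda>_. borel) (\<lambda>(m, n). z m n) ({1..} \<times> {1..})"
    and U: "tricomi_solution M \<psi> z U"
    and st: "0 \<le> s" "s < t" "t \<le> T" and \<epsilon>: "0 < \<epsilon>" "\<epsilon> < 1/2"
  defines "v \<equiv> (1 / (2 * pi) * (incr_const T \<epsilon> * incr_time_weight T \<epsilon> * incr_frequency_weight \<epsilon>) + 1)
    * (t - s) powr (1 - 2 * \<epsilon>)"
  shows "(\<integral>\<^sup>+\<omega>. ennreal ((U t x \<omega> - U s x \<omega>) ^ (2 * p)) \<partial>M)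
    \<le> ennreal (2 * fact (2 * p) * exp (1 / 2) * v ^ p)"
proof -
  interpret prob_space M by (rule M)
  have tr: "U \<tau> x \<in> borel_measurable M"
      "L2_tendsto M (\<lambda>N \<omega>. U_trunc \<psi> z N \<omega> \<tau> x) (\<lambda>\<omega>. complex_of_real (U \<tau> x \<omega>))" if "0 \<le> \<tau>" for \<tau>
    using U that unfolding tricomi_solution_def by auto
  have t0: "0 \<le> t" using st by simp
  define Y where "Y \<omega> = U t x \<omega> - U s x \<omega>" for \<omega>
  define X where "X N \<omega> = Re (U_trunc \<psi> z N \<omega> t x - U_trunc \<psi> z N \<omega> s x)" for N \<omega>
  define R where "R \<tau> N \<omega> = (norm (U_trunc \<psi> z N \<omega> \<tau> x - complex_of_real (U \<tau> x \<omega>)))\<^sup>2" for \<tau> N \<omega>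
  have R: "integrable M (R \<tau> N)" "(\<lambda>N. \<integral>\<omega>. R \<tau> N \<omega> \<partial>M) \<longlonglongrightarrow> 0" if "0 \<le> \<tau>" for \<tau> N
    using tr(2)[OF that] unfolding L2_tendsto_def R_def by (auto intro: square_integrable_diff)
  have tr_meas: "(\<lambda>\<omega>. U_trunc \<psi> z N \<omega> \<tau> x) \<in> borel_measurable M" if "0 \<le> \<tau>" for N \<tau>
    using tr(2)[OF that] by (auto simp: L2_tendsto_def square_integrable_def)
  have X_meas: "X N \<in> borel_measurable M" for N
    unfolding X_def[abs_def] using tr_meas[OF t0] tr_meas[OF st(1)] by measurable
  have Y_meas: "Y \<in> borel_measurable M"
    unfolding Y_def[abs_def] using tr(1)[OF t0] tr(1)[OF st(1)] by measurable
  have XY: "(X N \<omega> - Y \<omega>)\<^sup>2 \<le> 2 * R t N \<omega> + 2 * R s N \<omega>" for N \<omega>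
  proof -
    define A where "A \<tau> = U_trunc \<psi> z N \<omega> \<tau> x - complex_of_real (U \<tau> x \<omega>)" for \<tau>
    have "X N \<omega> - Y \<omega> = Re (A t - A s)" by (simp add: X_def Y_def A_def)
    hence "\<bar>X N \<omega> - Y \<omega>\<bar> \<le> norm (A t) + norm (A s)"
      using abs_Re_le_cmod[of "A t - A s"] norm_triangle_ineq4[of "A t" "A s"] by linarith
    hence "\<bar>X N \<omega> - Y \<omega>\<bar>\<^sup>2 \<le> (norm (A t) + norm (A s))\<^sup>2" by (intro power_mono) auto
    also have "\<dots> \<le> 2 * (norm (A t))\<^sup>2 + 2 * (norm (A s))\<^sup>2"
      using zero_le_power2[of "norm (A t) - norm (A s)"] unfolding power2_sum power2_diff by linarith
    finally show ?thesis by (simp add: R_def A_def)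
  qed
  have int_bound: "integrable M (\<lambda>\<omega>. 2 * R t N \<omega> + 2 * R s N \<omega>)" for N
    using R(1)[OF t0] R(1)[OF st(1)] by auto
  have XY_int: "integrable M (\<lambda>\<omega>. (X N \<omega> - Y \<omega>)\<^sup>2)" for N
  proof (rule Bochner_Integration.integrable_bound[OF int_bound])
    show "(\<lambda>\<omega>. (X N \<omega> - Y \<omega>)\<^sup>2) \<in> borel_measurable M" using X_meas Y_meas by measurable
    show "AE \<omega> in M. norm ((X N \<omega> - Y \<omega>)\<^sup>2) \<le> norm (2 * R t N \<omega> + 2 * R s N \<omega>)"
      using XY[of N] by (auto intro: order_trans[OF _ abs_ge_self])
  qed
  have XY_lim: "(\<lambda>N. \<integral>\<omega>. (X N \<omega> - Y \<omega>)\<^sup>2 \<partial>M) \<longlonglongrightarrow> 0"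
  proof (rule tendsto_sandwich[OF _ _ tendsto_const])
    show "\<forall>\<^sub>F N in sequentially. (\<integral>\<omega>. (X N \<omega> - Y \<omega>)\<^sup>2 \<partial>M) \<le> 2 * (\<integral>\<omega>. R t N \<omega> \<partial>M) + 2 * (\<integral>\<omega>. R s N \<omega> \<partial>M)"
    proof (intro always_eventually allI)
      fix N
      have "(\<integral>\<omega>. (X N \<omega> - Y \<omega>)\<^sup>2 \<partial>M) \<le> (\<integral>\<omega>. 2 * R t N \<omega> + 2 * R s N \<omega> \<partial>M)"
        by (intro integral_mono XY_int int_bound XY)
      thus "(\<integral>\<omega>. (X N \<omega> - Y \<omega>)\<^sup>2 \<partial>M) \<le> 2 * (\<integral>\<omega>. R t N \<omega> \<partial>M) + 2 * (\<integral>\<omega>. R s N \<omega> \<partial>M)"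
        using R(1)[OF t0] R(1)[OF st(1)] by simp
    qed
    have "(\<lambda>N. 2 * (\<integral>\<omega>. R t N \<omega> \<partial>M) + 2 * (\<integral>\<omega>. R s N \<omega> \<partial>M)) \<longlonglongrightarrow> 2 * 0 + 2 * 0"
      by (intro tendsto_intros R(2) t0 st(1))
    thus "(\<lambda>N. 2 * (\<integral>\<omega>. R t N \<omega> \<partial>M) + 2 * (\<integral>\<omega>. R s N \<omega> \<partial>M)) \<longlonglongrightarrow> 0" by simp
  qed simp
  have "(\<integral>\<^sup>+\<omega>. ennreal (X N \<omega> ^ (2 * p)) \<partial>M) \<le> ennreal (2 * fact (2 * p) * exp (1 / 2) * v ^ p)" for N
  proof -
    define I where "I = {1..N} \<times> {1..N}"
    define Z where "Z = (\<lambda>(m, n). z m n)"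
    define c where "c = (\<lambda>(m, n). Re (mode_coeff (\<psi> m) n t x - mode_coeff (\<psi> m) n s x))"
    have X: "X N \<omega> = (\<Sum>i\<in>I. c i * Z i \<omega>)" for \<omega>
    proof -
      have U_sum: "U_trunc \<psi> z N \<omega> \<tau> x
          = (\<Sum>m=1..N. \<Sum>n=1..N. of_real (z m n \<omega>) * mode_coeff (\<psi> m) n \<tau> x)" for \<tau>
        by (rule U_trunc_eq_sum) (rule cont)
      have "X N \<omega> = Re (\<Sum>m=1..N. \<Sum>n=1..N.
          of_real (z m n \<omega>) * (mode_coeff (\<psi> m) n t x - mode_coeff (\<psi> m) n s x))"
        unfolding X_def U_sum
        by (simp only: right_diff_distrib sum_subtractf)
      also have "\<dots> = (\<Sum>m=1..N. \<Sum>n=1..N. c (m, n) * Z (m, n) \<omega>)"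
        by (simp add: c_def Z_def Re_sum mult.commute)
      also have "\<dots> = (\<Sum>i\<in>I. c i * Z i \<omega>)"
        unfolding I_def by (subst sum.cartesian_product) (simp add: case_prod_unfold)
      finally show ?thesis .
    qed
    have "(\<Sum>i\<in>I. (c i)\<^sup>2) = (\<Sum>m=1..N. \<Sum>n=1..N. (c (m, n))\<^sup>2)"
      unfolding I_def by (subst sum.cartesian_product) (simp add: case_prod_unfold)
    also have "\<dots> \<le> (\<Sum>m=1..N. \<Sum>n=1..N. (cmod (mode_coeff (\<psi> m) n t x - mode_coeff (\<psi> m) n s x))\<^sup>2)"
    proof (intro sum_mono)
      show "(c (m, n))\<^sup>2 \<le> (cmod (mode_coeff (\<psi> m) n t x - mode_coeff (\<psi> m) n s x))\<^sup>2" for m n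
        using abs_Re_le_cmod[of "mode_coeff (\<psi> m) n t x - mode_coeff (\<psi> m) n s x"]
        by (simp add: c_def abs_le_square_iff[symmetric])
    qed
    also have "\<dots> \<le> 1 / (2 * pi) * (incr_const T \<epsilon> * incr_time_weight T \<epsilon> * incr_frequency_weight \<epsilon>)
      * (t - s) powr (1 - 2 * \<epsilon>)"
      using onb by (intro mode_coeff_sum_le cont st \<epsilon>) (auto simp: orthonormal_basis_L2_def)
    also have "\<dots> \<le> v" unfolding v_def by (intro mult_right_mono) auto
    finally have var: "(\<Sum>i\<in>I. (c i)\<^sup>2) \<le> v" .
    have "0 \<le> incr_const T \<epsilon>" "0 \<le> incr_time_weight T \<epsilon>" "0 \<le> incr_frequency_weight \<epsilon>"
      by (auto simp: incr_const_def incr_time_weight_def incr_frequency_weight_def)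
    hence v: "0 < v" unfolding v_def using st by (intro mult_pos_pos add_nonneg_pos) auto
    have "indep_vars (\<lambda>_. borel) Z I"
      unfolding Z_def I_def by (rule indep_vars_subset[OF indep]) auto
    moreover have "distributed M lborel (Z i) std_normal_density" if "i \<in> I" for i
      using that gauss by (auto simp: Z_def I_def)
    ultimately show ?thesis
      unfolding X using gaussian_sum_moment[OF _ _ _ var v, of Z p] by (simp add: I_def)
  qed
  hence "(\<integral>\<^sup>+\<omega>. ennreal (Y \<omega> ^ (2 * p)) \<partial>M) \<le> ennreal (2 * fact (2 * p) * exp (1 / 2) * v ^ p)"
    by (rule L2_limit_moment_bound[OF X_meas Y_meas XY_int XY_lim])
  thus ?thesis by (simp add: Y_def)
qed

section \<open>Regularity of the solution in time\<close>

lemma smooth_within_imp_continuous_on: "smooth_within S f \<Longrightarrow> continuous_on S f"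
proof -
  assume "smooth_within S f"
  then obtain D where D: "\<And>t. t \<in> S \<Longrightarrow> D 0 t = f t"
    "\<And>t. t \<in> S \<Longrightarrow> (D 0 has_real_derivative D (Suc 0) t) (at t within S)"
    unfolding smooth_within_def by blast
  have "continuous_on S (D 0)"
    unfolding continuous_on_eq_continuous_within using D(2) by (auto intro: DERIV_continuous)
  thus ?thesis using D(1) by (simp cong: continuous_on_cong)
qed

theorem corollary1p3:
  fixes M :: "'a measure"
    and \<psi> :: "nat \<Rightarrow> real \<Rightarrow> real"
    and z :: "nat \<Rightarrow> nat \<Rightarrow> 'a \<Rightarrow> real"
    and U :: "real \<Rightarrow> real \<Rightarrow> 'a \<Rightarrow> real"
  assumes "prob_space M"
    and "\<forall>m\<ge>1. smooth_within {0..} (\<psi> m)"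
    and "orthonormal_basis_L2 (restrict_space lborel {0..}) \<psi>"
    and "\<forall>m\<ge>1. \<forall>n\<ge>1. distributed M lborel (z m n) std_normal_density"
    and "prob_space.indep_vars M (\<lambda>_. borel) (\<lambda>(m, n). z m n) ({1..} \<times> {1..})"
    and "tricomi_solution M \<psi> z U"
  shows "\<forall>x. \<exists>V :: real \<Rightarrow> 'a \<Rightarrow> real.
           modification_on M {0..} V (\<lambda>t. U t x) \<and>
           (\<forall>\<omega>\<in>space M. continuous_on {0..} (\<lambda>t. V t \<omega>) \<and>
              (\<forall>\<gamma> T. 0 < \<gamma> \<longrightarrow> \<gamma> < 1/2 \<longrightarrow> 0 < T \<longrightarrow> hoelder_on \<gamma> {0..T} (\<lambda>t. V t \<omega>)))"
proof
  fix x :: real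
  have cont: "continuous_on {0..} (\<psi> m)" if "1 \<le> m" for m
    using assms(2) that by (auto intro: smooth_within_imp_continuous_on)
  show "\<exists>V :: real \<Rightarrow> 'a \<Rightarrow> real.
           modification_on M {0..} V (\<lambda>t. U t x) \<and>
           (\<forall>\<omega>\<in>space M. continuous_on {0..} (\<lambda>t. V t \<omega>) \<and>
              (\<forall>\<gamma> T. 0 < \<gamma> \<longrightarrow> \<gamma> < 1/2 \<longrightarrow> 0 < T \<longrightarrow> hoelder_on \<gamma> {0..T} (\<lambda>t. V t \<omega>)))"
  proof (rule kolmogorov_chentsov)
    show "U t x \<in> borel_measurable M" if "0 \<le> t" for t
      using assms(6) that by (simp add: tricomi_solution_def)
    fix \<gamma> :: real and N :: nat assume \<gamma>: "0 < \<gamma>" "\<gamma> < 1/2"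
    \<comment> \<open>moments of order \<open>2 p\<close> yield every exponent below \<open>(1/2 - \<epsilon>) - 1 / (2 p)\<close>, so \<open>\<epsilon>\<close> and \<open>p\<close>
      are taken with \<open>2 \<epsilon> = 1/2 - \<gamma>\<close> and \<open>p (1/2 - \<gamma>) > 1\<close>\<close>
    define \<epsilon> where "\<epsilon> = (1/2 - \<gamma>) / 2"
    have \<epsilon>: "0 < \<epsilon>" "\<epsilon> < 1/2" "1 - 2 * \<epsilon> = 1/2 + \<gamma>" using \<gamma> by (auto simp: \<epsilon>_def field_simps)
    obtain p :: nat where p: "1 / (1/2 - \<gamma>) < real p" using reals_Archimedean2 by blast
    hence p': "1 < (1/2 - \<gamma>) * real p" using \<gamma> by (simp add: field_simps)
    have p0: "0 < p" using p' by (cases p) auto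
    define C where "C = 1 / (2 * pi) * (incr_const (real N) \<epsilon> * incr_time_weight (real N) \<epsilon>
      * incr_frequency_weight \<epsilon>) + 1"
    define K where "K = 2 * fact (2 * p) * exp (1 / 2) * C ^ p"
    have "0 \<le> incr_const (real N) \<epsilon>" "0 \<le> incr_time_weight (real N) \<epsilon>" "0 \<le> incr_frequency_weight \<epsilon>"
      by (auto simp: incr_const_def incr_time_weight_def incr_frequency_weight_def)
    hence "0 \<le> C" unfolding C_def by auto
    hence K: "0 \<le> K" by (simp add: K_def)
    have "(\<integral>\<^sup>+\<omega>. ennreal (\<bar>U t x \<omega> - U s x \<omega>\<bar> powr real (2 * p)) \<partial>M)
        \<le> ennreal (K * (t - s) powr (1 + ((1/2 + \<gamma>) * real p - 1)))"
      if st: "s \<in> {0..real N}" "t \<in> {0..real N}" "s < t" for s t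
    proof -
      have "\<bar>a\<bar> powr real (2 * p) = a ^ (2 * p)" for a :: real
        using p0 by (cases "a = 0") (auto simp: powr_realpow power_even_abs simp del: of_nat_mult)
      hence "(\<integral>\<^sup>+\<omega>. ennreal (\<bar>U t x \<omega> - U s x \<omega>\<bar> powr real (2 * p)) \<partial>M)
          = (\<integral>\<^sup>+\<omega>. ennreal ((U t x \<omega> - U s x \<omega>) ^ (2 * p)) \<partial>M)" by (simp only:)
      also have "\<dots> \<le> ennreal (2 * fact (2 * p) * exp (1 / 2) * (C * (t - s) powr (1 - 2 * \<epsilon>)) ^ p)"
        unfolding C_def using st \<epsilon>
        by (intro tricomi_solution_increment_moment[OF assms(1) cont assms(3-6)]) auto
      also have "2 * fact (2 * p) * exp (1 / 2) * (C * (t - s) powr (1 - 2 * \<epsilon>)) ^ p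
          = K * (t - s) powr ((1/2 + \<gamma>) * real p)"
      proof -
        have "((t - s) powr (1/2 + \<gamma>)) ^ p = (t - s) powr ((1/2 + \<gamma>) * real p)"
          using st by (subst powr_powr[symmetric]) (simp add: powr_realpow)
        thus ?thesis unfolding \<epsilon>(3) power_mult_distrib K_def by (simp only: mult.assoc)
      qed
      finally show ?thesis by simp
    qed
    moreover have "\<gamma> * real (2 * p) < (1/2 + \<gamma>) * real p - 1" using p' by (simp add: algebra_simps)
    ultimately show "\<exists>q \<beta> K. 0 < q \<and> \<gamma> * q < \<beta> \<and> 0 \<le> K \<and>
      (\<forall>s\<in>{0..real N}. \<forall>t\<in>{0..real N}. s < t \<longrightarrow>
        (\<integral>\<^sup>+\<omega>. ennreal (\<bar>U t x \<omega> - U s x \<omega>\<bar> powr q) \<partial>M) \<le> ennreal (K * (t - s) powr (1 + \<beta>)))"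
      using K p0 by (intro exI[of _ "real (2 * p)"] exI[of _ "(1/2 + \<gamma>) * real p - 1"] exI[of _ K]) auto
  qed simp
qed

end
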